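(* Let $p>q$ be co-prime positive integers. For any Schoen–Wolfson cone $C_{p,q}\subset\mathbb{C}^2$ with $q>1$, there exists a Hamiltonian stationary self-similar eternal Brakke motion $V_t$, $-\infty<t<\infty$, in $\mathbb{C}^2=\mathbb{R}^4$ such that $V_t$ approaches $C_{p,q}$ as $t\to0$ from either direction.
   Context: Ambient space. $\mathbb{C}^2$ has coordinates $z^j=x^j+\sqrt{-1}\,y^j$, the Euclidean metric, the standard symplectic form $\omega=\sum_j dx^j\wedge dy^j$, and the standard almost complex structure $J$ with $J\partial_{x^j}=\partial_{y^j}$. Schoen–Wolfson cone. For co-prime positive integers $p,q$, $C_{p,q}$ is the cone $\{y\,\gamma_{pq}(\theta): y\ge 0,\ 0\le\theta<2\pi\}$ over the closed embedded curve $\gamma_{pq}(\theta)=\left(\sqrt{\tfrac{q}{p+q}}\,e^{ip\theta},\ i\sqrt{\tfrac{p}{p+q}}\,e^{-iq\theta}\right)$ in $S^3$. Lagrangian notions. On a Lagrangian submanifold $\Sigma$, the Lagrangian angle $\beta$ is defined by $*_\Sigma(dz^1\wedge dz^2)=e^{i\beta}$, where $*_\Sigma$ is the Hodge star operator on $\Sigma$; the mean curvature vector is $H=J\nabla\beta$, with $\nabla$ the gradient on $\Sigma$. $\Sigma$ is Hamiltonian stationary if $\Delta\beta=0$, where $\Delta$ is the Laplace operator on $\Sigma$. $\Sigma$ is a self-similar solution if $F^\perp=2cH$ for some constant $c$, where $F^\perp$ is the normal projection of the position vector $F$; it is a self-shrinker if $c<0$ and a self-expander if $c>0$. Brakke motion.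 For a varifold $V$, $\|V\|$ is its mass measure and $h(V)$ its generalized mean curvature vector. Put $\delta(V,\phi)(h(V))=-\int\phi|h(V)|^2\,d\|V\|+\int D\phi\cdot h(V)\,d\|V\|$ (with value $-\infty$ if $\int\phi|h(V)|^2\,d\|V\|=\infty$). A family of varifolds $V_t$ in $\mathbb{R}^n$ forms a solution of the Brakke motion if $\bar D\|V_t\|(\phi)\le\delta(V_t,\phi)(h(V_t))$ for every $t$ and every $\phi\in C^1_0(\mathbb{R}^n)$ (compactly supported $C^1$ functions) with $\phi\ge0$, where $\bar D\|V_t\|(\phi)=\limsup_{t_1\to t}\frac{\|V_{t_1}\|(\phi)-\|V_t\|(\phi)}{t_1-t}$. "Without mass loss" means that equality holds in this inequality. "$V_t$ approaches" a varifold $V_0$ as $t\to0$ means that $\|V_t\|$ converges to $\|V_0\|$ as Radon measures; the cone $C_{p,q}$ is regarded as a varifold of multiplicity one. Hamiltonian stationary self-similar eternal Brakke motion. This is a solution $V_t$, $-\infty<t<\infty$, of the Brakke motion without mass loss such that $V_t$ for $t<0$ is a smooth Hamiltonian stationary self-shrinker and $V_t$ for $t>0$ is a smooth Hamiltonian stationary self-expander.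
   Formalization: "Smooth" shrinker/expander means a proper smooth oriented Lagrangian immersion of a surface that may have boundary; half-sheets meet in a balanced circle. Without boundary the claim fails: the Lagrangian angle winds p−q≠0 times round the link of the cone, which would bound. *)

theory Defs
  imports "HOL-Analysis.Analysis"
begin

section \<open>Smooth maps\<close>

text \<open>Meant for an open set \<open>S\<close>. In finite dimension, continuity of all directional
  derivatives is continuity of the derivative, so this is the usual class \<open>C\<^sup>k\<close>.\<close>

primrec higher_differentiable_on ::
  "'a::real_normed_vector set \<Rightarrow> ('a \<Rightarrow> 'b::real_normed_vector) \<Rightarrow> nat \<Rightarrow> bool" where
  "higher_differentiable_on S f 0 \<longleftrightarrow> continuous_on S f"
| "higher_differentiable_on S f (Suc k) \<longleftrightarrow>
     (\<forall>x\<in>S. f differentiable (at x)) \<and>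
     (\<forall>v. higher_differentiable_on S (\<lambda>x. frechet_derivative f (at x) v) k)"

definition smooth_on :: "'a::real_normed_vector set \<Rightarrow> ('a \<Rightarrow> 'b::real_normed_vector) \<Rightarrow> bool" where
  "smooth_on S f \<longleftrightarrow> (\<forall>k. higher_differentiable_on S f k)"

definition compactly_supported :: "('a::topological_space \<Rightarrow> 'b::zero) \<Rightarrow> bool" where
  "compactly_supported f \<longleftrightarrow> (\<exists>K. compact K \<and> (\<forall>x. x \<notin> K \<longrightarrow> f x = 0))"

definition C1_compact :: "('a::euclidean_space \<Rightarrow> 'b::real_normed_vector) \<Rightarrow> bool" where
  "C1_compact f \<longleftrightarrow> higher_differentiable_on UNIV f 1 \<and> compactly_supported f"


section \<open>Varifolds and Brakke motion\<close>

text \<open>A \<open>k\<close>-plane is represented by the orthogonal projection onto it; this embeds the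
  Grassmannian as a compact set of linear maps.\<close>

definition grassmannian :: "nat \<Rightarrow> ('a::euclidean_space \<Rightarrow>\<^sub>L 'a) set" where
  "grassmannian k =
     {P :: 'a \<Rightarrow>\<^sub>L 'a. (\<forall>x. P (P x) = P x) \<and> (\<forall>x y. P x \<bullet> y = x \<bullet> P y) \<and> dim (range P) = k}"

definition plane_proj :: "'a::euclidean_space set \<Rightarrow> ('a \<Rightarrow>\<^sub>L 'a)" where
  "plane_proj T = (THE P. P \<in> grassmannian (dim T) \<and> range P = T)"

type_synonym 'a varifold = "('a \<times> ('a \<Rightarrow>\<^sub>L 'a)) measure"

definition is_varifold :: "nat \<Rightarrow> 'a::euclidean_space varifold \<Rightarrow> bool" where
  "is_varifold k V \<longleftrightarrow> sets V = sets borel \<and>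
     emeasure V (UNIV \<times> (- grassmannian k)) = 0 \<and>
     (\<forall>K. compact K \<longrightarrow> emeasure V (K \<times> UNIV) < \<infinity>)"

definition mass_measure :: "'a::euclidean_space varifold \<Rightarrow> 'a measure" where
  "mass_measure V = distr V borel fst"

definition mass :: "'a::euclidean_space varifold \<Rightarrow> ('a \<Rightarrow> real) \<Rightarrow> real" where
  "mass V \<phi> = (\<integral>x. \<phi> x \<partial>mass_measure V)"

text \<open>The divergence of \<open>X\<close> along the plane with projection \<open>P\<close> is the trace of \<open>DX \<circ> P\<close>.\<close>

definition first_variation :: "'a::euclidean_space varifold \<Rightarrow> ('a \<Rightarrow> 'a) \<Rightarrow> real" where
  "first_variation V X =
     (\<integral>(x, P). (\<Sum>b\<in>Basis. frechet_derivative X (at x) (blinfun_apply P b) \<bullet> b) \<partial>V)"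

definition generalized_mean_curvature :: "'a::euclidean_space varifold \<Rightarrow> ('a \<Rightarrow> 'a) \<Rightarrow> bool" where
  "generalized_mean_curvature V h \<longleftrightarrow>
     h \<in> borel_measurable borel \<and>
     (\<forall>K. compact K \<longrightarrow> set_integrable (mass_measure V) K h) \<and>
     (\<forall>X. C1_compact X \<longrightarrow> first_variation V X = - (\<integral>x. X x \<bullet> h x \<partial>mass_measure V))"

definition brakke_delta :: "'a::euclidean_space varifold \<Rightarrow> ('a \<Rightarrow> real) \<Rightarrow> ('a \<Rightarrow> 'a) \<Rightarrow> ereal" where
  "brakke_delta V \<phi> h =
     (if (\<integral>\<^sup>+x. ennreal (\<phi> x * (norm (h x))\<^sup>2) \<partial>mass_measure V) = \<infinity> then - \<infinity>
      else ereal (- (\<integral>x. \<phi> x * (norm (h x))\<^sup>2 \<partial>mass_measure V)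
                  + (\<integral>x. frechet_derivative \<phi> (at x) (h x) \<partial>mass_measure V)))"

definition upper_mass_derivative ::
  "(real \<Rightarrow> 'a::euclidean_space varifold) \<Rightarrow> real \<Rightarrow> ('a \<Rightarrow> real) \<Rightarrow> ereal" where
  "upper_mass_derivative V t \<phi> =
     Limsup (at t) (\<lambda>s. ereal ((mass (V s) \<phi> - mass (V t) \<phi>) / (s - t)))"

text \<open>The generalized mean curvature is determined almost everywhere with respect to the mass
  measure, so the choice of \<open>h\<close> does not matter. Its existence at every time is part of the
  definition; in particular the first variation has no singular part.\<close>

definition brakke_motion :: "nat \<Rightarrow> (real \<Rightarrow> 'a::euclidean_space varifold) \<Rightarrow> bool" where
  "brakke_motion k V \<longleftrightarrow> (\<forall>t. is_varifold k (V t) \<and>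
     (\<exists>h. generalized_mean_curvature (V t) h \<and>
        (\<forall>\<phi>. C1_compact \<phi> \<and> (\<forall>x. 0 \<le> \<phi> x) \<longrightarrow>
           upper_mass_derivative V t \<phi> \<le> brakke_delta (V t) \<phi> h)))"

definition without_mass_loss :: "(real \<Rightarrow> 'a::euclidean_space varifold) \<Rightarrow> bool" where
  "without_mass_loss V \<longleftrightarrow> (\<forall>t h \<phi>. generalized_mean_curvature (V t) h \<longrightarrow>
     C1_compact \<phi> \<and> (\<forall>x. 0 \<le> \<phi> x) \<longrightarrow>
     upper_mass_derivative V t \<phi> = brakke_delta (V t) \<phi> h)"

text \<open>Convergence of the mass measures as Radon measures.\<close>

definition approaches ::
  "('t \<Rightarrow> 'a::euclidean_space varifold) \<Rightarrow> 'a varifold \<Rightarrow> 't filter \<Rightarrow> bool" where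
  "approaches V W \<F> \<longleftrightarrow> (\<forall>\<phi>. continuous_on UNIV \<phi> \<and> compactly_supported \<phi> \<longrightarrow>
     ((\<lambda>t. mass (V t) \<phi>) \<longlongrightarrow> mass W \<phi>) \<F>)"


section \<open>Oriented surfaces\<close>

abbreviation pd1 :: "(real \<times> real \<Rightarrow> 'a::real_normed_vector) \<Rightarrow> real \<times> real \<Rightarrow> 'a" where
  "pd1 f u \<equiv> frechet_derivative f (at u) (1, 0)"

abbreviation pd2 :: "(real \<times> real \<Rightarrow> 'a::real_normed_vector) \<Rightarrow> real \<times> real \<Rightarrow> 'a" where
  "pd2 f u \<equiv> frechet_derivative f (at u) (0, 1)"

definition half_plane :: "(real \<times> real) set" where
  "half_plane = {u. 0 \<le> fst u}"

text \<open>Surfaces may have boundary. They are realised as smooth submanifolds \<open>M\<close> of a Euclidean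
  space. A chart is a pair \<open>(W, \<psi>)\<close> with \<open>W\<close> open in the plane; only the part
  \<open>W \<inter> half_plane\<close> parametrises a piece of \<open>M\<close>, while the rest of \<open>W\<close> gives
  room for two-sided derivatives at boundary points.\<close>

type_synonym 'm chart = "(real \<times> real) set \<times> (real \<times> real \<Rightarrow> 'm)"

definition oriented_surface :: "'m::euclidean_space set \<Rightarrow> 'm chart set \<Rightarrow> bool" where
  "oriented_surface M \<A> \<longleftrightarrow>
     M = (\<Union>(W, \<psi>)\<in>\<A>. \<psi> ` (W \<inter> half_plane)) \<and>
     (\<forall>(W, \<psi>)\<in>\<A>. open W \<and> smooth_on W \<psi> \<and>
        (\<forall>u\<in>W \<inter> half_plane. inj (frechet_derivative \<psi> (at u))) \<and>
        openin (top_of_set M) (\<psi> ` (W \<inter> half_plane)) \<and>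
        (\<exists>\<kappa>. homeomorphism (W \<inter> half_plane) (\<psi> ` (W \<inter> half_plane)) \<psi> \<kappa>)) \<and>
     (\<forall>(W, \<psi>)\<in>\<A>. \<forall>(W', \<psi>')\<in>\<A>. \<forall>u\<in>W \<inter> half_plane. \<forall>u'\<in>W' \<inter> half_plane.
        \<psi> u = \<psi>' u' \<longrightarrow>
        (\<exists>a b c d. pd1 \<psi> u = a *\<^sub>R pd1 \<psi>' u' + b *\<^sub>R pd2 \<psi>' u' \<and>
                   pd2 \<psi> u = c *\<^sub>R pd1 \<psi>' u' + d *\<^sub>R pd2 \<psi>' u' \<and> a * d - b * c > 0))"

definition proper_immersion ::
  "'m::euclidean_space set \<Rightarrow> 'm chart set \<Rightarrow> ('m \<Rightarrow> 'a::euclidean_space) \<Rightarrow> bool" where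
  "proper_immersion M \<A> F \<longleftrightarrow>
     (\<exists>N. open N \<and> M \<subseteq> N \<and> smooth_on N F) \<and>
     (\<forall>(W, \<psi>)\<in>\<A>. \<forall>u\<in>W \<inter> half_plane. inj (frechet_derivative (F \<circ> \<psi>) (at u))) \<and>
     (\<forall>K. compact K \<longrightarrow> compact (M \<inter> F -` K))"

definition tangent_plane :: "(real \<times> real \<Rightarrow> 'a::euclidean_space) \<Rightarrow> real \<times> real \<Rightarrow> 'a set" where
  "tangent_plane f u = span {pd1 f u, pd2 f u}"

definition area_density :: "(real \<times> real \<Rightarrow> 'a::euclidean_space) \<Rightarrow> real \<times> real \<Rightarrow> real" where
  "area_density f u =
     sqrt ((pd1 f u \<bullet> pd1 f u) * (pd2 f u \<bullet> pd2 f u) - (pd1 f u \<bullet> pd2 f u)\<^sup>2)"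

text \<open>\<open>\<mu>\<close> is the area measure of the metric on \<open>M\<close> induced by \<open>F\<close>; sheets of the immersion
  that overlap in the image are counted with multiplicity.\<close>

definition surface_varifold ::
  "'m::euclidean_space set \<Rightarrow> 'm chart set \<Rightarrow> ('m \<Rightarrow> 'a::euclidean_space) \<Rightarrow> 'a varifold \<Rightarrow> bool"
  where
  "surface_varifold M \<A> F V \<longleftrightarrow> (\<exists>\<mu> P.
     sets \<mu> = sets (restrict_space borel M) \<and>
     (\<forall>(W, \<psi>)\<in>\<A>.
        (\<forall>B\<in>sets borel. B \<subseteq> W \<inter> half_plane \<longrightarrow>
           emeasure \<mu> (\<psi> ` B) = (\<integral>\<^sup>+u\<in>B. ennreal (area_density (F \<circ> \<psi>) u) \<partial>lborel)) \<and>
        (\<forall>u\<in>W \<inter> half_plane. P (\<psi> u) = plane_proj (tangent_plane (F \<circ> \<psi>) u))) \<and>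
     V = distr \<mu> borel (\<lambda>x. (F x, P x)))"

text \<open>For \<open>f\<close> an injective immersion on \<open>U\<close>, this is the multiplicity one varifold of the
  surface \<open>f ` U\<close>.\<close>

definition param_varifold ::
  "(real \<times> real) set \<Rightarrow> (real \<times> real \<Rightarrow> 'a::euclidean_space) \<Rightarrow> 'a varifold" where
  "param_varifold U f =
     distr (density (restrict_space lborel U) (\<lambda>u. ennreal (area_density f u))) borel
       (\<lambda>u. (f u, plane_proj (tangent_plane f u)))"


section \<open>Lagrangian geometry in complex 2-space\<close>

type_synonym C2 = "complex \<times> complex"

definition J :: "C2 \<Rightarrow> C2" where
  "J v = (\<i> * fst v, \<i> * snd v)"

definition symplectic_form :: "C2 \<Rightarrow> C2 \<Rightarrow> real" where
  "symplectic_form v w = (Re (fst v) * Im (fst w) - Im (fst v) * Re (fst w))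
         + (Re (snd v) * Im (snd w) - Im (snd v) * Re (snd w))"

definition dz12 :: "C2 \<Rightarrow> C2 \<Rightarrow> complex" where
  "dz12 v w = fst v * snd w - snd v * fst w"

text \<open>The remaining notions are local; \<open>f\<close> is the immersion read in a positively oriented chart.
  The Hodge star of a 2-form is its value on an oriented basis divided by the area of that
  basis. As the angle is only defined modulo \<open>2\<pi>\<close>, \<open>\<beta>\<close> is a smooth local branch.
  Derivatives of \<open>\<beta>\<close> at points of the half plane are determined by its values there.\<close>

definition lagrangian_angle_near ::
  "(real \<times> real \<Rightarrow> C2) \<Rightarrow> real \<times> real \<Rightarrow> (real \<times> real \<Rightarrow> real) \<Rightarrow> bool" where
  "lagrangian_angle_near f u \<beta> \<longleftrightarrow> (\<exists>N. open N \<and> u \<in> N \<and> smooth_on N \<beta> \<and>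
     (\<forall>v\<in>N \<inter> half_plane. dz12 (pd1 f v) (pd2 f v) / of_real (area_density f v) = cis (\<beta> v)))"

text \<open>Components of the gradient with respect to the coordinate frame, by inverting the metric
  matrix.\<close>

definition grad1 :: "(real \<times> real \<Rightarrow> C2) \<Rightarrow> (real \<times> real \<Rightarrow> real) \<Rightarrow> real \<times> real \<Rightarrow> real" where
  "grad1 f \<beta> u = ((pd2 f u \<bullet> pd2 f u) * pd1 \<beta> u - (pd1 f u \<bullet> pd2 f u) * pd2 \<beta> u)
                  / (area_density f u)\<^sup>2"

definition grad2 :: "(real \<times> real \<Rightarrow> C2) \<Rightarrow> (real \<times> real \<Rightarrow> real) \<Rightarrow> real \<times> real \<Rightarrow> real" where
  "grad2 f \<beta> u = ((pd1 f u \<bullet> pd1 f u) * pd2 \<beta> u - (pd1 f u \<bullet> pd2 f u) * pd1 \<beta> u)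
                  / (area_density f u)\<^sup>2"

definition surface_gradient ::
  "(real \<times> real \<Rightarrow> C2) \<Rightarrow> (real \<times> real \<Rightarrow> real) \<Rightarrow> real \<times> real \<Rightarrow> C2" where
  "surface_gradient f \<beta> u = grad1 f \<beta> u *\<^sub>R pd1 f u + grad2 f \<beta> u *\<^sub>R pd2 f u"

definition surface_laplacian ::
  "(real \<times> real \<Rightarrow> C2) \<Rightarrow> (real \<times> real \<Rightarrow> real) \<Rightarrow> real \<times> real \<Rightarrow> real" where
  "surface_laplacian f \<beta> u =
     (pd1 (\<lambda>v. area_density f v * grad1 f \<beta> v) u + pd2 (\<lambda>v. area_density f v * grad2 f \<beta> v) u)
     / area_density f u"

definition lagrangian_immersion :: "'m::euclidean_space set \<Rightarrow> 'm chart set \<Rightarrow> ('m \<Rightarrow> C2) \<Rightarrow> bool" where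
  "lagrangian_immersion M \<A> F \<longleftrightarrow> proper_immersion M \<A> F \<and>
     (\<forall>(W, \<psi>)\<in>\<A>. \<forall>u\<in>W \<inter> half_plane. symplectic_form (pd1 (F \<circ> \<psi>) u) (pd2 (F \<circ> \<psi>) u) = 0)"

definition hamiltonian_stationary :: "'m::euclidean_space chart set \<Rightarrow> ('m \<Rightarrow> C2) \<Rightarrow> bool" where
  "hamiltonian_stationary \<A> F \<longleftrightarrow> (\<forall>(W, \<psi>)\<in>\<A>. \<forall>u\<in>W \<inter> half_plane.
     \<exists>\<beta>. lagrangian_angle_near (F \<circ> \<psi>) u \<beta> \<and> surface_laplacian (F \<circ> \<psi>) \<beta> u = 0)"

text \<open>The equation \<open>F\<^sup>\<bottom> = 2 c H\<close> with \<open>H = J \<nabla>\<beta>\<close>.\<close>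

definition self_similar :: "'m::euclidean_space chart set \<Rightarrow> ('m \<Rightarrow> C2) \<Rightarrow> real \<Rightarrow> bool" where
  "self_similar \<A> F c \<longleftrightarrow> (\<forall>(W, \<psi>)\<in>\<A>. \<forall>u\<in>W \<inter> half_plane.
     \<exists>\<beta>. lagrangian_angle_near (F \<circ> \<psi>) u \<beta> \<and>
         F (\<psi> u) - plane_proj (tangent_plane (F \<circ> \<psi>) u) (F (\<psi> u))
           = (2 * c) *\<^sub>R J (surface_gradient (F \<circ> \<psi>) \<beta> u))"

text \<open>The abstract surface is taken inside a real 5-space, which by Whitney's embedding theorem
  is no restriction. It may have boundary: several boundary arcs of the immersed surface may then
  be mapped to the same curve. Such a seam must be balanced for the varifold to have a generalized
  mean curvature vector.\<close>

type_synonym R5 = "complex \<times> complex \<times> real"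

definition smooth_hs_self_similar :: "C2 varifold \<Rightarrow> real \<Rightarrow> bool" where
  "smooth_hs_self_similar V c \<longleftrightarrow> (\<exists>(M :: R5 set) \<A> F.
     oriented_surface M \<A> \<and> lagrangian_immersion M \<A> F \<and>
     hamiltonian_stationary \<A> F \<and> self_similar \<A> F c \<and> surface_varifold M \<A> F V)"

definition hs_self_shrinker :: "C2 varifold \<Rightarrow> bool" where
  "hs_self_shrinker V \<longleftrightarrow> (\<exists>c<0. smooth_hs_self_similar V c)"

definition hs_self_expander :: "C2 varifold \<Rightarrow> bool" where
  "hs_self_expander V \<longleftrightarrow> (\<exists>c>0. smooth_hs_self_similar V c)"

definition hs_self_similar_eternal_brakke_motion :: "(real \<Rightarrow> C2 varifold) \<Rightarrow> bool" where
  "hs_self_similar_eternal_brakke_motion V \<longleftrightarrow>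
     brakke_motion 2 V \<and> without_mass_loss V \<and>
     (\<forall>t<0. hs_self_shrinker (V t)) \<and> (\<forall>t>0. hs_self_expander (V t))"


section \<open>Schoen--Wolfson cones\<close>

definition sw_curve :: "nat \<Rightarrow> nat \<Rightarrow> real \<Rightarrow> C2" where
  "sw_curve p q \<theta> =
     (of_real (sqrt (real q / real (p + q))) * cis (real p * \<theta>),
      \<i> * of_real (sqrt (real p / real (p + q))) * cis (- (real q * \<theta>)))"

definition sw_param :: "nat \<Rightarrow> nat \<Rightarrow> real \<times> real \<Rightarrow> C2" where
  "sw_param p q = (\<lambda>(y, \<theta>). y *\<^sub>R sw_curve p q \<theta>)"

definition sw_cone :: "nat \<Rightarrow> nat \<Rightarrow> C2 set" where
  "sw_cone p q = sw_param p q ` ({0..} \<times> {0..<2 * pi})"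

definition sw_cone_varifold :: "nat \<Rightarrow> nat \<Rightarrow> C2 varifold" where
  "sw_cone_varifold p q = param_varifold ({0<..} \<times> {0..<2 * pi}) (sw_param p q)"

lemma norm_sw_curve:
  assumes "0 < p" "0 < q"
  shows "norm (sw_curve p q \<theta>) = 1"
  using assms by (simp add: sw_curve_def norm_Pair norm_mult add_divide_distrib [symmetric])

lemma sw_curve_inj:
  assumes "0 < p" "0 < q" "coprime p q"
  shows "inj_on (sw_curve p q) {0..<2 * pi}"
proof (rule inj_onI)
  fix \<theta> \<theta>' assume th: "\<theta> \<in> {0..<2 * pi}" "\<theta>' \<in> {0..<2 * pi}"
    and eq: "sw_curve p q \<theta> = sw_curve p q \<theta>'"
  define d where "d = \<theta> - \<theta>'"
  have e1: "cis (real p * \<theta>) = cis (real p * \<theta>')"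
    and e2: "cis (- (real q * \<theta>)) = cis (- (real q * \<theta>'))"
    using eq assms by (auto simp: sw_curve_def)
  have "cis (real p * d) = 1"
    using e1 by (simp add: d_def right_diff_distrib cis_divide [symmetric])
  then obtain m :: int where m: "real p * d = of_int m * 2 * pi"
    by (auto simp: cis_conv_exp exp_eq_1 mult_ac)
  have "cis (real q * d) = 1"
    using arg_cong [OF e2, of inverse] by (simp add: d_def right_diff_distrib cis_divide [symmetric])
  then obtain n :: int where n: "real q * d = of_int n * 2 * pi"
    by (auto simp: cis_conv_exp exp_eq_1 mult_ac)
  obtain a b :: int where ab: "a * int p + b * int q = 1"
    using bezout_int [of "int p" "int q"] assms(3) by auto
  have "d = (of_int a * real p + of_int b * real q) * d"
    using arg_cong [OF ab, of real_of_int] by simp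
  also have "\<dots> = of_int a * (real p * d) + of_int b * (real q * d)"
    by (simp add: algebra_simps)
  also have "\<dots> = of_int (a * m + b * n) * (2 * pi)"
    unfolding m n by (simp add: algebra_simps)
  finally have d: "d = of_int (a * m + b * n) * (2 * pi)" .
  have "\<bar>d\<bar> < 1 * (2 * pi)" using th by (auto simp: d_def)
  then have "\<bar>real_of_int (a * m + b * n)\<bar> < 1"
    unfolding d abs_mult by simp
  then have "a * m + b * n = 0" by linarith
  then show "\<theta> = \<theta>'" using d by (simp add: d_def)
qed

text \<open>The parametrisation covers the cone away from its vertex exactly once, so
  \<open>sw_cone_varifold\<close> has multiplicity one.\<close>

lemma bij_betw_sw_param:
  assumes "0 < p" "0 < q" "coprime p q"
  shows "bij_betw (sw_param p q) ({0<..} \<times> {0..<2 * pi}) (sw_cone p q - {0})"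
  unfolding bij_betw_def
proof
  note nrm = norm_sw_curve [OF assms(1,2)]
  have nz: "sw_curve p q \<theta> \<noteq> 0" for \<theta> using nrm [of \<theta>] by auto
  show "inj_on (sw_param p q) ({0<..} \<times> {0..<2 * pi})"
  proof (rule inj_onI)
    fix u v assume u: "u \<in> {0<..} \<times> {0..<2 * pi}" and v: "v \<in> {0<..} \<times> {0..<2 * pi}"
      and "sw_param p q u = sw_param p q v"
    then have eq: "fst u *\<^sub>R sw_curve p q (snd u) = fst v *\<^sub>R sw_curve p q (snd v)"
      by (simp add: sw_param_def case_prod_beta)
    from arg_cong [OF eq, of norm] have y: "fst u = fst v" using u v nrm by auto
    with eq u have "sw_curve p q (snd u) = sw_curve p q (snd v)" by auto
    moreover have "snd u \<in> {0..<2 * pi}" "snd v \<in> {0..<2 * pi}" using u v by auto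
    ultimately have "snd u = snd v" by (rule inj_onD [OF sw_curve_inj [OF assms]])
    with y show "u = v" by (simp add: prod_eq_iff)
  qed
  show "sw_param p q ` ({0<..} \<times> {0..<2 * pi}) = sw_cone p q - {0}"
  proof -
    have z: "sw_param p q u = 0 \<longleftrightarrow> fst u = 0" for u
      using nz by (simp add: sw_param_def case_prod_beta)
    have "({0<..} \<times> {0..<2 * pi}) = {u \<in> {0..} \<times> {0..<2 * pi}. fst u \<noteq> (0::real)}"
      by auto
    then show ?thesis unfolding sw_cone_def using z by auto
  qed
qed

end

theory Submission
  imports Defs
begin

text \<open>The circle acts on \<open>\<complex>\<^sup>2\<close> with weights \<open>p\<close> and \<open>-q\<close>, and the cone is swept out by the orbits with
  radii \<open>(a, b)\<close> on a ray \<open>p a\<^sup>2 = q b\<^sup>2\<close>. The motion replaces the ray by the arcs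
  \<open>p a\<^sup>2 - q b\<^sup>2 = - 2 (p - q) t\<close> of hyperbolas in the quadrant \<open>a, b \<ge> 0\<close>. Constancy of
  \<open>p a\<^sup>2 - q b\<^sup>2\<close> along the arc is exactly the Lagrangian condition. The Lagrangian angle of such a
  surface is \<open>(p - q) \<theta>\<close>, where \<open>\<theta>\<close> is the angle of the circle action; the surface metric does not
  depend on \<open>\<theta>\<close>, so the angle is harmonic. Both \<open>J\<close> of its gradient and the normal part of the
  position vector are multiples of \<open>J\<close> applied to the velocity of the action, and comparing the
  factors gives the self-similar equation with the constant \<open>c = t\<close>: shrinkers for \<open>t < 0\<close>,
  expanders for \<open>t > 0\<close>.

  Each surface is a half cylinder. Its boundary orbit has \<open>b = 0\<close> for \<open>t < 0\<close> and \<open>a = 0\<close> for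
  \<open>t > 0\<close>, hence covers a circle \<open>p\<close> times and \<open>q\<close> times respectively. The conormals of the sheets
  that meet over a point of this circle are the vertices of a regular polygon, and they cancel as
  soon as there are at least two sheets (\<open>seam_balanced\<close>). This is where \<open>q > 1\<close> enters: without
  it the first variation would have a part concentrated on the circle. With it, an integration by
  parts over the half strip identifies the generalized mean curvature (\<open>first_variation_V\<close>), and
  this vector is given by one vector field on \<open>\<complex>\<^sup>2\<close> for all times, \<open>sw_mean_curvature\<close>.

  For \<open>t \<noteq> 0\<close> Brakke's inequality is an equality because the explicit parametrisation differs
  from the normal motion by a tangential field, which changes the mass integrals by a divergence
  only (\<open>mass_derivative_integrand\<close>). At \<open>t = 0\<close> the squared curvature of the cone is of the order of
  \<open>1 / r\<^sup>2\<close>. If the test function is positive at the vertex, the dissipation of the cone is infinite,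
  and by Fatou's lemma the dissipations at times \<open>t \<rightarrow> 0\<close> tend to infinity. If the test function vanishes
  there, it is of order \<open>r\<close>, and dominated convergence applies from both sides of the singular time. In both
  cases l'Hospital's rule carries the derivative of the mass to \<open>t = 0\<close> (\<open>upper_mass_derivative_V\<close>).
  Continuity of the masses at \<open>t = 0\<close> is dominated convergence as well, and it is the convergence to
  the cone.

  The absence of mass loss concerns every generalized mean curvature vector, so its uniqueness
  almost everywhere is needed; it follows by approximating the indicators of open boxes by
  compactly supported \<open>C\<^sup>1\<close> functions (\<open>generalized_mean_curvature_unique\<close>).\<close>


section \<open>Calculus of smooth maps\<close>

lemma higher_differentiable_cong:
  assumes "open S" "\<And>x. x \<in> S \<Longrightarrow> f x = g x" "higher_differentiable_on S f k"
  shows "higher_differentiable_on S g k"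
  using assms(2,3)
proof (induction k arbitrary: f g)
  case 0
  then show ?case by (simp cong: continuous_on_cong)
next
  case (Suc k)
  have d: "(g has_derivative frechet_derivative f (at x)) (at x)" if "x \<in> S" for x
  proof -
    have "(f has_derivative frechet_derivative f (at x)) (at x)"
      using Suc.prems(2) that by (simp add: frechet_derivative_works)
    then show ?thesis
      by (rule has_derivative_transform_within_open [OF _ assms(1) that]) (simp add: Suc.prems)
  qed
  have "higher_differentiable_on S (\<lambda>x. frechet_derivative g (at x) v) k" for v
  proof (rule Suc.IH)
    show "higher_differentiable_on S (\<lambda>x. frechet_derivative f (at x) v) k"
      using Suc.prems(2) by simp
    show "frechet_derivative f (at x) v = frechet_derivative g (at x) v" if "x \<in> S" for x
      using frechet_derivative_at [OF d [OF that]] by simp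
  qed
  then show ?case using d by (auto simp: differentiable_def)
qed

text \<open>The recursion of \<^const>\<open>higher_differentiable_on\<close> mentions the chosen derivative; this
  introduction rule accepts any formula for it.\<close>

lemma higher_differentiable_SucI:
  assumes "open S" "\<And>x. x \<in> S \<Longrightarrow> (f has_derivative f' x) (at x)"
    and "\<And>v. higher_differentiable_on S (\<lambda>x. f' x v) k"
  shows "higher_differentiable_on S f (Suc k)"
proof -
  have "higher_differentiable_on S (\<lambda>x. frechet_derivative f (at x) v) k" for v
    by (rule higher_differentiable_cong [OF assms(1) _ assms(3) [of v]])
      (use frechet_derivative_at [OF assms(2)] in auto)
  then show ?thesis using assms(2) by (auto simp: differentiable_def)
qed

lemma higher_differentiable_SucD:
  assumes "higher_differentiable_on S f (Suc k)"
  shows "\<And>x. x \<in> S \<Longrightarrow> (f has_derivative frechet_derivative f (at x)) (at x)"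
    and "higher_differentiable_on S (\<lambda>x. frechet_derivative f (at x) v) k"
  using assms by (auto simp: frechet_derivative_works)

lemma higher_differentiable_pred:
  assumes "higher_differentiable_on S f (Suc k)"
  shows "higher_differentiable_on S f k"
  using assms
proof (induction k arbitrary: f)
  case 0
  then have "f differentiable (at x)" if "x \<in> S" for x using that by simp
  then show ?case
    by (auto intro!: continuous_at_imp_continuous_on differentiable_imp_continuous_within)
next
  case (Suc k)
  have "higher_differentiable_on S (\<lambda>x. frechet_derivative f (at x) v) k" for v
    by (rule Suc.IH) (rule higher_differentiable_SucD(2) [OF Suc.prems])
  moreover have "\<forall>x\<in>S. f differentiable (at x)"
    using Suc.prems unfolding higher_differentiable_on.simps(2) [of S f "Suc k"] by blast
  ultimately show ?case unfolding higher_differentiable_on.simps(2) [of S f k] by blast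
qed

lemma higher_differentiable_const: "open S \<Longrightarrow> higher_differentiable_on S (\<lambda>x. c) k"
proof (induction k arbitrary: c)
  case (Suc k)
  show ?case by (rule higher_differentiable_SucI [where f' = "\<lambda>x v. 0"]) (use Suc in auto)
qed simp

lemma higher_differentiable_add:
  assumes "open S" "higher_differentiable_on S f k" "higher_differentiable_on S g k"
  shows "higher_differentiable_on S (\<lambda>x. f x + g x) k"
  using assms(2,3)
proof (induction k arbitrary: f g)
  case 0
  then show ?case by (simp add: continuous_on_add)
next
  case (Suc k)
  show ?case
    by (rule higher_differentiable_SucI [OF assms(1) has_derivative_add])
      (assumption | rule Suc.IH higher_differentiable_SucD [OF Suc.prems(1)]
        higher_differentiable_SucD [OF Suc.prems(2)])+
qed

lemma higher_differentiable_bilinear: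
  assumes "open S" "bounded_bilinear B"
    and "higher_differentiable_on S f k" "higher_differentiable_on S g k"
  shows "higher_differentiable_on S (\<lambda>x. B (f x) (g x)) k"
  using assms(3,4)
proof (induction k arbitrary: f g)
  case 0
  then show ?case by (simp add: bounded_bilinear.continuous_on [OF assms(2)])
next
  case (Suc k)
  note f = higher_differentiable_SucD [OF Suc.prems(1)] higher_differentiable_pred [OF Suc.prems(1)]
  note g = higher_differentiable_SucD [OF Suc.prems(2)] higher_differentiable_pred [OF Suc.prems(2)]
  show ?case
    by (rule higher_differentiable_SucI [OF assms(1) bounded_bilinear.FDERIV [OF assms(2)]])
      (assumption | rule higher_differentiable_add assms(1) Suc.IH f g)+
qed

lemma higher_differentiable_linear:
  assumes "open S" "bounded_linear L"
  shows "higher_differentiable_on S L k"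
proof (cases k)
  case 0
  then show ?thesis by (simp add: linear_continuous_on assms)
next
  case (Suc n)
  show ?thesis unfolding Suc
    by (rule higher_differentiable_SucI [where f' = "\<lambda>x. L"])
      (rule assms bounded_linear_imp_has_derivative higher_differentiable_const)+
qed

lemma higher_differentiable_linear_comp:
  assumes "open S" "bounded_linear L" "higher_differentiable_on S f k"
  shows "higher_differentiable_on S (\<lambda>x. L (f x)) k"
  using assms(3)
proof (induction k arbitrary: f)
  case 0
  then show ?case by (simp add: bounded_linear.continuous_on [OF assms(2)])
next
  case (Suc k)
  show ?case
    by (rule higher_differentiable_SucI [OF assms(1) bounded_linear.has_derivative [OF assms(2)]])
      (assumption | rule Suc.IH higher_differentiable_SucD [OF Suc.prems(1)])+
qed

lemma smooth_on_const: "open S \<Longrightarrow> smooth_on S (\<lambda>x. c)"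
  by (simp add: smooth_on_def higher_differentiable_const)

lemma smooth_on_linear: "open S \<Longrightarrow> bounded_linear L \<Longrightarrow> smooth_on S L"
  by (simp add: smooth_on_def higher_differentiable_linear)

lemma smooth_on_linear_comp:
  "open S \<Longrightarrow> bounded_linear L \<Longrightarrow> smooth_on S f \<Longrightarrow> smooth_on S (\<lambda>x. L (f x))"
  by (simp add: smooth_on_def higher_differentiable_linear_comp)

lemma smooth_on_add:
  "open S \<Longrightarrow> smooth_on S f \<Longrightarrow> smooth_on S g \<Longrightarrow> smooth_on S (\<lambda>x. f x + g x)"
  by (simp add: smooth_on_def higher_differentiable_add)

lemma smooth_on_mult:
  fixes f g :: "'a::real_normed_vector \<Rightarrow> 'b::real_normed_algebra"
  shows "open S \<Longrightarrow> smooth_on S f \<Longrightarrow> smooth_on S g \<Longrightarrow> smooth_on S (\<lambda>x. f x * g x)"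
  by (simp add: smooth_on_def higher_differentiable_bilinear [OF _ bounded_bilinear_mult])

lemma smooth_on_power:
  fixes f :: "'a::real_normed_vector \<Rightarrow> 'b::real_normed_algebra_1"
  shows "open S \<Longrightarrow> smooth_on S f \<Longrightarrow> smooth_on S (\<lambda>x. f x ^ n)"
  by (induction n) (auto intro!: smooth_on_mult smooth_on_const)

lemma smooth_on_Pair:
  fixes f :: "'a::real_normed_vector \<Rightarrow> 'b::real_normed_vector"
    and g :: "'a \<Rightarrow> 'c::real_normed_vector"
  assumes "open S" "smooth_on S f" "smooth_on S g"
  shows "smooth_on S (\<lambda>x. (f x, g x))"
proof -
  have "bounded_linear (\<lambda>y::'b. (y, 0::'c))" "bounded_linear (\<lambda>y::'c. (0::'b, y))"
    by (rule bounded_linear_Pair bounded_linear_ident bounded_linear_zero)+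
  from smooth_on_add [OF assms(1) smooth_on_linear_comp [OF assms(1) this(1) assms(2)]
      smooth_on_linear_comp [OF assms(1) this(2) assms(3)]]
  show ?thesis by simp
qed

text \<open>The derivative is expressed through the function itself, so each order of differentiability
  gives the next one.\<close>

lemma smooth_on_cis:
  assumes "open S" "bounded_linear L"
  shows "smooth_on S (\<lambda>x. cis (L x))"
  unfolding smooth_on_def
proof
  fix k
  have d: "((\<lambda>x. cis (L x)) has_derivative (\<lambda>v. of_real (L v) * (\<i> * cis (L x)))) (at x)" for x
    using has_derivative_cis [OF bounded_linear_imp_has_derivative [OF assms(2)]]
    by (simp add: scaleR_conv_of_real)
  show "higher_differentiable_on S (\<lambda>x. cis (L x)) k"
  proof (induction k)
    case 0
    have "continuous_on S L" by (simp add: linear_continuous_on assms)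
    then show ?case by (auto intro!: continuous_intros)
  next
    case (Suc k)
    have "higher_differentiable_on S (\<lambda>x. of_real (L v) * (\<i> * cis (L x))) k" for v
      by (rule higher_differentiable_bilinear [OF assms(1) bounded_bilinear_mult] Suc
          higher_differentiable_const [OF assms(1)])+
    then show ?case
      by (rule higher_differentiable_SucI [OF assms(1), where f' = "\<lambda>x v. of_real (L v) * (\<i> * cis (L x))", OF d])
  qed
qed

text \<open>The same bootstrap works for \<open>g = 1 / sqrt Q\<close>. Here the equation is \<open>g' = - Q' g\<^sup>3 / 2\<close>, and \<open>sqrt Q = Q g\<close>.\<close>

lemma smooth_on_sqrt:
  fixes Q :: "'a::real_normed_vector \<Rightarrow> real"
  assumes "open S" "smooth_on S Q" "\<And>x. x \<in> S \<Longrightarrow> 0 < Q x"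
  shows "smooth_on S (\<lambda>x. sqrt (Q x))"
proof -
  have Q: "higher_differentiable_on S Q k" for k using assms(2) by (simp add: smooth_on_def)
  define g where "g = (\<lambda>x. inverse (sqrt (Q x)))"
  define g' where "g' = (\<lambda>x v. (- 1 / 2) * (frechet_derivative Q (at x) v * (g x * (g x * g x))))"
  have d: "(g has_derivative g' x) (at x)"
    if x: "x \<in> S" for x
  proof -
    have *: "((\<lambda>y. inverse (sqrt y)) has_real_derivative (- 1 / 2) * (g x * (g x * g x))) (at (Q x))"
      using assms(3) [OF x] by (auto intro!: derivative_eq_intros simp: g_def field_simps)
    have "(Q has_derivative frechet_derivative Q (at x)) (at x)"
      by (rule higher_differentiable_SucD(1) [OF Q x])
    from DERIV_compose_FDERIV [OF * this] show ?thesis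
      unfolding g_def g'_def by (simp add: mult_ac)
  qed
  have "higher_differentiable_on S g k" for k
  proof (induction k)
    case 0
    have "continuous_on S Q" using Q [of 0] by simp
    then show ?case using assms(3) by (force simp: g_def intro!: continuous_intros)
  next
    case (Suc k)
    have "higher_differentiable_on S
        (\<lambda>x. (- 1 / 2) * (frechet_derivative Q (at x) v * (g x * (g x * g x)))) k" for v
      by (rule higher_differentiable_bilinear [OF assms(1) bounded_bilinear_mult] Suc
          higher_differentiable_const [OF assms(1)] higher_differentiable_SucD(2) [OF Q])+
    then have "higher_differentiable_on S (\<lambda>x. g' x v) k" for v
      by (simp add: g'_def)
    with d show ?case by (rule higher_differentiable_SucI [OF assms(1)])
  qed
  then have "higher_differentiable_on S (\<lambda>x. Q x * g x) k" for k
    by (intro higher_differentiable_bilinear [OF assms(1) bounded_bilinear_mult] Q)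
  moreover have "Q x * g x = sqrt (Q x)" if "x \<in> S" for x
    using assms(3) [OF that] by (simp add: g_def field_simps)
  ultimately show ?thesis
    unfolding smooth_on_def
    using higher_differentiable_cong [OF assms(1), of "\<lambda>x. Q x * g x" "\<lambda>x. sqrt (Q x)"] by blast
qed


section \<open>Projections onto planes\<close>

text \<open>The projection onto the plane of an orthogonal frame that need not be normalised.\<close>

definition frame_proj :: "'a::euclidean_space \<Rightarrow> 'a \<Rightarrow> ('a \<Rightarrow>\<^sub>L 'a)" where
  "frame_proj v w =
     inverse (v \<bullet> v) *\<^sub>R (blinfun_scaleR_left v o\<^sub>L blinfun_inner_right v)
     + inverse (w \<bullet> w) *\<^sub>R (blinfun_scaleR_left w o\<^sub>L blinfun_inner_right w)"

lemma frame_proj_apply: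
  "frame_proj v w x = (inverse (v \<bullet> v) * (v \<bullet> x)) *\<^sub>R v + (inverse (w \<bullet> w) * (w \<bullet> x)) *\<^sub>R w"
  by (simp add: frame_proj_def blinfun.bilinear_simps)

lemma continuous_on_frame_proj:
  assumes "continuous_on S v" "continuous_on S w" "\<And>x. x \<in> S \<Longrightarrow> v x \<noteq> 0" "\<And>x. x \<in> S \<Longrightarrow> w x \<noteq> 0"
  shows "continuous_on S (\<lambda>x. frame_proj (v x) (w x))"
  unfolding frame_proj_def
  by (intro continuous_intros assms bounded_linear.continuous_on [OF bounded_linear_blinfun_scaleR_left]
      bounded_linear.continuous_on [OF bounded_linear_blinfun_inner_right]
      bounded_bilinear.continuous_on [OF bounded_bilinear_blinfun_compose]) (use assms in auto)

lemma frame_proj_grassmannian: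
  assumes "v \<noteq> 0" "w \<noteq> 0" "v \<bullet> w = 0"
  shows "frame_proj v w \<in> grassmannian 2" "range (frame_proj v w) = span {v, w}"
proof -
  let ?P = "frame_proj v w"
  have wv: "w \<bullet> v = 0" using assms(3) by (simp add: inner_commute)
  have Pv: "?P v = v" and Pw: "?P w = w"
    using assms wv by (simp_all add: frame_proj_apply)
  have in_span: "?P x \<in> span {v, w}" for x
    unfolding frame_proj_apply by (intro span_add span_scale span_base) auto
  have id: "?P x = x" if "x \<in> span {v, w}" for x
    using that by (induction rule: span_induct_alt) (auto simp: blinfun.bilinear_simps Pv Pw)
  show r: "range ?P = span {v, w}"
  proof (rule equalityI)
    show "range ?P \<subseteq> span {v, w}" using in_span by auto
    show "span {v, w} \<subseteq> range ?P" using id by (metis rangeI subsetI)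
  qed
  have "v \<noteq> w" using assms by auto
  moreover have "independent {v, w}"
    by (rule pairwise_orthogonal_independent)
      (use assms wv in \<open>auto simp: pairwise_def orthogonal_def\<close>)
  ultimately have "dim (span {v, w}) = 2" by (simp add: dim_eq_card_independent)
  moreover have "?P x \<bullet> y = x \<bullet> ?P y" for x y
    by (simp add: frame_proj_apply algebra_simps inner_commute)
  ultimately show "?P \<in> grassmannian 2"
    unfolding grassmannian_def using r id [OF in_span] by auto
qed

text \<open>An orthogonal projection is determined by its range: \<open>x - P x\<close> is orthogonal to the range, so the
  difference of two candidates lies in the range and is orthogonal to it.\<close>

lemma plane_proj_span_orthogonal:
  fixes v w :: "'a::euclidean_space"
  assumes "v \<noteq> 0" "w \<noteq> 0" "v \<bullet> w = 0"
  shows "plane_proj (span {v, w}) = frame_proj v w"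
proof -
  let ?T = "span {v, w}"
  note g = frame_proj_grassmannian [OF assms]
  have dim: "dim ?T = 2" using g by (auto simp: grassmannian_def)
  have "P = frame_proj v w" if P: "P \<in> grassmannian 2" "range P = ?T" for P
  proof (rule blinfun_eqI)
    fix x
    have orth: "(x - Q x) \<bullet> y = 0"
      if Q: "Q \<in> grassmannian 2" "range Q = ?T" and y: "y \<in> ?T" for Q :: "'a \<Rightarrow>\<^sub>L 'a" and y
    proof -
      obtain z where z: "y = Q z" using y Q(2) by auto
      have "(x - Q x) \<bullet> Q z = Q (x - Q x) \<bullet> z" using Q(1) by (simp add: grassmannian_def)
      also have "Q (x - Q x) = 0" using Q(1) by (simp add: grassmannian_def blinfun.bilinear_simps)
      finally show ?thesis using z by simp
    qed
    define d where "d = P x - frame_proj v w x"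
    have "d \<in> ?T" unfolding d_def using P(2) g(2) by (intro span_diff) blast+
    then have "d \<bullet> d = 0"
      using orth [OF P, of d] orth [OF g, of d] by (simp add: d_def inner_diff_left)
    then show "P x = frame_proj v w x" by (simp add: d_def)
  qed
  note unique = this
  show ?thesis
    unfolding plane_proj_def dim
  proof (rule the_equality)
    show "frame_proj v w \<in> grassmannian 2 \<and> range (frame_proj v w) = ?T" using g by (rule conjI)
  qed (use unique in blast)
qed

text \<open>The divergence along a plane is a trace over a basis of the whole space; this turns it into
  derivatives in the directions of a frame of the plane.\<close>

lemma trace_frame_proj:
  fixes L :: "'a::euclidean_space \<Rightarrow> 'a"
  assumes "bounded_linear L"
  shows "(\<Sum>b\<in>Basis. L (frame_proj v w b) \<bullet> b)
    = inverse (v \<bullet> v) * (L v \<bullet> v) + inverse (w \<bullet> w) * (L w \<bullet> w)"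
proof -
  interpret L: bounded_linear L by fact
  have "(\<Sum>b\<in>Basis. L (frame_proj v w b) \<bullet> b)
      = (\<Sum>b\<in>Basis. inverse (v \<bullet> v) * ((L v \<bullet> b) * (v \<bullet> b)) + inverse (w \<bullet> w) * ((L w \<bullet> b) * (w \<bullet> b)))"
    by (rule sum.cong) (simp_all add: frame_proj_apply L.add L.scaleR inner_add_left algebra_simps)
  also have "\<dots> = inverse (v \<bullet> v) * (L v \<bullet> v) + inverse (w \<bullet> w) * (L w \<bullet> w)"
    unfolding sum.distrib sum_distrib_left [symmetric]
    by (simp only: euclidean_inner [of "L v" v] euclidean_inner [of "L w" w])
  finally show ?thesis .
qed


section \<open>Uniqueness of the generalized mean curvature\<close>

lemma C1_compact_D:
  assumes "C1_compact f"
  shows "\<And>x. (f has_derivative frechet_derivative f (at x)) (at x)"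
    and "\<And>v. continuous_on UNIV (\<lambda>x. frechet_derivative f (at x) v)"
    and "continuous_on UNIV f"
    and "compactly_supported f"
proof -
  show d: "(f has_derivative frechet_derivative f (at x)) (at x)" for x
    using assms by (auto simp: C1_compact_def numeral_eq_Suc frechet_derivative_works)
  show "continuous_on UNIV (\<lambda>x. frechet_derivative f (at x) v)" for v
    using assms by (auto simp: C1_compact_def)
  show "continuous_on UNIV f"
    using d by (intro has_derivative_continuous_on) (auto intro: has_derivative_at_withinI)
  show "compactly_supported f" using assms by (auto simp: C1_compact_def)
qed

lemma compactly_supported_bound:
  fixes f :: "'a::heine_borel \<Rightarrow> 'b::real_normed_vector"
  assumes "compactly_supported f" "continuous_on UNIV f"
  obtains K C where "compact K" "\<And>x. x \<notin> K \<Longrightarrow> f x = 0" "0 \<le> C" "\<And>x. norm (f x) \<le> C"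
proof -
  obtain K where K: "compact K" "\<And>x. x \<notin> K \<Longrightarrow> f x = 0"
    using assms by (auto simp: compactly_supported_def)
  have "compact (f ` K)"
    using K(1) assms(2) by (meson compact_continuous_image continuous_on_subset subset_UNIV)
  then have "bounded (f ` K)" by (rule compact_imp_bounded)
  then obtain C where C: "\<And>y. y \<in> f ` K \<Longrightarrow> norm y \<le> C"
    unfolding bounded_iff by blast
  have "norm (f x) \<le> max 0 C" for x
    using C [of "f x"] K(2) [of x] by (cases "x \<in> K") force+
  with K show ?thesis by (intro that [of K "max 0 C"]) auto
qed

lemma has_real_derivative_square_pos_part:
  "((\<lambda>z. (max 0 z)\<^sup>2) has_real_derivative 2 * max 0 z) (at (z::real))"
proof -
  consider "z > 0" | "z < 0" | "z = 0" by linarith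
  then show ?thesis
  proof cases
    case 1
    have "((\<lambda>z. z\<^sup>2) has_real_derivative 2 * max 0 z) (at z)"
      using 1 by (auto intro!: derivative_eq_intros)
    then show ?thesis
      by (rule has_field_derivative_transform_within_open [where S = "{0<..}"]) (use 1 in auto)
  next
    case 2
    have "((\<lambda>z. 0) has_real_derivative 2 * max 0 z) (at z)"
      using 2 by (auto intro!: derivative_eq_intros)
    then show ?thesis
      by (rule has_field_derivative_transform_within_open [where S = "{..<0}"]) (use 2 in auto)
  next
    case 3
    have "((\<lambda>h::real. max 0 h) \<longlongrightarrow> max 0 0) (at 0)" by (intro tendsto_intros)
    moreover have "\<forall>\<^sub>F h::real in at 0. max 0 h = (max 0 (0 + h))\<^sup>2 / h"
      by (auto simp: eventually_at_filter max_def power2_eq_square)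
    ultimately have "((\<lambda>h::real. (max 0 (0 + h))\<^sup>2 / h) \<longlongrightarrow> max 0 0) (at 0)"
      by (rule Lim_transform_eventually)
    then show ?thesis unfolding 3 by (simp add: DERIV_def)
  qed
qed

text \<open>Squares of positive parts are \<open>C\<^sup>1\<close>, and the product is positive exactly on the open box.\<close>

definition box_bump :: "'a::euclidean_space \<Rightarrow> 'a \<Rightarrow> 'a \<Rightarrow> real" where
  "box_bump a b x = (\<Prod>i\<in>Basis. (max 0 ((x - a) \<bullet> i))\<^sup>2 * (max 0 ((b - x) \<bullet> i))\<^sup>2)"

lemma higher_differentiable_prod:
  fixes f :: "'i \<Rightarrow> 'a::real_normed_vector \<Rightarrow> real"
  assumes "finite I" "open S" "\<And>i. i \<in> I \<Longrightarrow> higher_differentiable_on S (f i) k"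
  shows "higher_differentiable_on S (\<lambda>x. \<Prod>i\<in>I. f i x) k"
  using assms(1,3)
proof (induction I rule: finite_induct)
  case empty
  then show ?case by (simp add: higher_differentiable_const assms(2))
next
  case (insert i I)
  then show ?case
    using higher_differentiable_bilinear [OF assms(2) bounded_bilinear_mult, of "f i" k "\<lambda>x. \<Prod>i\<in>I. f i x"]
    by simp
qed

lemma box_bump_C1: "higher_differentiable_on UNIV (box_bump a b) (Suc 0)"
proof -
  have d: "higher_differentiable_on UNIV (\<lambda>x::'a. (max 0 ((c + s *\<^sub>R x) \<bullet> i))\<^sup>2) (Suc 0)" for c s i
  proof (rule higher_differentiable_SucI [where f' = "\<lambda>x v. 2 * max 0 ((c + s *\<^sub>R x) \<bullet> i) * ((s *\<^sub>R v) \<bullet> i)"])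
    show "((\<lambda>x. (max 0 ((c + s *\<^sub>R x) \<bullet> i))\<^sup>2) has_derivative
        (\<lambda>v. 2 * max 0 ((c + s *\<^sub>R x) \<bullet> i) * ((s *\<^sub>R v) \<bullet> i))) (at x)" for x
      by (rule DERIV_compose_FDERIV [OF has_real_derivative_square_pos_part, THEN has_derivative_eq_rhs])
        (auto intro!: derivative_eq_intros)
    show "higher_differentiable_on UNIV (\<lambda>x. 2 * max 0 ((c + s *\<^sub>R x) \<bullet> i) * ((s *\<^sub>R v) \<bullet> i)) 0" for v
      by (auto intro!: continuous_intros)
  qed auto
  have 1: "higher_differentiable_on UNIV (\<lambda>x::'a. (max 0 ((x - a) \<bullet> i))\<^sup>2) (Suc 0)" for i
    using d [of "- a" 1 i] by (simp only: scaleR_one add.commute [of "- a"] diff_conv_add_uminus)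
  have 2: "higher_differentiable_on UNIV (\<lambda>x::'a. (max 0 ((b - x) \<bullet> i))\<^sup>2) (Suc 0)" for i
    using d [of b "- 1" i] by (simp only: scaleR_minus1_left diff_conv_add_uminus)
  have "higher_differentiable_on UNIV
      (\<lambda>x. \<Prod>i\<in>Basis. (max 0 ((x - a) \<bullet> i))\<^sup>2 * (max 0 ((b - x) \<bullet> i))\<^sup>2) (Suc 0)"
    by (intro higher_differentiable_prod finite_Basis open_UNIV
        higher_differentiable_bilinear [OF open_UNIV bounded_bilinear_mult] 1 2)
  then show ?thesis unfolding box_bump_def .
qed

lemma box_bump_pos: "x \<in> box a b \<Longrightarrow> 0 < box_bump a b x"
  unfolding box_bump_def
  by (intro prod_pos) (auto simp: mem_box inner_diff_left zero_less_mult_iff)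

lemma box_bump_0: "x \<notin> box a b \<Longrightarrow> box_bump a b x = 0"
proof -
  assume "x \<notin> box a b"
  then obtain i where i: "i \<in> Basis" "(x - a) \<bullet> i \<le> 0 \<or> (b - x) \<bullet> i \<le> 0"
    by (auto simp: mem_box inner_diff_left not_less)
  then have "(max 0 ((x - a) \<bullet> i))\<^sup>2 * (max 0 ((b - x) \<bullet> i))\<^sup>2 = 0" by auto
  then show ?thesis unfolding box_bump_def using i by (intro prod_zero finite_Basis) blast
qed

lemma box_bump_nonneg: "0 \<le> box_bump a b x"
  unfolding box_bump_def by (intro prod_nonneg) auto

text \<open>The functions \<open>n M / (1 + n M)\<close>, where \<open>M\<close> is the bump, increase to the indicator of
  the box.\<close>

lemma C1_compact_box_approx:
  fixes a b :: "'a::euclidean_space" and e :: "'b::real_normed_vector"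
  shows "C1_compact (\<lambda>x. (real n * box_bump a b x / (1 + real n * box_bump a b x)) *\<^sub>R e)"
proof -
  let ?M = "box_bump a b"
  note hM = higher_differentiable_SucD [OF box_bump_C1 [of a b]]
  note dM = hM(1) [OF UNIV_I]
  have pos: "0 < 1 + real n * ?M x" for x
    using mult_nonneg_nonneg [OF of_nat_0_le_iff [of n] box_bump_nonneg [of a b x]] by linarith
  have cM: "continuous_on UNIV ?M"
    using dM by (intro has_derivative_continuous_on) (auto intro: has_derivative_at_withinI)
  define M' where "M' = (\<lambda>x v. real n * frechet_derivative ?M (at x) v / (1 + real n * ?M x)\<^sup>2)"
  have "higher_differentiable_on UNIV (\<lambda>x. real n * ?M x / (1 + real n * ?M x)) (Suc 0)"
  proof (rule higher_differentiable_SucI [where f' = M'])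
    fix x
    have *: "((\<lambda>z. real n * z / (1 + real n * z)) has_real_derivative
        real n / (1 + real n * ?M x)\<^sup>2) (at (?M x))"
      using pos [of x] by (auto intro!: derivative_eq_intros simp: field_simps power2_eq_square)
    show "((\<lambda>x. real n * ?M x / (1 + real n * ?M x)) has_derivative M' x) (at x)"
      unfolding M'_def
      by (rule has_derivative_eq_rhs [OF DERIV_compose_FDERIV [OF * dM]]) (auto simp: field_simps)
  next
    fix v
    have "continuous_on UNIV (\<lambda>x. frechet_derivative ?M (at x) v)" using hM(2) by simp
    moreover have "1 + real n * ?M x \<noteq> 0" for x using pos [of x] by simp
    ultimately show "higher_differentiable_on UNIV (\<lambda>x. M' x v) 0"
      unfolding M'_def by (auto intro!: continuous_intros cM)
  qed simp
  then have "higher_differentiable_on UNIV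
      (\<lambda>x. (real n * ?M x / (1 + real n * ?M x)) *\<^sub>R e) (Suc 0)"
    by (rule higher_differentiable_linear_comp [OF open_UNIV bounded_linear_scaleR_left])
  moreover have "compactly_supported (\<lambda>x. (real n * ?M x / (1 + real n * ?M x)) *\<^sub>R e)"
    unfolding compactly_supported_def
  proof (intro exI conjI allI impI)
    show "compact (cbox a b)" by simp
    show "(real n * ?M x / (1 + real n * ?M x)) *\<^sub>R e = 0" if "x \<notin> cbox a b" for x
      using that box_bump_0 [of x a b] box_subset_cbox [of a b] by auto
  qed
  ultimately show ?thesis unfolding C1_compact_def by simp
qed

lemma box_approx_limit:
  "(\<lambda>n. real n * box_bump a b x / (1 + real n * box_bump a b x)) \<longlonglongrightarrow> indicat_real (box a b) x"
proof (cases "x \<in> box a b")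
  case True
  define m where "m = box_bump a b x"
  have m: "0 < m" using box_bump_pos True by (simp add: m_def)
  have 1: "(\<lambda>n. inverse (real n * m)) \<longlonglongrightarrow> 0"
    using tendsto_inverse_0_at_top [OF filterlim_tendsto_pos_mult_at_top [OF tendsto_const m
        filterlim_real_sequentially]] by (simp add: mult.commute)
  have "(\<lambda>n. 1 / (1 + inverse (real n * m))) \<longlonglongrightarrow> 1 / (1 + 0)"
    by (intro tendsto_intros 1) simp
  then have "(\<lambda>n. real n * m / (1 + real n * m)) \<longlonglongrightarrow> 1 / (1 + 0)"
  proof (rule Lim_transform_eventually)
    show "\<forall>\<^sub>F n in sequentially. 1 / (1 + inverse (real n * m)) = real n * m / (1 + real n * m)"
      using eventually_gt_at_top [of 0]
    proof eventually_elim
      case (elim n)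
      then have "real n * m \<noteq> 0" "1 + real n * m \<noteq> 0"
        using m by (auto simp: add_nonneg_eq_0_iff)
      then show ?case by (simp add: field_simps)
    qed
  qed
  then show ?thesis using True by (simp add: m_def)
qed (simp add: box_bump_0)

text \<open>Testing the difference of two candidates with bumps that converge to the indicator of an open box
  shows that its integral over every open box vanishes. Open boxes are stable under intersection and
  generate the Borel sets, so all its integrals over Borel sets inside a box vanish.\<close>

lemma generalized_mean_curvature_unique:
  fixes V :: "'a::euclidean_space varifold"
  assumes "generalized_mean_curvature V h" "generalized_mean_curvature V h'"
  shows "AE x in mass_measure V. h x = h' x"
proof -
  let ?\<mu> = "mass_measure V"
  define d where "d = (\<lambda>x. h x - h' x)"
  have sets: "sets ?\<mu> = sets borel" by (simp add: mass_measure_def)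
  note [measurable_cong] = sets
  have [measurable]: "h \<in> borel_measurable borel" "h' \<in> borel_measurable borel"
    using assms by (auto simp: generalized_mean_curvature_def)
  have [measurable]: "d \<in> borel_measurable borel" unfolding d_def by measurable
  have int: "set_integrable ?\<mu> K g" if "compact K" "g = h \<or> g = h'" for K g
    using assms that by (auto simp: generalized_mean_curvature_def)
  have intd: "set_integrable ?\<mu> K d" if "compact K" for K
    unfolding d_def by (intro set_integral_diff int that) auto
  have intd': "set_integrable ?\<mu> A d" if "A \<subseteq> cbox a b" "A \<in> sets borel" for A a b
    using set_integrable_subset [OF intd [OF compact_cbox]] that sets by auto
  have box0: "(LINT x:box a b|?\<mu>. d x) = 0" for a b
  proof (rule euclidean_eqI)
    fix e :: 'a assume "e \<in> Basis"
    define f where "f = (\<lambda>n x. real n * box_bump a b x / (1 + real n * box_bump a b x))"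
    have f_bound: "\<bar>f n x\<bar> \<le> indicat_real (cbox a b) x" for n x
    proof (cases "x \<in> box a b")
      case True
      then have "indicat_real (cbox a b) x = 1" using box_subset_cbox [of a b] by auto
      moreover have "0 \<le> real n * box_bump a b x" using box_bump_nonneg [of a b x] by simp
      ultimately show ?thesis by (simp add: f_def)
    next
      case False
      then show ?thesis by (simp add: f_def box_bump_0)
    qed
    have C1: "C1_compact (\<lambda>x. f n x *\<^sub>R e)" for n
      unfolding f_def by (rule C1_compact_box_approx)
    have [measurable]: "box_bump a b \<in> borel_measurable borel"
    proof -
      have "continuous_on UNIV (box_bump a b)"
        using higher_differentiable_pred [OF box_bump_C1 [of a b]] by simp
      then show ?thesis by (rule borel_measurable_continuous_onI)
    qed
    have [measurable]: "f n \<in> borel_measurable borel" for n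
      unfolding f_def by measurable
    have fint: "integrable ?\<mu> (\<lambda>x. f n x *\<^sub>R e \<bullet> g x)" if g: "g = h \<or> g = h'" for n g
    proof (rule Bochner_Integration.integrable_bound)
      show "integrable ?\<mu> (\<lambda>x. norm (e) * norm (indicat_real (cbox a b) x *\<^sub>R g x))"
        using int [OF compact_cbox g] unfolding set_integrable_def
        by (intro integrable_mult_right integrable_norm) 
      show "(\<lambda>x. f n x *\<^sub>R e \<bullet> g x) \<in> borel_measurable ?\<mu>" using g by auto
      have "\<bar>f n x\<bar> * \<bar>e \<bullet> g x\<bar> \<le> norm e * (indicat_real (cbox a b) x * norm (g x))" for x
        using mult_mono [OF f_bound [of n x] Cauchy_Schwarz_ineq2 [of e "g x"]] by (simp add: mult_ac)
      then show "AE x in ?\<mu>. norm (f n x *\<^sub>R e \<bullet> g x) \<le> norm (norm e * norm (indicat_real (cbox a b) x *\<^sub>R g x))"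
        by (simp add: abs_mult)
    qed
    have zero: "(\<integral>x. f n x * (e \<bullet> d x) \<partial>?\<mu>) = 0" for n
    proof -
      have "(\<integral>x. f n x *\<^sub>R e \<bullet> h x \<partial>?\<mu>) = (\<integral>x. f n x *\<^sub>R e \<bullet> h' x \<partial>?\<mu>)"
      proof -
        have "first_variation V (\<lambda>x. f n x *\<^sub>R e) = - (\<integral>x. f n x *\<^sub>R e \<bullet> g x \<partial>?\<mu>)"
          if "generalized_mean_curvature V g" for g
          using that C1 [of n] by (simp add: generalized_mean_curvature_def)
        from this [OF assms(1)] this [OF assms(2)] show ?thesis by simp
      qed
      then have "(\<integral>x. f n x *\<^sub>R e \<bullet> h x - f n x *\<^sub>R e \<bullet> h' x \<partial>?\<mu>) = 0"
        using fint by (subst Bochner_Integration.integral_diff) auto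
      then show ?thesis by (simp add: d_def inner_diff_right right_diff_distrib)
    qed
    have "(\<lambda>n. \<integral>x. f n x * (e \<bullet> d x) \<partial>?\<mu>) \<longlonglongrightarrow> (\<integral>x. indicat_real (box a b) x * (e \<bullet> d x) \<partial>?\<mu>)"
    proof (rule integral_dominated_convergence)
      show "integrable ?\<mu> (\<lambda>x. norm e * norm (indicat_real (cbox a b) x *\<^sub>R d x))"
        using intd [OF compact_cbox] unfolding set_integrable_def
        by (intro integrable_mult_right integrable_norm)
      show "AE x in ?\<mu>. (\<lambda>n. f n x * (e \<bullet> d x)) \<longlonglongrightarrow> indicat_real (box a b) x * (e \<bullet> d x)"
        unfolding f_def by (intro AE_I2 tendsto_mult box_approx_limit tendsto_const)
      have "\<bar>f n x\<bar> * \<bar>e \<bullet> d x\<bar> \<le> norm e * (indicat_real (cbox a b) x * norm (d x))" for n x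
        using mult_mono [OF f_bound [of n x] Cauchy_Schwarz_ineq2 [of e "d x"]] by (simp add: mult_ac)
      then show "AE x in ?\<mu>. norm (f n x * (e \<bullet> d x)) \<le> norm e * norm (indicat_real (cbox a b) x *\<^sub>R d x)" for n
        by (simp add: abs_mult)
    qed measurable
    then have "(\<integral>x. indicat_real (box a b) x * (e \<bullet> d x) \<partial>?\<mu>) = 0"
      by (simp add: zero LIMSEQ_const_iff)
    moreover have "(LINT x:box a b|?\<mu>. d x) \<bullet> e = (\<integral>x. (indicat_real (box a b) x *\<^sub>R d x) \<bullet> e \<partial>?\<mu>)"
      unfolding set_lebesgue_integral_def
      using intd' [OF box_subset_cbox, of a b] unfolding set_integrable_def
      by (subst integral_inner_left) auto
    ultimately show "(LINT x:box a b|?\<mu>. d x) \<bullet> e = 0 \<bullet> e"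
      by (simp add: inner_commute)
  qed
  have on_box: "AE x in ?\<mu>. x \<in> box a b \<longrightarrow> d x = 0" for a b :: 'a
  proof -
    have ib: "set_integrable ?\<mu> A d" if "A \<subseteq> box a b" "A \<in> sets borel" for A
      by (rule intd' [of _ a b]) (use that box_subset_cbox [of a b] in auto)
    have "(LINT x:A \<inter> box a b|?\<mu>. d x) = 0" if "A \<in> sets borel" for A
    proof -
      have "Int_stable (range (\<lambda>(a, b). box a b :: 'a set))"
        by (auto simp: Int_stable_def box_Int_box)
      moreover have "range (\<lambda>(a, b). box a b :: 'a set) \<subseteq> Pow UNIV" by auto
      moreover have "A \<in> sigma_sets UNIV (range (\<lambda>(a, b). box a b :: 'a set))"
        using that by (simp add: borel_eq_box)
      ultimately show ?thesis
      proof (induction A rule: sigma_sets_induct_disjoint)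
        case (basic A)
        then obtain u v where "A = box u v" by auto
        then show ?case by (simp add: box0 box_Int_box)
      next
        case empty
        then show ?case by (simp add: set_lebesgue_integral_def)
      next
        case (compl A)
        have A: "A \<in> sets borel" using compl by (simp add: borel_eq_box)
        have "box a b = (A \<inter> box a b) \<union> ((UNIV - A) \<inter> box a b)" by auto
        then have "(LINT x:box a b|?\<mu>. d x) = (LINT x:A \<inter> box a b|?\<mu>. d x) + (LINT x:(UNIV - A) \<inter> box a b|?\<mu>. d x)"
          using A by (subst set_integral_Un [symmetric]) (auto intro!: ib)
        then show ?case using compl box0 by simp
      next
        case (union A)
        have A: "A i \<in> sets borel" for i using union by (auto simp: borel_eq_box)
        have dj: "A i \<inter> box a b \<inter> (A j \<inter> box a b) = {}" if "i \<noteq> j" for i j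
          using union(1) that by (auto simp: disjoint_family_on_def)
        have "(LINT x:(\<Union>i. A i \<inter> box a b)|?\<mu>. d x) = (\<Sum>i. LINT x:A i \<inter> box a b|?\<mu>. d x)"
          by (rule lebesgue_integral_countable_add) (use A dj in \<open>auto simp: sets intro!: ib\<close>)
        moreover have "(\<Union>i. A i \<inter> box a b) = (\<Union>i. A i) \<inter> box a b" by auto
        ultimately show ?case using union by simp
      qed
    qed
    note zero = this
    have "AE x in ?\<mu>. (indicat_real (box a b) x *\<^sub>R d x) \<bullet> e = 0" for e
    proof (rule density_unique_real)
      show int_e: "integrable ?\<mu> (\<lambda>x. (indicat_real (box a b) x *\<^sub>R d x) \<bullet> e)"
        using ib [of "box a b"] unfolding set_integrable_def by (intro integrable_inner_left) auto
      fix A assume A: "A \<in> sets ?\<mu>"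
      have "(LINT x:A|?\<mu>. (indicat_real (box a b) x *\<^sub>R d x) \<bullet> e)
          = (\<integral>x. (indicat_real (A \<inter> box a b) x *\<^sub>R d x) \<bullet> e \<partial>?\<mu>)"
        unfolding set_lebesgue_integral_def by (simp add: indicator_inter_arith mult_ac)
      also have "\<dots> = (LINT x:A \<inter> box a b|?\<mu>. d x) \<bullet> e"
        unfolding set_lebesgue_integral_def
        using ib [of "A \<inter> box a b"] A sets unfolding set_integrable_def
        by (intro integral_inner_left) auto
      finally show "(LINT x:A|?\<mu>. (indicat_real (box a b) x *\<^sub>R d x) \<bullet> e) = (LINT x:A|?\<mu>. 0)"
        using zero A sets by (simp add: set_lebesgue_integral_def)
    qed simp
    then have "AE x in ?\<mu>. \<forall>e\<in>Basis. (indicat_real (box a b) x *\<^sub>R d x) \<bullet> e = 0"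
      by (rule AE_finite_allI [OF finite_Basis])
    then show ?thesis
    proof eventually_elim
      case (elim x)
      have "indicat_real (box a b) x *\<^sub>R d x = 0"
        by (rule euclidean_eqI) (use elim in \<open>simp only: inner_zero_left\<close>)
      then show ?case by (auto simp: indicator_def)
    qed
  qed
  have "AE x in ?\<mu>. \<forall>n::nat. x \<in> box (- (real n *\<^sub>R One)) (real n *\<^sub>R One) \<longrightarrow> d x = 0"
    by (intro AE_all_countable [THEN iffD2] allI on_box)
  then show ?thesis
  proof eventually_elim
    case (elim x)
    obtain n :: nat where "x \<in> box (- (real n *\<^sub>R One)) (real n *\<^sub>R One)"
      using UN_box_eq_UNIV by blast
    then show ?case using elim by (auto simp: d_def)
  qed
qed


section \<open>The circle action and its orbits\<close>

text \<open>The orbits of the circle action with weights \<open>p\<close> and \<open>-q\<close>. The surfaces of the motion are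
  swept out by these orbits; in each orbit \<open>(x1, x2)\<close> are the radii, and vectors along the surface
  rotate in the same way.\<close>

definition sw_point :: "nat \<Rightarrow> nat \<Rightarrow> real \<Rightarrow> real \<Rightarrow> real \<Rightarrow> C2" where
  "sw_point p q x1 x2 \<theta> =
     (of_real x1 * cis (real p * \<theta>), \<i> * of_real x2 * cis (- (real q * \<theta>)))"

lemma J_linear: "J (x + y) = J x + J y" "J (c *\<^sub>R x) = c *\<^sub>R J x" "J 0 = 0"
  by (simp_all add: J_def algebra_simps zero_prod_def)

lemma J_J: "J (J x) = - x"
  by (simp add: J_def prod_eq_iff)

lemma bounded_linear_J: "bounded_linear J"
  unfolding J_def
  by (intro bounded_linear_Pair bounded_linear_const_mult bounded_linear_fst bounded_linear_snd)

lemma inner_J_J: "J x \<bullet> J y = x \<bullet> y"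
  by (simp add: J_def inner_prod_def inner_complex_def)

lemma sw_point_linear:
  "sw_point p q (x1 + y1) (x2 + y2) \<theta> = sw_point p q x1 x2 \<theta> + sw_point p q y1 y2 \<theta>"
  "sw_point p q (c * x1) (c * x2) \<theta> = c *\<^sub>R sw_point p q x1 x2 \<theta>"
  "sw_point p q (- x1) (- x2) \<theta> = - sw_point p q x1 x2 \<theta>"
  "sw_point p q 0 0 \<theta> = 0"
  by (simp_all add: sw_point_def algebra_simps scaleR_conv_of_real zero_prod_def)

lemma cos_sin_mult: "(a * cos t) * (b * cos t) + (a * sin t) * (b * sin t) = a * (b::real)"
proof -
  have "(a * cos t) * (b * cos t) + (a * sin t) * (b * sin t) = a * b * ((cos t)\<^sup>2 + (sin t)\<^sup>2)"
    by algebra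
  then show ?thesis by simp
qed

lemma inner_sw_point: "sw_point p q x1 x2 \<theta> \<bullet> sw_point p q y1 y2 \<theta> = x1 * y1 + x2 * y2"
proof -
  have "sw_point p q x1 x2 \<theta> \<bullet> sw_point p q y1 y2 \<theta>
      = ((x1 * cos (p * \<theta>)) * (y1 * cos (p * \<theta>)) + (x1 * sin (p * \<theta>)) * (y1 * sin (p * \<theta>)))
      + ((x2 * cos (q * \<theta>)) * (y2 * cos (q * \<theta>)) + (x2 * sin (q * \<theta>)) * (y2 * sin (q * \<theta>)))"
    by (simp add: sw_point_def inner_prod_def inner_complex_def)
  then show ?thesis by (simp only: cos_sin_mult)
qed

lemma inner_sw_point_J: "sw_point p q x1 x2 \<theta> \<bullet> J (sw_point p q y1 y2 \<theta>) = 0"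
  by (simp add: sw_point_def J_def inner_prod_def inner_complex_def)

lemma inner_J_sw_point: "J (sw_point p q y1 y2 \<theta>) \<bullet> sw_point p q x1 x2 \<theta> = 0"
  by (simp add: inner_commute inner_sw_point_J)

lemma norm_sw_point: "norm (sw_point p q x1 x2 \<theta>) = sqrt (x1\<^sup>2 + x2\<^sup>2)"
  by (simp add: norm_eq_sqrt_inner inner_sw_point power2_eq_square)

lemma sw_point_has_derivative:
  assumes "(a has_real_derivative a') (at y)" "(b has_real_derivative b') (at y)"
  shows "((\<lambda>u. sw_point p q (a (fst u)) (b (fst u)) (snd u)) has_derivative
     (\<lambda>v. fst v *\<^sub>R sw_point p q a' b' \<theta> + snd v *\<^sub>R J (sw_point p q (p * a y) (- (q * b y)) \<theta>)))
     (at (y, \<theta>))"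
proof -
  have a: "((\<lambda>u. a (fst u)) has_derivative (\<lambda>v. fst v * a')) (at (y, \<theta>))"
    using DERIV_compose_FDERIV [of a a' fst "(y, \<theta>)" fst UNIV] assms(1)
    by (simp add: bounded_linear_imp_has_derivative bounded_linear_fst)
  have b: "((\<lambda>u. b (fst u)) has_derivative (\<lambda>v. fst v * b')) (at (y, \<theta>))"
    using DERIV_compose_FDERIV [of b b' fst "(y, \<theta>)" fst UNIV] assms(2)
    by (simp add: bounded_linear_imp_has_derivative bounded_linear_fst)
  have c: "((\<lambda>u::real \<times> real. cis (c * snd u)) has_derivative (\<lambda>v. (c * snd v) *\<^sub>R (\<i> * cis (c * \<theta>)))) (at (y, \<theta>))" for c
    by (rule has_derivative_eq_rhs) (auto intro!: derivative_eq_intros)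
  show ?thesis
    unfolding sw_point_def J_def
    by (rule has_derivative_eq_rhs, (rule derivative_intros a b c [of "- real q", simplified] c)+)
      (auto simp: fun_eq_iff scaleR_conv_of_real algebra_simps)
qed

lemma continuous_on_sw_point [continuous_intros]:
  assumes "continuous_on S x1" "continuous_on S x2" "continuous_on S \<theta>"
  shows "continuous_on S (\<lambda>x. sw_point p q (x1 x) (x2 x) (\<theta> x))"
  unfolding sw_point_def by (intro continuous_intros assms)

lemma continuous_on_J [continuous_intros]:
  "continuous_on S f \<Longrightarrow> continuous_on S (\<lambda>x. J (f x))"
  by (rule bounded_linear.continuous_on [OF bounded_linear_J])

lemma sw_point_has_vector_derivative_angle:
  "((\<lambda>\<theta>. sw_point p q x1 x2 \<theta>) has_vector_derivative
     J (sw_point p q (p * x1) (- (q * x2)) \<theta>)) (at \<theta>)"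
  unfolding has_vector_derivative_def sw_point_def J_def
  by (rule has_derivative_eq_rhs, (rule derivative_intros)+)
    (auto simp: fun_eq_iff scaleR_conv_of_real algebra_simps)

lemma sw_point_has_vector_derivative_radius:
  assumes "(a has_real_derivative a') (at y)" "(b has_real_derivative b') (at y)"
  shows "((\<lambda>y. sw_point p q (a y) (b y) \<theta>) has_vector_derivative sw_point p q a' b' \<theta>) (at y)"
proof -
  show ?thesis unfolding sw_point_def
    by (intro has_vector_derivative_Pair has_vector_derivative_mult_left has_vector_derivative_mult_right
        has_vector_derivative_of_real assms)
qed


section \<open>Integration over a periodic half strip\<close>

definition half_strip :: "(real \<times> real) set" where
  "half_strip = {0<..} \<times> {0..<2 * pi}"

lemma half_strip_borel [measurable]: "half_strip \<in> sets borel"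
  unfolding half_strip_def by (intro borel_Times) auto

lemma AE_lborel_coordinate_neq:
  "AE u in (lborel :: (real \<times> real) measure). fst u \<noteq> c"
  "AE u in (lborel :: (real \<times> real) measure). snd u \<noteq> c"
proof -
  have "emeasure (lborel \<Otimes>\<^sub>M lborel) ({c} \<times> (UNIV::real set)) = 0"
    "emeasure (lborel \<Otimes>\<^sub>M lborel) ((UNIV::real set) \<times> {c}) = 0"
    by (subst lborel.emeasure_pair_measure_Times; simp)+
  then have *: "{c} \<times> (UNIV::real set) \<in> null_sets lborel" "(UNIV::real set) \<times> {c} \<in> null_sets lborel"
    unfolding lborel_prod by (auto simp: null_sets_def intro!: borel_Times)
  show "AE u in (lborel :: (real \<times> real) measure). fst u \<noteq> c"
    using AE_not_in [OF *(1)] by eventually_elim auto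
  show "AE u in (lborel :: (real \<times> real) measure). snd u \<noteq> c"
    using AE_not_in [OF *(2)] by eventually_elim auto
qed

abbreviation strip_integral :: "real \<Rightarrow> (real \<times> real \<Rightarrow> 'b::real_normed_vector) \<Rightarrow> 'b" where
  "strip_integral R \<equiv> integral (cbox (0, 0) (R, 2 * pi))"

text \<open>The half strip and the closed box up to the radius \<open>R\<close> differ by two lines and by points where
  \<open>G\<close> vanishes. Integrals over the box can be treated by iterated integration and by the
  fundamental theorem of calculus.\<close>

lemma half_strip_integral:
  fixes G :: "real \<times> real \<Rightarrow> 'b::euclidean_space"
  assumes "continuous_on UNIV G" "\<And>u. u \<in> half_strip \<Longrightarrow> fst u > R \<Longrightarrow> G u = 0"
  shows "integrable lborel (\<lambda>u. indicator half_strip u *\<^sub>R G u)"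
    and "(\<integral>u. indicator half_strip u *\<^sub>R G u \<partial>lborel) = strip_integral R G"
proof -
  let ?B = "cbox (0, 0) (R, 2 * pi)"
  have cont: "continuous_on ?B G" using assms(1) continuous_on_subset by blast
  have int: "integrable lborel (\<lambda>u. indicator ?B u *\<^sub>R G u)"
    by (rule borel_integrable_compact [OF compact_cbox cont])
  have [measurable]: "G \<in> borel_measurable borel"
    using assms(1) by (rule borel_measurable_continuous_onI)
  have AE: "AE u in lborel. indicator half_strip u *\<^sub>R G u = indicator ?B u *\<^sub>R G u"
    using AE_lborel_coordinate_neq(1) [of 0] AE_lborel_coordinate_neq(2) [of "2 * pi"]
  proof eventually_elim
    case (elim u)
    have "u \<in> ?B" if "u \<in> half_strip" "fst u \<le> R"
      using that by (auto simp: half_strip_def cbox_Pair_eq)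
    moreover have "u \<in> half_strip" if "u \<in> ?B"
      using that elim by (cases u) (auto simp: half_strip_def cbox_Pair_eq)
    ultimately show ?case using assms(2) [of u]
      by (cases "fst u \<le> R") (auto simp: indicator_def not_le)
  qed
  have [measurable]: "?B \<in> sets borel" by simp
  show "integrable lborel (\<lambda>u. indicator half_strip u *\<^sub>R G u)"
    by (rule integrable_cong_AE [THEN iffD2, OF _ _ AE int]) measurable
  have "(\<integral>u. indicator half_strip u *\<^sub>R G u \<partial>lborel) = (\<integral>u. indicator ?B u *\<^sub>R G u \<partial>lborel)"
    by (rule integral_cong_AE [OF _ _ AE]) measurable
  also have "\<dots> = integral ?B G"
    using set_borel_integral_eq_integral(2) [of ?B G] int
    by (simp add: set_integrable_def set_lebesgue_integral_def)
  finally show "(\<integral>u. indicator half_strip u *\<^sub>R G u \<partial>lborel) = integral ?B G" .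
qed

lemma half_strip_integrable_bounded:
  fixes G :: "real \<times> real \<Rightarrow> 'b::euclidean_space"
  assumes "continuous_on UNIV G"
  shows "integrable lborel (\<lambda>u. indicator (half_strip \<inter> {u. fst u \<le> R}) u *\<^sub>R G u)"
proof -
  let ?B = "cbox (0, 0) (R, 2 * pi)"
  have "continuous_on ?B G" using assms continuous_on_subset by blast
  then have "set_integrable lborel ?B G"
    unfolding set_integrable_def by (rule borel_integrable_compact [OF compact_cbox])
  moreover have "half_strip \<inter> {u. fst u \<le> R} \<in> sets lborel"
    unfolding sets_lborel
    by (intro sets.Int half_strip_borel borel_closed closed_Collect_le continuous_intros)
  moreover have "half_strip \<inter> {u. fst u \<le> R} \<subseteq> ?B"
    by (auto simp: half_strip_def cbox_Pair_eq)
  ultimately show ?thesis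
    unfolding set_integrable_def [symmetric] by (rule set_integrable_subset)
qed

lemma box_integral_iterated:
  fixes G :: "real \<times> real \<Rightarrow> 'b::euclidean_space"
  assumes "continuous_on UNIV G"
  shows "strip_integral R G = integral {0..R} (\<lambda>y. integral {0..2 * pi} (\<lambda>\<theta>. G (y, \<theta>)))"
    and "strip_integral R G = integral {0..2 * pi} (\<lambda>\<theta>. integral {0..R} (\<lambda>y. G (y, \<theta>)))"
proof -
  have c: "continuous_on (cbox (0, 0) (R, 2 * pi)) G" using assms continuous_on_subset by blast
  show 1: "strip_integral R G = integral {0..R} (\<lambda>y. integral {0..2 * pi} (\<lambda>\<theta>. G (y, \<theta>)))"
    using integral_prod_continuous [OF c] by simp
  show "strip_integral R G = integral {0..2 * pi} (\<lambda>\<theta>. integral {0..R} (\<lambda>y. G (y, \<theta>)))"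
    using integral_swap_continuous [of 0 0 R "2 * pi" "\<lambda>y \<theta>. G (y, \<theta>)"] c unfolding 1 by simp
qed

lemma box_integral_divergence_radius:
  fixes \<Phi> \<Phi>' :: "real \<times> real \<Rightarrow> 'b::euclidean_space"
  assumes "continuous_on UNIV \<Phi>" "continuous_on UNIV \<Phi>'" "0 \<le> R"
    and "\<And>y \<theta>. 0 < y \<Longrightarrow> ((\<lambda>y. \<Phi> (y, \<theta>)) has_vector_derivative \<Phi>' (y, \<theta>)) (at y)"
    and "\<And>\<theta>. \<Phi> (R, \<theta>) = 0"
  shows "strip_integral R \<Phi>' = - integral {0..2 * pi} (\<lambda>\<theta>. \<Phi> (0, \<theta>))"
proof -
  have "integral {0..R} (\<lambda>y. \<Phi>' (y, \<theta>)) = - \<Phi> (0, \<theta>)" for \<theta>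
  proof -
    have "continuous_on {0..R} (\<lambda>y. \<Phi> (y, \<theta>))"
      by (rule continuous_on_compose2 [OF assms(1)]) (auto intro!: continuous_intros)
    then have "((\<lambda>y. \<Phi>' (y, \<theta>)) has_integral \<Phi> (R, \<theta>) - \<Phi> (0, \<theta>)) {0..R}"
      using assms(3,4) by (intro fundamental_theorem_of_calculus_interior) auto
    then show ?thesis using assms(5) by (simp add: integral_unique)
  qed
  then show ?thesis by (simp add: box_integral_iterated(2) [OF assms(2)])
qed

lemma box_integral_divergence_angle:
  fixes \<Phi> \<Phi>' :: "real \<times> real \<Rightarrow> 'b::euclidean_space"
  assumes "continuous_on UNIV \<Phi>'"
    and "\<And>y \<theta>. ((\<lambda>\<theta>. \<Phi> (y, \<theta>)) has_vector_derivative \<Phi>' (y, \<theta>)) (at \<theta>)"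
    and "\<And>y. \<Phi> (y, 2 * pi) = \<Phi> (y, 0)"
  shows "strip_integral R \<Phi>' = 0"
proof -
  have "integral {0..2 * pi} (\<lambda>\<theta>. \<Phi>' (y, \<theta>)) = 0" for y
  proof -
    have "((\<lambda>\<theta>. \<Phi>' (y, \<theta>)) has_integral \<Phi> (y, 2 * pi) - \<Phi> (y, 0)) {0..2 * pi}"
      using assms(2) by (intro fundamental_theorem_of_calculus) (auto intro: has_vector_derivative_at_within)
    then show ?thesis using assms(3) by (simp add: integral_unique)
  qed
  then show ?thesis by (simp add: box_integral_iterated(1) [OF assms(1)])
qed

text \<open>A periodic function that acquires the factor \<open>w\<close> under a translation has the same integral
  as \<open>w\<close> times itself. Along the seam the conormals of the sheets are related in this way, and
  this is why they cancel.\<close>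

lemma integral_twisted_periodic:
  fixes f :: "real \<Rightarrow> complex"
  assumes "continuous_on UNIV f" "\<And>\<theta>. f (\<theta> + 2 * pi) = f \<theta>"
    and "\<And>\<theta>. f (\<theta> + c) = w * f \<theta>" "w \<noteq> 1" "0 \<le> c" "c \<le> 2 * pi"
  shows "integral {0..2 * pi} f = 0"
proof -
  have int: "f integrable_on {a..b}" for a b
    using assms(1) by (intro integrable_continuous_real) (auto intro: continuous_on_subset)
  have sh: "integral {a..b} (\<lambda>\<theta>. f (\<theta> + d)) = integral {a + d..b + d} f" for a b d
    using integral_shift [of a d b f] assms(1) by (auto simp: o_def intro: continuous_on_subset)
  have "w * integral {0..2 * pi} f = integral {0..2 * pi} (\<lambda>\<theta>. f (\<theta> + c))"
    by (simp add: assms(3))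
  also have "\<dots> = integral {c..2 * pi + c} f" by (simp add: sh)
  also have "\<dots> = integral {c..2 * pi} f + integral {2 * pi..2 * pi + c} f"
    using assms(5,6) by (intro Henstock_Kurzweil_Integration.integral_combine [symmetric] int) auto
  also have "integral {2 * pi..2 * pi + c} f = integral {0..c} f"
    using sh [of 0 c "2 * pi"] by (simp add: assms(2) add.commute)
  also have "integral {c..2 * pi} f + integral {0..c} f = integral {0..2 * pi} f"
    using Henstock_Kurzweil_Integration.integral_combine [of 0 c "2 * pi" f] assms(5,6) int by (simp add: add.commute)
  finally have "(w - 1) * integral {0..2 * pi} f = 0" by (simp add: algebra_simps)
  then show ?thesis using assms(4) by simp
qed

text \<open>The conormal is multiplied by this number from one sheet to the next; it is \<open>1\<close> only if there is
  a single sheet.\<close>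

lemma cis_fraction_neq_1:
  fixes m n :: nat
  assumes "1 < m" "coprime m n"
  shows "cis (real n * (2 * pi / real m)) \<noteq> 1"
proof
  assume "cis (real n * (2 * pi / real m)) = 1"
  then obtain k :: int where k: "real n * (2 * pi / real m) = of_int k * 2 * pi"
    by (auto simp: cis_conv_exp exp_eq_1 mult_ac)
  then have "real n = of_int k * real m" using assms(1) by (simp add: field_simps)
  then have "int n = k * int m" by (metis of_int_eq_iff of_int_mult of_int_of_nat_eq)
  then have "int m dvd int n" by simp
  then have "m dvd n" by simp
  then show False using assms by (simp add: coprime_absorb_left)
qed

lemma cis_nat_periodic:
  "cis (real m * (\<theta> + 2 * pi)) = cis (real m * \<theta>)"
  "cis (- (real m * (\<theta> + 2 * pi))) = cis (- (real m * \<theta>))"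
proof -
  have "cis (real m * (2 * pi)) = 1"
    using cis_multiple_2pi [of "real m"] by (simp add: mult_ac)
  then show *: "cis (real m * (\<theta> + 2 * pi)) = cis (real m * \<theta>)"
    by (simp add: distrib_left cis_mult [symmetric])
  show "cis (- (real m * (\<theta> + 2 * pi))) = cis (- (real m * \<theta>))"
    by (simp only: cis_cnj [symmetric] *)
qed

lemma sw_point_periodic: "sw_point p q x1 x2 (\<theta> + 2 * pi) = sw_point p q x1 x2 \<theta>"
  by (simp only: sw_point_def cis_nat_periodic)

lemma integral_seam:
  fixes k :: "real \<Rightarrow> complex" and m n :: nat
  assumes "continuous_on UNIV k" "1 < m" "coprime m n"
    and "\<And>\<theta>. k (\<theta> + 2 * pi / real m) = k \<theta>" "\<And>\<theta>. k (\<theta> + 2 * pi) = k \<theta>" "s = 1 \<or> s = - 1"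
  shows "integral {0..2 * pi} (\<lambda>\<theta>. k \<theta> \<bullet> (c * cis (s * (real n * \<theta>)))) = 0"
proof -
  define f where "f = (\<lambda>\<theta>. cnj (k \<theta>) * (c * cis (s * (real n * \<theta>))))"
  have cf: "continuous_on UNIV f"
    unfolding f_def by (intro continuous_intros assms)
  have "integral {0..2 * pi} f = 0"
  proof (rule integral_twisted_periodic [OF cf])
    have "cis (s * (real n * (\<theta> + 2 * pi))) = cis (s * (real n * \<theta>))" for \<theta>
      using assms(6) by (auto simp only: cis_nat_periodic mult_1 mult_minus1)
    then show "f (\<theta> + 2 * pi) = f \<theta>" for \<theta> by (simp add: f_def assms)
    show "f (\<theta> + 2 * pi / real m) = cis (s * (real n * (2 * pi / real m))) * f \<theta>" for \<theta>
      unfolding f_def assms(4) distrib_left cis_mult [symmetric] by (simp add: mult_ac)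
    show "cis (s * (real n * (2 * pi / real m))) \<noteq> 1"
    proof
      assume "cis (s * (real n * (2 * pi / real m))) = 1"
      moreover have "cis x = 1" if "cis (- x) = 1" for x
        using cis_cnj [of "- x"] that by simp
      ultimately have "cis (real n * (2 * pi / real m)) = 1"
        using assms(6) by (metis mult_1 mult_minus1)
      then show False using cis_fraction_neq_1 [OF assms(2,3)] by simp
    qed
    show "0 \<le> 2 * pi / real m" "2 * pi / real m \<le> 2 * pi"
      using assms(2) by (auto simp: field_simps)
  qed
  moreover have "f integrable_on {0..2 * pi}"
    using cf by (intro integrable_continuous_real) (auto intro: continuous_on_subset)
  ultimately have "integral {0..2 * pi} (\<lambda>\<theta>. Re (f \<theta>)) = 0"
    using integral_linear [OF _ bounded_linear_Re, of f "{0..2 * pi}"] by (simp add: o_def)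
  moreover have "Re (f \<theta>) = k \<theta> \<bullet> (c * cis (s * (real n * \<theta>)))" for \<theta>
    unfolding f_def inner_complex_def by simp
  ultimately show ?thesis by simp
qed


section \<open>The varifold of a surface swept out by orbits\<close>

text \<open>The field that is the mean curvature vector of all the surfaces simultaneously. It does
  not depend on the time: at a point with radii \<open>x1, x2\<close> it is \<open>(p - q) / D\<close> times \<open>J\<close> applied to
  the velocity of the circle action, where \<open>D\<close> is the squared length of that velocity.\<close>

definition sw_speed2 :: "nat \<Rightarrow> nat \<Rightarrow> C2 \<Rightarrow> real" where
  "sw_speed2 p q z = (real p)\<^sup>2 * (norm (fst z))\<^sup>2 + (real q)\<^sup>2 * (norm (snd z))\<^sup>2"

definition sw_mean_curvature :: "nat \<Rightarrow> nat \<Rightarrow> C2 \<Rightarrow> C2" where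
  "sw_mean_curvature p q z = ((real p - real q) / sw_speed2 p q z) *\<^sub>R (- (real p *\<^sub>R fst z), real q *\<^sub>R snd z)"

lemma sw_mean_curvature_measurable [measurable]: "sw_mean_curvature p q \<in> borel_measurable borel"
proof -
  have [measurable]: "sw_speed2 p q \<in> borel_measurable borel"
    unfolding sw_speed2_def by (intro borel_measurable_continuous_onI continuous_intros)
  have [measurable]: "(\<lambda>z::C2. (- (real p *\<^sub>R fst z), real q *\<^sub>R snd z)) \<in> borel_measurable borel"
    by (intro borel_measurable_continuous_onI continuous_intros)
  show ?thesis unfolding sw_mean_curvature_def by measurable
qed

lemma sw_mean_curvature_point:
  "sw_mean_curvature p q (sw_point p q x1 x2 \<theta>)
     = ((real p - real q) / ((real p * x1)\<^sup>2 + (real q * x2)\<^sup>2)) *\<^sub>R sw_point p q (- (p * x1)) (q * x2) \<theta>"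
  by (simp add: sw_mean_curvature_def sw_speed2_def sw_point_def norm_mult power_mult_distrib
      scaleR_conv_of_real mult_ac)

text \<open>The radii \<open>a, b\<close> satisfy \<open>p a a' = q b b'\<close>, which is the Lagrangian condition; the common
  factor of \<open>(a', b') = s (q b, p a)\<close> is \<open>s\<close>. On the cone \<open>s\<close> is singular at the vertex, but
  \<open>sa = s a\<close> and \<open>sb = s b\<close> stay continuous.\<close>

locale sw_profile =
  fixes p q :: nat and a b sa sb s :: "real \<Rightarrow> real"
  assumes weights: "1 < p" "1 < q" "coprime p q" "p \<noteq> q"
    and cont: "continuous_on UNIV a" "continuous_on UNIV b" "continuous_on UNIV sa" "continuous_on UNIV sb"
    and positive: "\<And>y. 0 < y \<Longrightarrow> 0 < a y" "\<And>y. 0 < y \<Longrightarrow> 0 < b y" "\<And>y. 0 < y \<Longrightarrow> 0 < s y"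
    and sa: "\<And>y. 0 < y \<Longrightarrow> sa y = s y * a y" and sb: "\<And>y. 0 < y \<Longrightarrow> sb y = s y * b y"
    and deriv_a: "\<And>y. 0 < y \<Longrightarrow> (a has_real_derivative q * sb y) (at y)"
    and deriv_b: "\<And>y. 0 < y \<Longrightarrow> (b has_real_derivative p * sa y) (at y)"
    and seam: "a 0 = 0 \<or> b 0 = 0"
    and radius: "\<And>y. 0 \<le> y \<Longrightarrow> y\<^sup>2 \<le> (a y)\<^sup>2 + (b y)\<^sup>2"
begin

text \<open>The coordinate frame is \<open>F1, F2\<close>; it is orthogonal. \<open>D\<close> is the squared length of \<open>F2\<close> and of
  \<open>conormal = F1 / s\<close>, and \<open>A = s D\<close> is the area density.\<close>

definition F where "F u = sw_point p q (a (fst u)) (b (fst u)) (snd u)"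
definition F1 where "F1 u = sw_point p q (q * sb (fst u)) (p * sa (fst u)) (snd u)"
definition F2 where "F2 u = J (sw_point p q (p * a (fst u)) (- (q * b (fst u))) (snd u))"
definition conormal where "conormal u = sw_point p q (q * b (fst u)) (p * a (fst u)) (snd u)"
definition D where "D y = (p * a y)\<^sup>2 + (q * b y)\<^sup>2"
definition A where "A y = (real p)\<^sup>2 * (a y * sa y) + (real q)\<^sup>2 * (b y * sb y)"

text \<open>The mean curvature vector times the area density.\<close>

definition AH :: "real \<times> real \<Rightarrow> C2" where
  "AH u = (real p - real q) *\<^sub>R sw_point p q (- (p * sa (fst u))) (q * sb (fst u)) (snd u)"

definition V :: "C2 varifold" where "V = param_varifold half_strip F"

lemma cont_comp [continuous_intros]:
  "continuous_on S (\<lambda>u. a (fst u))" "continuous_on S (\<lambda>u. b (fst u))"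
  "continuous_on S (\<lambda>u. sa (fst u))" "continuous_on S (\<lambda>u. sb (fst u))"
  by (rule continuous_on_compose2 [OF cont(1)] continuous_on_compose2 [OF cont(2)]
      continuous_on_compose2 [OF cont(3)] continuous_on_compose2 [OF cont(4)];
      auto intro!: continuous_intros)+

lemma continuous_F: "continuous_on S F" and continuous_F1: "continuous_on S F1"
  and continuous_F2: "continuous_on S F2" and continuous_conormal: "continuous_on S conormal"
  and continuous_A: "continuous_on S (\<lambda>u. A (fst u))" and continuous_AH: "continuous_on S AH"
  unfolding F_def F1_def F2_def conormal_def A_def AH_def by (intro continuous_intros)+

lemma measurable_F [measurable]: "F \<in> borel_measurable borel"
  and measurable_A [measurable]: "(\<lambda>u. A (fst u :: real)) \<in> borel_measurable (borel :: (real \<times> real) measure)"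
  by (intro borel_measurable_continuous_onI continuous_F continuous_A)+

lemma D_pos: "0 < y \<Longrightarrow> 0 < D y"
  using positive(1) [of y] weights by (simp add: D_def add_pos_nonneg)

lemma A_eq: "0 < y \<Longrightarrow> A y = s y * D y"
  by (simp add: A_def D_def sa sb power_mult_distrib power2_eq_square algebra_simps)

lemma F1_eq: "0 < fst u \<Longrightarrow> F1 u = s (fst u) *\<^sub>R conormal u"
  unfolding F1_def conormal_def sw_point_linear(2) [symmetric] by (simp add: sa sb mult_ac)

lemma inner_frame:
  "conormal u \<bullet> conormal u = D (fst u)" "F2 u \<bullet> F2 u = D (fst u)" "F1 u \<bullet> F2 u = 0"
  by (simp_all add: conormal_def F1_def F2_def inner_J_J inner_sw_point inner_sw_point_J D_def
      power2_eq_square algebra_simps)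

lemma F1_nonzero: "0 < fst u \<Longrightarrow> F1 u \<noteq> 0" and F2_nonzero: "0 < fst u \<Longrightarrow> F2 u \<noteq> 0"
  using D_pos [of "fst u"] inner_frame(1,2) [of u] positive(3) [of "fst u"] by (auto simp: F1_eq)

lemma F_has_derivative:
  assumes "0 < fst u"
  shows "(F has_derivative (\<lambda>v. fst v *\<^sub>R F1 u + snd v *\<^sub>R F2 u)) (at u)"
  using sw_point_has_derivative [OF deriv_a deriv_b, OF assms assms, of p q "snd u"]
  unfolding F_def F1_def F2_def by simp

lemma pd_F: "0 < fst u \<Longrightarrow> pd1 F u = F1 u" "0 < fst u \<Longrightarrow> pd2 F u = F2 u"
  using frechet_derivative_at [OF F_has_derivative, of u, symmetric] by simp_all

lemma area_density_F:
  assumes "0 < fst u"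
  shows "area_density F u = A (fst u)"
proof -
  have "area_density F u = sqrt ((s (fst u) * D (fst u))\<^sup>2)"
  proof -
    have "F1 u \<bullet> F1 u * D (fst u) = (s (fst u) * D (fst u))\<^sup>2"
      by (simp add: F1_eq assms inner_frame(1) power2_eq_square)
    then show ?thesis
      unfolding area_density_def by (simp only: pd_F [OF assms] inner_frame(2,3)) simp
  qed
  also have "\<dots> = A (fst u)"
    using D_pos [OF assms] positive(3) [OF assms] by (simp add: A_eq assms)
  finally show ?thesis .
qed

lemma A_nonneg: "0 < y \<Longrightarrow> 0 \<le> A y"
  using D_pos [of y] positive(3) [of y] by (simp add: A_eq)

lemma tangent_plane_F:
  assumes "0 < fst u"
  shows "plane_proj (tangent_plane F u) = frame_proj (F1 u) (F2 u)"
  unfolding tangent_plane_def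
  by (simp add: pd_F assms plane_proj_span_orthogonal F1_nonzero F2_nonzero inner_frame(3))

text \<open>Multiplication by the area density removes the singularity of the curvature at the vertex of the
  cone: the product extends continuously to \<open>y = 0\<close>.\<close>

lemma A_sw_mean_curvature:
  assumes "0 < fst u"
  shows "A (fst u) *\<^sub>R sw_mean_curvature p q (F u) = AH u"
proof -
  have "sw_mean_curvature p q (F u) = ((real p - real q) / D (fst u)) *\<^sub>R
      sw_point p q (- (p * a (fst u))) (q * b (fst u)) (snd u)"
    unfolding F_def sw_mean_curvature_point D_def by simp
  then have "A (fst u) *\<^sub>R sw_mean_curvature p q (F u) = ((real p - real q) * s (fst u)) *\<^sub>R
      sw_point p q (- (p * a (fst u))) (q * b (fst u)) (snd u)"
    using D_pos [OF assms] by (simp add: A_eq assms)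
  also have "\<dots> = AH u"
    unfolding AH_def scaleR_scaleR [symmetric] sw_point_linear(2) [symmetric]
    by (simp add: sa sb assms mult_ac)
  finally show ?thesis .
qed

lemma A_sw_mean_curvature_norm2:
  assumes "0 < fst u"
  shows "A (fst u) * (norm (sw_mean_curvature p q (F u)))\<^sup>2 = (real p - real q)\<^sup>2 * s (fst u)"
proof -
  have D: "sw_point p q (- (p * a (fst u))) (q * b (fst u)) (snd u) \<bullet>
      sw_point p q (- (p * a (fst u))) (q * b (fst u)) (snd u) = D (fst u)"
    unfolding inner_sw_point D_def by (simp add: power2_eq_square)
  have "(norm (sw_mean_curvature p q (F u)))\<^sup>2 = (real p - real q)\<^sup>2 / D (fst u)"
    unfolding F_def sw_mean_curvature_point D_def [symmetric] power2_norm_eq_inner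
    using D_pos [OF assms] by (simp add: D power2_eq_square)
  then show ?thesis using D_pos [OF assms] by (simp add: A_eq assms)
qed

text \<open>The area measure of the surface in the coordinates \<open>(y, \<theta>)\<close>; the boundary line \<open>y = 0\<close> is left out.\<close>

definition area_measure :: "(real \<times> real) measure" where
  "area_measure = density lborel (\<lambda>u. ennreal (indicator half_strip u * A (fst u)))"

text \<open>A map that is continuous on an open set and constant elsewhere is Borel.\<close>

definition lift :: "real \<times> real \<Rightarrow> C2 \<times> (C2 \<Rightarrow>\<^sub>L C2)" where
  "lift u = (if u \<in> {u. 0 < fst u} then (F u, frame_proj (F1 u) (F2 u)) else (0, 0))"

lemma measurable_lift [measurable]: "lift \<in> borel \<rightarrow>\<^sub>M borel"
proof -
  have "{u :: real \<times> real. 0 < fst u} \<in> sets borel"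
    by (intro borel_open open_Collect_less continuous_intros)
  moreover have "continuous_on {u :: real \<times> real. 0 < fst u} (\<lambda>u. (F u, frame_proj (F1 u) (F2 u)))"
    by (intro continuous_on_Pair continuous_on_frame_proj continuous_F continuous_F1 continuous_F2)
      (auto simp: F1_nonzero F2_nonzero)
  ultimately show ?thesis
    unfolding lift_def by (rule borel_measurable_continuous_on_if) (rule continuous_on_const)
qed

lemma lift_half_strip: "u \<in> half_strip \<Longrightarrow> lift u = (F u, frame_proj (F1 u) (F2 u))"
  by (auto simp: lift_def half_strip_def)

lemma V_eq: "V = distr area_measure borel lift"
proof -
  let ?N = "restrict_space lborel half_strip"
  have pos: "0 < fst u" if "u \<in> half_strip" for u using that by (auto simp: half_strip_def)
  have "density ?N (\<lambda>u. ennreal (area_density F u)) = density ?N (\<lambda>u. ennreal (A (fst u)))"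
  proof (rule density_cong)
    show m: "(\<lambda>u. ennreal (A (fst u))) \<in> borel_measurable ?N"
      by (intro measurable_restrict_space1) measurable
    show "(\<lambda>u. ennreal (area_density F u)) \<in> borel_measurable ?N"
      by (rule measurable_cong [THEN iffD1, OF _ m]) (simp add: area_density_F pos)
    show "AE u in ?N. ennreal (area_density F u) = ennreal (A (fst u))"
      by (rule AE_I2) (simp add: area_density_F pos)
  qed
  then have "V = distr (density ?N (\<lambda>u. ennreal (A (fst u)))) borel (\<lambda>u. (F u, plane_proj (tangent_plane F u)))"
    unfolding V_def param_varifold_def by simp
  also have "\<dots> = distr (density ?N (\<lambda>u. ennreal (A (fst u)))) borel lift"
    by (rule distr_cong) (auto simp: tangent_plane_F pos lift_half_strip)
  also have "\<dots> = distr area_measure borel lift"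
  proof (rule measure_eqI)
    fix S assume "S \<in> sets (distr (density ?N (\<lambda>u. ennreal (A (fst u)))) borel lift)"
    then have [measurable]: "S \<in> sets borel" by simp
    have m: "(\<lambda>u. ennreal (A (fst u))) \<in> borel_measurable ?N" "lift \<in> measurable ?N borel"
      by (intro measurable_restrict_space1; measurable)+
    have GS: "lift -` S \<in> sets borel" using measurable_sets [of lift borel borel S] by simp
    have "emeasure (distr (density ?N (\<lambda>u. ennreal (A (fst u)))) borel lift) S
        = emeasure (density ?N (\<lambda>u. ennreal (A (fst u)))) (lift -` S \<inter> half_strip)"
      using m by (subst emeasure_distr) auto
    also have "\<dots> = (\<integral>\<^sup>+u. ennreal (A (fst u)) * indicator (lift -` S \<inter> half_strip) u \<partial>?N)"
      using GS by (intro emeasure_density m) (auto simp: sets_restrict_space)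
    also have "\<dots> = (\<integral>\<^sup>+u. ennreal (A (fst u)) * indicator (lift -` S \<inter> half_strip) u * indicator half_strip u \<partial>lborel)"
      by (rule nn_integral_restrict_space) simp
    also have "\<dots> = (\<integral>\<^sup>+u. ennreal (indicator half_strip u * A (fst u)) * indicator (lift -` S) u \<partial>lborel)"
      by (rule nn_integral_cong) (auto simp: indicator_def)
    also have "\<dots> = emeasure area_measure (lift -` S)"
      unfolding area_measure_def using GS by (subst emeasure_density) auto
    also have "\<dots> = emeasure (distr area_measure borel lift) S"
      by (subst emeasure_distr) (auto simp: area_measure_def)
    finally show "emeasure (distr (density ?N (\<lambda>u. ennreal (A (fst u)))) borel lift) S
      = emeasure (distr area_measure borel lift) S" .
  qed simp
  finally show ?thesis .
qed

lemma mass_measure_V: "mass_measure V = distr area_measure borel F"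
proof -
  have [measurable]: "fst \<in> (borel :: (C2 \<times> (C2 \<Rightarrow>\<^sub>L C2)) measure) \<rightarrow>\<^sub>M borel"
    by (intro borel_measurable_continuous_onI continuous_intros)
  have [measurable]: "lift \<in> area_measure \<rightarrow>\<^sub>M borel" "F \<in> area_measure \<rightarrow>\<^sub>M borel"
    using measurable_lift measurable_F by (auto simp: area_measure_def)
  have "AE u in area_measure. u \<in> half_strip"
    unfolding area_measure_def by (subst AE_density) (auto simp: indicator_def)
  then have "AE u in area_measure. (fst \<circ> lift) u = F u"
    by eventually_elim (simp add: lift_half_strip)
  then have "distr area_measure borel (fst \<circ> lift) = distr area_measure borel F"
    by (intro distr_cong_AE) auto
  then show ?thesis unfolding mass_measure_def V_eq by (subst distr_distr) auto
qed

lemma weight_nonneg: "0 \<le> indicat_real half_strip u * A (fst u)"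
  using A_nonneg [of "fst u"] by (auto simp: indicator_def half_strip_def)

lemma integral_mass_V:
  fixes g :: "C2 \<Rightarrow> 'c::euclidean_space"
  assumes [measurable]: "g \<in> borel_measurable borel"
  shows "integrable (mass_measure V) g \<longleftrightarrow> integrable lborel (\<lambda>u. indicator half_strip u *\<^sub>R (A (fst u) *\<^sub>R g (F u)))"
    and "(\<integral>x. g x \<partial>mass_measure V) = (\<integral>u. indicator half_strip u *\<^sub>R (A (fst u) *\<^sub>R g (F u)) \<partial>lborel)"
proof -
  have [measurable]: "F \<in> area_measure \<rightarrow>\<^sub>M borel"
    using measurable_F by (simp add: area_measure_def)
  show "integrable (mass_measure V) g \<longleftrightarrow> integrable lborel (\<lambda>u. indicator half_strip u *\<^sub>R (A (fst u) *\<^sub>R g (F u)))"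
    unfolding mass_measure_V integrable_distr_eq [OF \<open>F \<in> area_measure \<rightarrow>\<^sub>M borel\<close> assms]
    unfolding area_measure_def
    by (subst integrable_density) (auto simp: weight_nonneg)
  show "(\<integral>x. g x \<partial>mass_measure V) = (\<integral>u. indicator half_strip u *\<^sub>R (A (fst u) *\<^sub>R g (F u)) \<partial>lborel)"
    unfolding mass_measure_V integral_distr [OF \<open>F \<in> area_measure \<rightarrow>\<^sub>M borel\<close> assms]
    unfolding area_measure_def
    by (subst integral_density) (auto simp: weight_nonneg)
qed

lemma nn_integral_mass_V:
  assumes [measurable]: "g \<in> borel_measurable borel"
  shows "(\<integral>\<^sup>+x. g x \<partial>mass_measure V) = (\<integral>\<^sup>+u. ennreal (indicator half_strip u * A (fst u)) * g (F u) \<partial>lborel)"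
proof -
  have "F \<in> area_measure \<rightarrow>\<^sub>M borel"
    using measurable_F by (simp add: area_measure_def)
  then have "(\<integral>\<^sup>+x. g x \<partial>mass_measure V) = (\<integral>\<^sup>+u. g (F u) \<partial>area_measure)"
    unfolding mass_measure_V by (rule nn_integral_distr) simp
  then show ?thesis
    unfolding area_measure_def by (subst (asm) nn_integral_density) auto
qed

text \<open>A test function with support in a ball of radius \<open>R\<close> only sees \<open>y \<le> R\<close>, for all times.\<close>

lemma norm_F_ge: "0 \<le> fst u \<Longrightarrow> fst u \<le> norm (F u)"
  unfolding F_def norm_sw_point using radius by (intro real_le_rsqrt) auto

lemma is_varifold_V: "is_varifold 2 V"
  unfolding is_varifold_def
proof (intro conjI allI impI)
  show "sets V = sets borel" by (simp add: V_eq)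
  have em: "emeasure V S = (\<integral>\<^sup>+u. ennreal (indicator half_strip u * A (fst u)) * indicator (lift -` S) u \<partial>lborel)"
    if S: "S \<in> sets borel" for S
  proof -
    have "lift -` S \<in> sets borel" using measurable_sets [of lift borel borel S] S by simp
    then show ?thesis
      unfolding V_eq using S
      by (subst emeasure_distr) (auto simp: area_measure_def emeasure_density)
  qed
  show "emeasure V (UNIV \<times> (- grassmannian 2)) = 0"
  proof (cases "UNIV \<times> (- grassmannian 2) \<in> sets (borel :: (C2 \<times> (C2 \<Rightarrow>\<^sub>L C2)) measure)")
    case True
    have "ennreal (indicator half_strip u * A (fst u)) * indicator (lift -` (UNIV \<times> (- grassmannian 2))) u = 0" for u
      using frame_proj_grassmannian(1) [OF F1_nonzero F2_nonzero inner_frame(3), of u] lift_half_strip [of u]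
      by (auto simp: indicator_def half_strip_def)
    then show ?thesis unfolding em [OF True] by (simp only: nn_integral_const mult_zero_left)
  next
    case False
    then show ?thesis by (intro emeasure_notin_sets) (simp add: V_eq)
  qed
  fix K :: "C2 set" assume K: "compact K"
  then obtain R where R: "\<And>x. x \<in> K \<Longrightarrow> norm x \<le> R"
    by (meson compact_imp_bounded bounded_iff)
  have KU: "K \<times> UNIV \<in> sets (borel :: (C2 \<times> (C2 \<Rightarrow>\<^sub>L C2)) measure)"
    using K by (intro borel_closed closed_Times) (auto simp: compact_imp_closed)
  have "emeasure V (K \<times> UNIV) \<le> (\<integral>\<^sup>+u. ennreal (norm (indicator (half_strip \<inter> {u. fst u \<le> R}) u *\<^sub>R A (fst u))) \<partial>lborel)"
    unfolding em [OF KU]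
  proof (rule nn_integral_mono)
    fix u :: "real \<times> real"
    show "ennreal (indicator half_strip u * A (fst u)) * indicator (lift -` (K \<times> UNIV)) u
        \<le> ennreal (norm (indicator (half_strip \<inter> {u. fst u \<le> R}) u *\<^sub>R A (fst u)))"
      using R [of "F u"] norm_F_ge [of u] lift_half_strip [of u]
      by (auto simp: indicator_def half_strip_def intro!: ennreal_leI)
  qed
  also have "\<dots> < \<infinity>"
    using half_strip_integrable_bounded [OF continuous_A, of R] by (simp add: integrable_iff_bounded)
  finally show "emeasure V (K \<times> UNIV) < \<infinity>" .
qed

end


section \<open>Mean curvature of the swept surfaces\<close>

lemma frechet_derivative_sum_Basis:
  fixes X :: "'a::euclidean_space \<Rightarrow> 'b::real_normed_vector"
  assumes "(X has_derivative frechet_derivative X (at x)) (at x)"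
  shows "frechet_derivative X (at x) v = (\<Sum>i\<in>Basis. (v \<bullet> i) *\<^sub>R frechet_derivative X (at x) i)"
proof -
  interpret bounded_linear "frechet_derivative X (at x)"
    using assms by (rule has_derivative_bounded_linear)
  have "frechet_derivative X (at x) v = frechet_derivative X (at x) (\<Sum>i\<in>Basis. (v \<bullet> i) *\<^sub>R i)"
    by (simp add: euclidean_representation)
  then show ?thesis by (simp add: sum scaleR)
qed

text \<open>Directional derivatives in fixed directions are continuous, and so is the derivative as a function of
  point and direction, because it is linear in the direction.\<close>

lemma continuous_on_frechet_derivative:
  fixes X :: "'a::euclidean_space \<Rightarrow> 'b::real_normed_vector"
  assumes "C1_compact X" "continuous_on S f" "continuous_on S v"
  shows "continuous_on S (\<lambda>u. frechet_derivative X (at (f u)) (v u))"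
proof -
  have "continuous_on S (\<lambda>u. frechet_derivative X (at (f u)) i)" for i
    by (rule continuous_on_compose2 [OF C1_compact_D(2) [OF assms(1)] assms(2)]) auto
  then have "continuous_on S (\<lambda>u. \<Sum>i\<in>Basis. (v u \<bullet> i) *\<^sub>R frechet_derivative X (at (f u)) i)"
    by (intro continuous_intros assms)
  then show ?thesis
    by (subst frechet_derivative_sum_Basis [OF C1_compact_D(1) [OF assms(1)]])
qed

lemma C1_compact_radius:
  fixes X :: "'a::euclidean_space \<Rightarrow> 'b::real_normed_vector"
  assumes "C1_compact X"
  obtains R where "0 \<le> R" "\<And>x. R \<le> norm x \<Longrightarrow> X x = 0"
    "\<And>x v. R \<le> norm x \<Longrightarrow> frechet_derivative X (at x) v = 0"
proof -
  obtain K where K: "compact K" "\<And>x. x \<notin> K \<Longrightarrow> X x = 0"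
    using C1_compact_D(4) [OF assms] by (auto simp: compactly_supported_def)
  obtain R where R: "\<And>x. x \<in> K \<Longrightarrow> norm x \<le> R"
    using K(1) by (meson compact_imp_bounded bounded_iff)
  have out: "X x = 0" if "R < norm x" for x using K(2) [of x] R [of x] that by fastforce
  have d: "frechet_derivative X (at x) v = 0" if "R < norm x" for x v
  proof -
    have "((\<lambda>x. 0) has_derivative (\<lambda>v. 0)) (at x)" by simp
    then have "(X has_derivative (\<lambda>v. 0)) (at x)"
    proof (rule has_derivative_transform_within_open)
      show "open {x :: 'a. R < norm x}" by (intro open_Collect_less continuous_intros)
    qed (use that out in auto)
    then show ?thesis using frechet_derivative_at by metis
  qed
  show ?thesis by (rule that [of "max 0 (R + 1)"]) (auto intro!: out d)
qed

context sw_profile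
begin

definition F1_conormal where "F1_conormal u = sw_point p q (q * (p * sa (fst u))) (p * (q * sb (fst u))) (snd u)"
text \<open>The conormal to the lines of constant \<open>\<theta>\<close>, weighted with the length element of these lines.\<close>

definition sF2 where "sF2 u = J (sw_point p q (p * sa (fst u)) (- (q * sb (fst u))) (snd u))"
definition sF22 where "sF22 u = - sw_point p q (p * (p * sa (fst u))) (q * (q * sb (fst u))) (snd u)"

lemma continuous_sF2: "continuous_on S sF2" and continuous_sF22: "continuous_on S sF22"
  and continuous_F1_conormal: "continuous_on S F1_conormal"
  unfolding F1_conormal_def sF2_def sF22_def by (intro continuous_intros)+

lemma sF2_eq: "0 < fst u \<Longrightarrow> sF2 u = s (fst u) *\<^sub>R F2 u"
  unfolding sF2_def F2_def J_linear(2) [symmetric] sw_point_linear(2) [symmetric]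
  by (simp add: sa sb mult_ac)

text \<open>The two summands are the derivatives of the weighted conormals in their own directions. Their sum is
  the area density times the mean curvature vector, which is the Laplacian of the position vector.\<close>

lemma divergence_of_frame: "F1_conormal u + sF22 u = AH u"
proof -
  have "AH u = sw_point p q ((p - real q) * - (p * sa (fst u))) ((p - real q) * (q * sb (fst u))) (snd u)"
    by (simp only: AH_def sw_point_linear(2))
  then show ?thesis
    unfolding F1_conormal_def sF22_def sw_point_linear(3) [symmetric] sw_point_linear(1) [symmetric]
    by (simp add: algebra_simps)
qed

lemma conormal_has_vector_derivative:
  "0 < y \<Longrightarrow> ((\<lambda>y. conormal (y, \<theta>)) has_vector_derivative F1_conormal (y, \<theta>)) (at y)"
  unfolding conormal_def F1_conormal_def fst_conv snd_conv
  by (intro sw_point_has_vector_derivative_radius) (auto intro!: derivative_eq_intros deriv_a deriv_b)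

lemma sF2_has_vector_derivative:
  "((\<lambda>\<theta>. sF2 (y, \<theta>)) has_vector_derivative sF22 (y, \<theta>)) (at \<theta>)"
proof -
  have "sF22 (y, \<theta>) = J (J (sw_point p q (p * (p * sa y)) (- (q * - (q * sb y))) \<theta>))"
    by (simp add: sF22_def J_J)
  then show ?thesis
    unfolding sF2_def fst_conv snd_conv
    using bounded_linear.has_vector_derivative [OF bounded_linear_J sw_point_has_vector_derivative_angle]
    by (simp only:)
qed

lemma F_has_vector_derivative:
  "0 < y \<Longrightarrow> ((\<lambda>y. F (y, \<theta>)) has_vector_derivative F1 (y, \<theta>)) (at y)"
  "((\<lambda>\<theta>. F (y, \<theta>)) has_vector_derivative F2 (y, \<theta>)) (at \<theta>)"
  unfolding F_def F1_def F2_def fst_conv snd_conv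
  by (intro sw_point_has_vector_derivative_radius sw_point_has_vector_derivative_angle deriv_a deriv_b; simp)+

text \<open>If one radius vanishes at \<open>y = 0\<close>, the surface meets itself there in \<open>p\<close> or in \<open>q\<close> sheets over
  each point of a circle, and the conormals of these sheets are the vertices of a regular polygon. If
  both radii vanish, as for the cone, so does the conormal.\<close>

lemma seam_balanced:
  fixes X :: "C2 \<Rightarrow> C2"
  assumes "continuous_on UNIV X"
  shows "integral {0..2 * pi} (\<lambda>\<theta>. X (F (0, \<theta>)) \<bullet> conormal (0, \<theta>)) = 0"
proof -
  have cX: "continuous_on UNIV (\<lambda>\<theta>. X (F (0, \<theta>)))"
    by (rule continuous_on_compose2 [OF assms])
      (auto simp: F_def intro!: continuous_intros)
  have per: "F (0, \<theta> + 2 * pi) = F (0, \<theta>)" for \<theta>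
    by (simp add: F_def sw_point_periodic)
  have rot: "cis (real m * (\<theta> + 2 * pi / real m)) = cis (real m * \<theta>)"
    "cis (- (real m * (\<theta> + 2 * pi / real m))) = cis (- (real m * \<theta>))" if "1 < m" for m \<theta>
  proof -
    have "real m * (\<theta> + 2 * pi / real m) = real m * \<theta> + 2 * pi" using that by (simp add: field_simps)
    then show *: "cis (real m * (\<theta> + 2 * pi / real m)) = cis (real m * \<theta>)"
      by (simp add: cis_mult [symmetric])
    show "cis (- (real m * (\<theta> + 2 * pi / real m))) = cis (- (real m * \<theta>))"
      by (simp only: cis_cnj [symmetric] *)
  qed
  show ?thesis
    using seam
  proof
    assume a0: "a 0 = 0"
    have "F (0, \<theta> + 2 * pi / real q) = F (0, \<theta>)" for \<theta>
      by (simp only: F_def fst_conv snd_conv a0 sw_point_def rot(2) [OF weights(2)]) simp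
    then have "integral {0..2 * pi} (\<lambda>\<theta>. fst (X (F (0, \<theta>))) \<bullet> (of_real (q * b 0) * cis (1 * (p * \<theta>)))) = 0"
      using weights by (intro integral_seam [of _ q]) (auto simp: per coprime_commute intro!: continuous_on_fst cX)
    then show ?thesis using a0 by (simp add: conormal_def sw_point_def inner_prod_def)
  next
    assume b0: "b 0 = 0"
    have "F (0, \<theta> + 2 * pi / real p) = F (0, \<theta>)" for \<theta>
      by (simp only: F_def fst_conv snd_conv b0 sw_point_def rot(1) [OF weights(1)]) simp
    then have "integral {0..2 * pi} (\<lambda>\<theta>. snd (X (F (0, \<theta>))) \<bullet> ((\<i> * of_real (p * a 0)) * cis (- 1 * (q * \<theta>)))) = 0"
      using weights by (intro integral_seam [of _ p]) (auto simp: per intro!: continuous_on_snd cX)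
    then show ?thesis using b0 by (simp add: conormal_def sw_point_def inner_prod_def)
  qed
qed

text \<open>The divergence of \<open>X\<close> along the surface, times the area density, is a divergence in the
  coordinates minus the inner product with the mean curvature. The angular part integrates to zero by
  periodicity, the radial part leaves the boundary term at the seam.\<close>

lemma first_variation_V:
  assumes "C1_compact X"
  shows "first_variation V X = - (\<integral>x. X x \<bullet> sw_mean_curvature p q x \<partial>mass_measure V)"
proof -
  let ?d = "\<lambda>x. frechet_derivative X (at x)"
  note X = C1_compact_D [OF assms]
  have lin: "bounded_linear (?d x)" for x using X(1) by (rule has_derivative_bounded_linear)
  obtain R where R: "0 \<le> R" "\<And>x. R \<le> norm x \<Longrightarrow> X x = 0" "\<And>x v. R \<le> norm x \<Longrightarrow> ?d x v = 0"
    using C1_compact_radius [OF assms] by blast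
  have RF: "R \<le> norm (F u)" if "R \<le> fst u" for u using norm_F_ge [of u] that R(1) by linarith
  (* g1 and g2 are the radial derivative of X . conormal and the angular derivative of X . sF2 *)
  define g1 where "g1 u = ?d (F u) (F1 u) \<bullet> conormal u + X (F u) \<bullet> F1_conormal u" for u
  define g2 where "g2 u = ?d (F u) (F2 u) \<bullet> sF2 u + X (F u) \<bullet> sF22 u" for u
  define g3 where "g3 u = X (F u) \<bullet> AH u" for u
  have cXF: "continuous_on S (\<lambda>u. X (F u))" for S
    by (rule continuous_on_compose2 [OF X(3) continuous_F]) auto
  have c: "continuous_on UNIV g1" "continuous_on UNIV g2" "continuous_on UNIV g3"
    unfolding g1_def g2_def g3_def
    by (intro continuous_on_add continuous_on_inner continuous_on_frechet_derivative assms
        continuous_F continuous_F1 continuous_F2 continuous_conormal continuous_F1_conormal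
        continuous_sF2 continuous_sF22 continuous_AH cXF)+
  have c_trace: "continuous_on UNIV (\<lambda>z. \<Sum>b\<in>Basis. ?d (fst z) (blinfun_apply (snd z) b) \<bullet> b)"
    by (intro continuous_on_sum continuous_on_inner continuous_on_frechet_derivative assms
        continuous_intros)
  then have m_trace: "(\<lambda>z. \<Sum>b\<in>Basis. ?d (fst z) (blinfun_apply (snd z) b) \<bullet> b) \<in> borel_measurable borel"
    by (rule borel_measurable_continuous_onI)
  have trace: "A (fst u) * (\<Sum>b\<in>Basis. ?d (F u) (frame_proj (F1 u) (F2 u) b) \<bullet> b) = g1 u + g2 u - g3 u"
    if u: "u \<in> half_strip" for u
  proof -
    have y: "0 < fst u" using u by (auto simp: half_strip_def)
    interpret d: bounded_linear "?d (F u)" by (rule lin)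
    have "F1 u \<bullet> F1 u = s (fst u) * (s (fst u) * D (fst u))"
      by (simp add: F1_eq y inner_frame(1))
    then have "A (fst u) * (inverse (F1 u \<bullet> F1 u) * (?d (F u) (F1 u) \<bullet> F1 u)
          + inverse (F2 u \<bullet> F2 u) * (?d (F u) (F2 u) \<bullet> F2 u))
        = inverse (s (fst u)) * (?d (F u) (F1 u) \<bullet> F1 u) + s (fst u) * (?d (F u) (F2 u) \<bullet> F2 u)"
      using D_pos [OF y] positive(3) [OF y] by (simp add: A_eq y inner_frame(2) field_simps)
    also have "inverse (s (fst u)) * (?d (F u) (F1 u) \<bullet> F1 u) = ?d (F u) (F1 u) \<bullet> conormal u"
      using positive(3) [OF y] F1_eq [OF y] by simp
    also have "s (fst u) * (?d (F u) (F2 u) \<bullet> F2 u) = ?d (F u) (F2 u) \<bullet> sF2 u"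
      by (simp add: sF2_eq y)
    finally show ?thesis
      unfolding trace_frame_proj [OF lin]
      by (simp add: g1_def g2_def g3_def divergence_of_frame [symmetric] inner_add_right)
  qed
  have z: "g1 u = 0" "g2 u = 0" "g3 u = 0" if "R < fst u" for u
    using RF [of u] that R by (auto simp: g1_def g2_def g3_def)
  have m_lift: "lift \<in> area_measure \<rightarrow>\<^sub>M borel" using measurable_lift by (simp add: area_measure_def)
  have "first_variation V X = (\<integral>z. (\<Sum>b\<in>Basis. ?d (fst z) (blinfun_apply (snd z) b) \<bullet> b) \<partial>V)"
    unfolding first_variation_def case_prod_unfold by (rule refl)
  also have "\<dots> = (\<integral>u. (\<Sum>b\<in>Basis. ?d (fst (lift u)) (blinfun_apply (snd (lift u)) b) \<bullet> b) \<partial>area_measure)"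
    unfolding V_eq by (rule integral_distr [OF m_lift m_trace])
  also have "\<dots> = (\<integral>u. (indicator half_strip u * A (fst u)) *\<^sub>R
      (\<Sum>b\<in>Basis. ?d (fst (lift u)) (blinfun_apply (snd (lift u)) b) \<bullet> b) \<partial>lborel)"
    unfolding area_measure_def
  proof (rule integral_density)
    show "(\<lambda>u. \<Sum>b\<in>Basis. ?d (fst (lift u)) (blinfun_apply (snd (lift u)) b) \<bullet> b) \<in> borel_measurable lborel"
      using measurable_compose [OF measurable_lift m_trace] by simp
  qed (auto simp: weight_nonneg)
  also have "\<dots> = (\<integral>u. indicator half_strip u *\<^sub>R (g1 u + g2 u - g3 u) \<partial>lborel)"
    by (intro Bochner_Integration.integral_cong) (auto simp: indicator_def lift_half_strip trace)
  also have "\<dots> = strip_integral R (\<lambda>u. g1 u + g2 u - g3 u)"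
    by (rule half_strip_integral(2)) (auto intro!: continuous_intros c z simp: z)
  also have "\<dots> = strip_integral R g1 + strip_integral R g2
      - strip_integral R g3"
    using c by (simp add: integrable_continuous continuous_on_subset [OF _ subset_UNIV] integrable_add
        Henstock_Kurzweil_Integration.integral_diff Henstock_Kurzweil_Integration.integral_add)
  also have "strip_integral R g1 = - integral {0..2 * pi} (\<lambda>\<theta>. X (F (0, \<theta>)) \<bullet> conormal (0, \<theta>))"
  proof (rule box_integral_divergence_radius [OF _ c(1) R(1)])
    show "continuous_on UNIV (\<lambda>u. X (F u) \<bullet> conormal u)"
      by (intro continuous_on_inner cXF continuous_conormal)
    show "X (F (R, \<theta>)) \<bullet> conormal (R, \<theta>) = 0" for \<theta> using RF [of "(R, \<theta>)"] R by simp
    fix y \<theta> :: real assume y: "0 < y"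
    have "((\<lambda>y. X (F (y, \<theta>))) has_vector_derivative ?d (F (y, \<theta>)) (F1 (y, \<theta>))) (at y)"
      using vector_derivative_diff_chain_within [of "\<lambda>y. F (y, \<theta>)" "F1 (y, \<theta>)" y UNIV X]
        F_has_vector_derivative(1) [OF y] has_derivative_at_withinI [OF X(1)] by (simp add: o_def)
    then show "((\<lambda>y. X (F (y, \<theta>)) \<bullet> conormal (y, \<theta>)) has_vector_derivative g1 (y, \<theta>)) (at y)"
      using bounded_bilinear.has_vector_derivative [OF bounded_bilinear_inner _ conormal_has_vector_derivative [OF y]]
      unfolding g1_def by (fastforce simp: add.commute)
  qed
  also have "\<dots> = 0" by (simp add: seam_balanced X(3))
  also have "strip_integral R g2 = 0"
  proof (rule box_integral_divergence_angle [OF c(2)])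
    show "X (F (y, 2 * pi)) \<bullet> sF2 (y, 2 * pi) = X (F (y, 0)) \<bullet> sF2 (y, 0)" for y
      using sw_point_periodic [of p q _ _ 0] by (simp add: F_def sF2_def)
    fix y \<theta> :: real
    have "((\<lambda>\<theta>. X (F (y, \<theta>))) has_vector_derivative ?d (F (y, \<theta>)) (F2 (y, \<theta>))) (at \<theta>)"
      using vector_derivative_diff_chain_within [of "\<lambda>\<theta>. F (y, \<theta>)" "F2 (y, \<theta>)" \<theta> UNIV X]
        F_has_vector_derivative(2) has_derivative_at_withinI [OF X(1)] by (simp add: o_def)
    then show "((\<lambda>\<theta>. X (F (y, \<theta>)) \<bullet> sF2 (y, \<theta>)) has_vector_derivative g2 (y, \<theta>)) (at \<theta>)"
      using bounded_bilinear.has_vector_derivative [OF bounded_bilinear_inner _ sF2_has_vector_derivative]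
      unfolding g2_def by (fastforce simp: add.commute)
  qed
  also have "strip_integral R g3 = (\<integral>u. indicator half_strip u *\<^sub>R g3 u \<partial>lborel)"
    by (rule half_strip_integral(2) [symmetric]) (auto intro: c z)
  also have "\<dots> = (\<integral>u. indicator half_strip u *\<^sub>R (A (fst u) *\<^sub>R (X (F u) \<bullet> sw_mean_curvature p q (F u))) \<partial>lborel)"
  proof (intro Bochner_Integration.integral_cong refl)
    fix u :: "real \<times> real"
    have "g3 u = A (fst u) *\<^sub>R (X (F u) \<bullet> sw_mean_curvature p q (F u))" if "0 < fst u"
      unfolding g3_def A_sw_mean_curvature [OF that, symmetric] by simp
    then show "indicator half_strip u *\<^sub>R g3 u
        = indicator half_strip u *\<^sub>R (A (fst u) *\<^sub>R (X (F u) \<bullet> sw_mean_curvature p q (F u)))"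
      by (auto simp: indicator_def half_strip_def)
  qed
  also have "\<dots> = (\<integral>x. X x \<bullet> sw_mean_curvature p q x \<partial>mass_measure V)"
  proof (rule integral_mass_V(2) [symmetric])
    have [measurable]: "X \<in> borel_measurable borel" using X(3) by (rule borel_measurable_continuous_onI)
    show "(\<lambda>x. X x \<bullet> sw_mean_curvature p q x) \<in> borel_measurable borel" by measurable
  qed
  finally show ?thesis by simp
qed

lemma generalized_mean_curvature_V: "generalized_mean_curvature V (sw_mean_curvature p q)"
  unfolding generalized_mean_curvature_def
proof (intro conjI allI impI)
  fix K :: "C2 set" assume K: "compact K"
  then obtain R where R: "\<And>x. x \<in> K \<Longrightarrow> norm x \<le> R"
    by (meson compact_imp_bounded bounded_iff)
  have [measurable]: "K \<in> sets borel" using K by (simp add: borel_compact)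
  have [measurable]: "(\<lambda>x. indicat_real K x *\<^sub>R sw_mean_curvature p q x) \<in> borel_measurable borel"
    by measurable
  have "integrable lborel (\<lambda>u. indicator half_strip u *\<^sub>R (A (fst u) *\<^sub>R (indicat_real K (F u) *\<^sub>R sw_mean_curvature p q (F u))))"
  proof (rule Bochner_Integration.integrable_bound [OF half_strip_integrable_bounded [OF continuous_AH, of R]])
    show "AE u in lborel. norm (indicat_real half_strip u *\<^sub>R (A (fst u) *\<^sub>R (indicat_real K (F u) *\<^sub>R sw_mean_curvature p q (F u))))
        \<le> norm (indicat_real (half_strip \<inter> {u. fst u \<le> R}) u *\<^sub>R AH u)"
    proof (rule AE_I2)
      fix u :: "real \<times> real"
      have "norm (A (fst u) *\<^sub>R (indicat_real K (F u) *\<^sub>R sw_mean_curvature p q (F u)))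
          \<le> norm (indicat_real {u. fst u \<le> R} u *\<^sub>R AH u)" if "0 < fst u"
        using R [of "F u"] norm_F_ge [of u] that
        unfolding A_sw_mean_curvature [OF that, symmetric] by (auto simp: indicator_def)
      then show "norm (indicat_real half_strip u *\<^sub>R (A (fst u) *\<^sub>R (indicat_real K (F u) *\<^sub>R sw_mean_curvature p q (F u))))
        \<le> norm (indicat_real (half_strip \<inter> {u. fst u \<le> R}) u *\<^sub>R AH u)"
        by (auto simp: indicator_def half_strip_def split: if_splits)
    qed
  qed measurable
  then show "set_integrable (mass_measure V) K (sw_mean_curvature p q)"
    unfolding set_integrable_def by (subst integral_mass_V(1)) auto
qed (simp_all add: first_variation_V)

end


section \<open>First variation of the mass along the motion\<close>

lemma C1_compact_derivative_bound:
  fixes X :: "'a::euclidean_space \<Rightarrow> 'b::real_normed_vector"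
  assumes "C1_compact X"
  obtains L where "0 \<le> L" "\<And>x v. norm (frechet_derivative X (at x) v) \<le> L * norm v"
proof -
  obtain R where R: "\<And>x v. R \<le> norm x \<Longrightarrow> frechet_derivative X (at x) v = 0"
    using C1_compact_radius [OF assms] by metis
  have "\<exists>C. \<forall>x. norm (frechet_derivative X (at x) i) \<le> C" for i
  proof -
    have "compactly_supported (\<lambda>x. frechet_derivative X (at x) i)"
      unfolding compactly_supported_def using R by (intro exI [of _ "cball 0 R"]) auto
    from compactly_supported_bound [OF this C1_compact_D(2) [OF assms]] show ?thesis by metis
  qed
  then obtain C where C: "\<And>i x. norm (frechet_derivative X (at x) i) \<le> C i" by metis
  have C0: "0 \<le> C i" for i using order_trans [OF norm_ge_zero C [of 0 i]] .
  show ?thesis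
  proof (rule that)
    show "0 \<le> (\<Sum>i\<in>Basis. C i)" by (simp add: sum_nonneg C0)
    fix x v
    have "norm (frechet_derivative X (at x) v) \<le> (\<Sum>i\<in>Basis. norm ((v \<bullet> i) *\<^sub>R frechet_derivative X (at x) i))"
      by (subst frechet_derivative_sum_Basis [OF C1_compact_D(1) [OF assms]]) (rule norm_sum)
    also have "\<dots> \<le> (\<Sum>i\<in>Basis. C i * norm v)"
    proof (rule sum_mono)
      fix i :: 'a assume "i \<in> Basis"
      then have "\<bar>v \<bullet> i\<bar> * norm (frechet_derivative X (at x) i) \<le> norm v * C i"
        by (intro mult_mono Basis_le_norm C) auto
      then show "norm ((v \<bullet> i) *\<^sub>R frechet_derivative X (at x) i) \<le> C i * norm v"
        by (simp add: mult.commute)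
    qed
    finally show "norm (frechet_derivative X (at x) v) \<le> (\<Sum>i\<in>Basis. C i) * norm v"
      by (simp add: sum_distrib_right)
  qed
qed

lemma continuous_C1_derivative:
  fixes X :: "'a::euclidean_space \<Rightarrow> 'b::real_normed_vector"
  assumes "C1_compact X"
  shows "isCont (\<lambda>z. frechet_derivative X (at (fst z)) (snd z)) z"
proof -
  have "continuous_on UNIV (\<lambda>z::'a \<times> 'a. frechet_derivative X (at (fst z)) (snd z))"
    by (intro continuous_on_frechet_derivative assms continuous_intros)
  then show ?thesis by (cases z) (simp add: continuous_on_eq_continuous_at)
qed

lemma measurable_C1_derivative:
  fixes X :: "'a::euclidean_space \<Rightarrow> 'b::euclidean_space"
  assumes "C1_compact X" and [measurable]: "h \<in> borel_measurable borel"
  shows "(\<lambda>x. frechet_derivative X (at x) (h x)) \<in> borel_measurable borel"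
proof -
  have [measurable]: "(\<lambda>x. frechet_derivative X (at x) i) \<in> borel_measurable borel" for i
    by (rule borel_measurable_continuous_onI [OF C1_compact_D(2) [OF assms(1)]])
  have "(\<lambda>x. \<Sum>i\<in>Basis. (h x \<bullet> i) *\<^sub>R frechet_derivative X (at x) i) \<in> borel_measurable borel"
    by measurable
  then show ?thesis
    by (subst frechet_derivative_sum_Basis [OF C1_compact_D(1) [OF assms(1)]])
qed

lemma brakke_delta_cong_AE:
  assumes "C1_compact \<phi>" "generalized_mean_curvature V h" "generalized_mean_curvature V h'"
  shows "brakke_delta V \<phi> h = brakke_delta V \<phi> h'"
proof -
  have sets: "sets (mass_measure V) = sets borel" by (simp add: mass_measure_def)
  note [measurable_cong] = sets
  have [measurable]: "h \<in> borel_measurable borel" "h' \<in> borel_measurable borel"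
    using assms by (auto simp: generalized_mean_curvature_def)
  have [measurable]: "\<phi> \<in> borel_measurable borel"
    by (rule borel_measurable_continuous_onI [OF C1_compact_D(3) [OF assms(1)]])
  have [measurable]: "(\<lambda>x. frechet_derivative \<phi> (at x) (h x)) \<in> borel_measurable borel"
    "(\<lambda>x. frechet_derivative \<phi> (at x) (h' x)) \<in> borel_measurable borel"
    by (auto intro: measurable_C1_derivative assms)
  note AE = generalized_mean_curvature_unique [OF assms(2,3)]
  have 1: "AE x in mass_measure V. \<phi> x * (norm (h x))\<^sup>2 = \<phi> x * (norm (h' x))\<^sup>2"
    using AE by eventually_elim simp
  have 2: "AE x in mass_measure V. frechet_derivative \<phi> (at x) (h x) = frechet_derivative \<phi> (at x) (h' x)"
    using AE by eventually_elim simp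
  have "(\<integral>\<^sup>+x. ennreal (\<phi> x * (norm (h x))\<^sup>2) \<partial>mass_measure V) = (\<integral>\<^sup>+x. ennreal (\<phi> x * (norm (h' x))\<^sup>2) \<partial>mass_measure V)"
    by (rule nn_integral_cong_AE) (use 1 in eventually_elim, simp only:)
  moreover have "(\<integral>x. \<phi> x * (norm (h x))\<^sup>2 \<partial>mass_measure V) = (\<integral>x. \<phi> x * (norm (h' x))\<^sup>2 \<partial>mass_measure V)"
    by (rule integral_cong_AE [OF _ _ 1]) measurable
  moreover have "(\<integral>x. frechet_derivative \<phi> (at x) (h x) \<partial>mass_measure V) = (\<integral>x. frechet_derivative \<phi> (at x) (h' x) \<partial>mass_measure V)"
    by (rule integral_cong_AE [OF _ _ 2]) measurable
  ultimately show ?thesis unfolding brakke_delta_def by simp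
qed

context sw_profile
begin

text \<open>The factor \<open>sa / a\<close> is \<open>s\<close>, so this is the density of \<open>\<phi> \<bar>H\<bar>\<^sup>2\<close> in the coordinates.\<close>

definition dissipation :: "(C2 \<Rightarrow> real) \<Rightarrow> real \<times> real \<Rightarrow> real" where
  "dissipation \<phi> u = indicator half_strip u * ((real p - real q)\<^sup>2 * (sa (fst u) / a (fst u)) * \<phi> (F u))"

text \<open>The density of \<open>D\<phi> (H)\<close> in the coordinates.\<close>

definition transport :: "(C2 \<Rightarrow> real) \<Rightarrow> real \<times> real \<Rightarrow> real" where
  "transport \<phi> u = indicator half_strip u * frechet_derivative \<phi> (at (F u)) (AH u)"

lemma dissipation_measurable:
  assumes "continuous_on UNIV \<phi>"
  shows "dissipation \<phi> \<in> borel_measurable borel"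
proof -
  have [measurable]: "\<phi> \<in> borel_measurable borel" using assms by (rule borel_measurable_continuous_onI)
  have [measurable]: "(\<lambda>u. sa (fst u :: real)) \<in> borel_measurable (borel :: (real \<times> real) measure)"
    "(\<lambda>u. a (fst u :: real)) \<in> borel_measurable (borel :: (real \<times> real) measure)"
    by (intro borel_measurable_continuous_onI continuous_intros)+
  show ?thesis unfolding dissipation_def by measurable
qed

lemma transport_integrable:
  assumes "C1_compact \<phi>"
  shows "integrable lborel (transport \<phi>)"
proof -
  obtain R where R: "0 \<le> R" "\<And>x v. R \<le> norm x \<Longrightarrow> frechet_derivative \<phi> (at x) v = 0"
    using C1_compact_radius [OF assms] by metis
  have "continuous_on UNIV (\<lambda>u. frechet_derivative \<phi> (at (F u)) (AH u))"
    by (intro continuous_on_frechet_derivative assms continuous_F continuous_AH)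
  moreover have "frechet_derivative \<phi> (at (F u)) (AH u) = 0" if "fst u > R" for u
    using norm_F_ge [of u] R that by auto
  ultimately show ?thesis
    using half_strip_integral(1) [of "\<lambda>u. frechet_derivative \<phi> (at (F u)) (AH u)" R]
    unfolding transport_def by simp
qed

lemma brakke_delta_V:
  assumes "C1_compact \<phi>" "\<And>x. 0 \<le> \<phi> x" "generalized_mean_curvature V h"
  shows "brakke_delta V \<phi> h =
    (if (\<integral>\<^sup>+u. ennreal (dissipation \<phi> u) \<partial>lborel) = \<infinity> then - \<infinity>
     else ereal (- (\<integral>u. dissipation \<phi> u \<partial>lborel) + (\<integral>u. transport \<phi> u \<partial>lborel)))"
proof -
  let ?h = "sw_mean_curvature p q"
  note C = C1_compact_D [OF assms(1)]
  have [measurable]: "\<phi> \<in> borel_measurable borel" using C(3) by (rule borel_measurable_continuous_onI)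
  have [measurable]: "(\<lambda>x. frechet_derivative \<phi> (at x) (?h x)) \<in> borel_measurable borel"
    by (intro measurable_C1_derivative assms sw_mean_curvature_measurable)
  have y: "0 < fst u" if "u \<in> half_strip" for u using that by (auto simp: half_strip_def)
  have 1: "(indicator half_strip u * A (fst u)) * (\<phi> (F u) * (norm (?h (F u)))\<^sup>2) = dissipation \<phi> u" for u
  proof (cases "u \<in> half_strip")
    case True
    have "A (fst u) * (\<phi> (F u) * (norm (?h (F u)))\<^sup>2) = (A (fst u) * (norm (?h (F u)))\<^sup>2) * \<phi> (F u)" by simp
    then show ?thesis
      using True positive(1) [OF y [OF True]]
      by (simp add: dissipation_def A_sw_mean_curvature_norm2 [OF y] sa [OF y])
  qed (simp add: dissipation_def)
  have 2: "indicator half_strip u *\<^sub>R (A (fst u) *\<^sub>R frechet_derivative \<phi> (at (F u)) (?h (F u))) = transport \<phi> u" for u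
  proof (cases "u \<in> half_strip")
    case True
    interpret d: bounded_linear "frechet_derivative \<phi> (at (F u))" using C(1) by (rule has_derivative_bounded_linear)
    show ?thesis
      using True by (simp add: transport_def A_sw_mean_curvature [OF y, symmetric] d.scaleR)
  qed (simp add: transport_def)
  have "brakke_delta V \<phi> h = brakke_delta V \<phi> ?h"
    by (rule brakke_delta_cong_AE [OF assms(1,3) generalized_mean_curvature_V])
  moreover have "(\<integral>\<^sup>+x. ennreal (\<phi> x * (norm (?h x))\<^sup>2) \<partial>mass_measure V) = (\<integral>\<^sup>+u. ennreal (dissipation \<phi> u) \<partial>lborel)"
    by (subst nn_integral_mass_V) (auto simp: ennreal_mult [symmetric] weight_nonneg assms(2) 1)
  moreover have "(\<integral>x. \<phi> x * (norm (?h x))\<^sup>2 \<partial>mass_measure V) = (\<integral>u. dissipation \<phi> u \<partial>lborel)"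
    by (subst integral_mass_V(2)) (auto intro!: Bochner_Integration.integral_cong simp: 1 [symmetric] mult.assoc)
  moreover have "(\<integral>x. frechet_derivative \<phi> (at x) (?h x) \<partial>mass_measure V) = (\<integral>u. transport \<phi> u \<partial>lborel)"
    by (subst integral_mass_V(2)) (auto intro!: Bochner_Integration.integral_cong simp: 2 [symmetric])
  ultimately show ?thesis unfolding brakke_delta_def by simp
qed

lemma mass_V:
  assumes "continuous_on UNIV \<phi>" "\<And>x. R \<le> norm x \<Longrightarrow> \<phi> x = 0"
  shows "mass V \<phi> = (\<integral>u. indicator half_strip u * (A (fst u) * \<phi> (F u)) \<partial>lborel)"
    and "mass V \<phi> = strip_integral R (\<lambda>u. A (fst u) * \<phi> (F u))"
proof -
  have [measurable]: "\<phi> \<in> borel_measurable borel" using assms(1) by (rule borel_measurable_continuous_onI)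
  show 1: "mass V \<phi> = (\<integral>u. indicator half_strip u * (A (fst u) * \<phi> (F u)) \<partial>lborel)"
    unfolding mass_def by (subst integral_mass_V(2)) auto
  have "continuous_on UNIV (\<lambda>u. A (fst u) * \<phi> (F u))"
    by (intro continuous_on_mult continuous_A continuous_on_compose2 [OF assms(1) continuous_F]) auto
  moreover have "A (fst u) * \<phi> (F u) = 0" if "u \<in> half_strip" "fst u > R" for u
    using norm_F_ge [of u] assms(2) [of "F u"] that by (auto simp: half_strip_def)
  ultimately show "mass V \<phi> = strip_integral R (\<lambda>u. A (fst u) * \<phi> (F u))"
    unfolding 1 using half_strip_integral(2) [of "\<lambda>u. A (fst u) * \<phi> (F u)" R] by simp
qed

text \<open>The radii move with velocity \<open>(a1, b1)\<close> and the area density changes at the rate \<open>A1\<close>. The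
  hypotheses on the velocity say that the surface moves by its mean curvature vector plus the
  tangential field \<open>w / A\<close> in the radial direction. The tangential part contributes the radial
  derivative of \<open>w \<phi>\<close>, whose integral vanishes because \<open>w\<close> vanishes at the seam.\<close>

lemma mass_derivative_integrand:
  fixes a1 b1 A1 w w' sc :: "real \<Rightarrow> real"
  assumes "C1_compact \<phi>"
    and cont: "continuous_on UNIV w" "continuous_on UNIV w'" "continuous_on UNIV sc"
    and w: "w 0 = 0" "\<And>y. 0 < y \<Longrightarrow> (w has_real_derivative w' y) (at y)"
    and sc: "\<And>y. 0 < y \<Longrightarrow> sc y = sa y / a y"
    and velocity: "\<And>y. A y * a1 y = - ((real p - real q) * (p * sa y)) + w y * (q * sb y)"
      "\<And>y. A y * b1 y = (real p - real q) * (q * sb y) + w y * (p * sa y)"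
    and dilation: "\<And>y. A1 y = - ((real p - real q)\<^sup>2 * sc y) + w' y"
    and R: "0 \<le> R" "\<And>x. R \<le> norm x \<Longrightarrow> \<phi> x = 0" "\<And>x v. R \<le> norm x \<Longrightarrow> frechet_derivative \<phi> (at x) v = 0"
  shows "strip_integral R (\<lambda>u. A1 (fst u) * \<phi> (F u) + A (fst u) *
        frechet_derivative \<phi> (at (F u)) (sw_point p q (a1 (fst u)) (b1 (fst u)) (snd u)))
      = - (\<integral>u. dissipation \<phi> u \<partial>lborel) + (\<integral>u. transport \<phi> u \<partial>lborel)"
    and "integrable lborel (dissipation \<phi>)"
proof -
  let ?d = "\<lambda>x. frechet_derivative \<phi> (at x)"
  note C = C1_compact_D [OF assms(1)]
  have RF: "R \<le> norm (F u)" if "R \<le> fst u" for u using norm_F_ge [of u] that R(1) by linarith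
  have cfst: "continuous_on UNIV (\<lambda>u::real \<times> real. w (fst u))" "continuous_on UNIV (\<lambda>u::real \<times> real. w' (fst u))"
    "continuous_on UNIV (\<lambda>u::real \<times> real. sc (fst u))"
    by (rule continuous_on_compose2 [OF cont(1)] continuous_on_compose2 [OF cont(2)]
      continuous_on_compose2 [OF cont(3)]; auto intro!: continuous_intros)+
  have c\<phi>F: "continuous_on UNIV (\<lambda>u. \<phi> (F u))"
    by (rule continuous_on_compose2 [OF C(3) continuous_F]) auto
  define g1 where "g1 u = - ((real p - real q)\<^sup>2 * sc (fst u) * \<phi> (F u))" for u
  define g2 where "g2 u = ?d (F u) (AH u)" for u
  define g3 where "g3 u = w (fst u) * ?d (F u) (F1 u) + w' (fst u) * \<phi> (F u)" for u
  have c: "continuous_on UNIV g1" "continuous_on UNIV g2" "continuous_on UNIV g3"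
    unfolding g1_def g2_def g3_def
    by (intro continuous_intros cfst c\<phi>F continuous_on_frechet_derivative assms(1)
        continuous_F continuous_F1 continuous_AH)+
  have z: "g1 u = 0" "g2 u = 0" if "R < fst u" for u
    using RF [of u] that R by (auto simp: g1_def g2_def)
  have "A1 (fst u) * \<phi> (F u) + A (fst u) * ?d (F u) (sw_point p q (a1 (fst u)) (b1 (fst u)) (snd u))
      = g1 u + g2 u + g3 u" for u
  proof -
    interpret d: bounded_linear "?d (F u)" using C(1) by (rule has_derivative_bounded_linear)
    have "A (fst u) *\<^sub>R sw_point p q (a1 (fst u)) (b1 (fst u)) (snd u) = AH u + w (fst u) *\<^sub>R F1 u"
      unfolding AH_def F1_def sw_point_linear(2) [symmetric] sw_point_linear(1) [symmetric]
      by (simp add: velocity)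
    then have "A (fst u) * ?d (F u) (sw_point p q (a1 (fst u)) (b1 (fst u)) (snd u))
        = ?d (F u) (AH u) + w (fst u) * ?d (F u) (F1 u)"
      by (metis d.scaleR d.add real_scaleR_def)
    then show ?thesis by (simp add: g1_def g2_def g3_def dilation algebra_simps)
  qed
  then have "strip_integral R (\<lambda>u. A1 (fst u) * \<phi> (F u) + A (fst u) *
        frechet_derivative \<phi> (at (F u)) (sw_point p q (a1 (fst u)) (b1 (fst u)) (snd u)))
      = strip_integral R (\<lambda>u. g1 u + g2 u + g3 u)"
    by simp
  also have "\<dots> = strip_integral R g1 + strip_integral R g2
      + strip_integral R g3"
    using c by (simp add: integrable_continuous continuous_on_subset [OF _ subset_UNIV] integrable_add
        Henstock_Kurzweil_Integration.integral_add)
  also have "strip_integral R g3 = - integral {0..2 * pi} (\<lambda>\<theta>. w (fst (0, \<theta>)) * \<phi> (F (0, \<theta>)))"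
  proof (rule box_integral_divergence_radius [OF _ c(3) R(1), where \<Phi> = "\<lambda>u. w (fst u) * \<phi> (F u)"])
    show "continuous_on UNIV (\<lambda>u. w (fst u) * \<phi> (F u))" by (intro continuous_intros cfst c\<phi>F)
    show "w (fst (R, \<theta>)) * \<phi> (F (R, \<theta>)) = 0" for \<theta> using RF [of "(R, \<theta>)"] R by simp
    fix y \<theta> :: real assume y: "0 < y"
    have "((\<lambda>y. \<phi> (F (y, \<theta>))) has_vector_derivative ?d (F (y, \<theta>)) (F1 (y, \<theta>))) (at y)"
      using vector_derivative_diff_chain_within [of "\<lambda>y. F (y, \<theta>)" "F1 (y, \<theta>)" y UNIV \<phi>]
        F_has_vector_derivative(1) [OF y] has_derivative_at_withinI [OF C(1)] by (simp add: o_def)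
    then have "((\<lambda>y. \<phi> (F (y, \<theta>))) has_real_derivative ?d (F (y, \<theta>)) (F1 (y, \<theta>))) (at y)"
      by (simp add: has_real_derivative_iff_has_vector_derivative)
    from DERIV_mult [OF w(2) [OF y] this]
    show "((\<lambda>y. w (fst (y, \<theta>)) * \<phi> (F (y, \<theta>))) has_vector_derivative g3 (y, \<theta>)) (at y)"
      unfolding has_real_derivative_iff_has_vector_derivative by (simp add: g3_def algebra_simps)
  qed
  also have "\<dots> = 0" by (simp add: w(1))
  also have "strip_integral R g1 = (\<integral>u. indicator half_strip u *\<^sub>R g1 u \<partial>lborel)"
    by (rule half_strip_integral(2) [symmetric]) (auto intro: c z)
  also have "(\<lambda>u. indicator half_strip u *\<^sub>R g1 u) = (\<lambda>u. - dissipation \<phi> u)"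
    by (auto simp: fun_eq_iff g1_def dissipation_def indicator_def half_strip_def sc)
  also have "strip_integral R g2 = (\<integral>u. indicator half_strip u *\<^sub>R g2 u \<partial>lborel)"
    by (rule half_strip_integral(2) [symmetric]) (auto intro: c z)
  finally show "strip_integral R (\<lambda>u. A1 (fst u) * \<phi> (F u) + A (fst u) *
        frechet_derivative \<phi> (at (F u)) (sw_point p q (a1 (fst u)) (b1 (fst u)) (snd u)))
      = - (\<integral>u. dissipation \<phi> u \<partial>lborel) + (\<integral>u. transport \<phi> u \<partial>lborel)"
    by (simp add: g2_def transport_def)
  have "integrable lborel (\<lambda>u. indicator half_strip u *\<^sub>R g1 u)"
    by (rule half_strip_integral(1)) (auto intro: c z)
  then show "integrable lborel (dissipation \<phi>)"
    unfolding \<open>(\<lambda>u. indicator half_strip u *\<^sub>R g1 u) = (\<lambda>u. - dissipation \<phi> u)\<close> by simp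
qed

end

text \<open>Differentiation under the integral sign over a fixed box: the support of a test function bounds \<open>y\<close>
  independently of the time.\<close>

lemma swept_mass_has_derivative:
  fixes a b A a1 b1 A1 :: "real \<Rightarrow> real \<Rightarrow> real"
  assumes "C1_compact \<phi>" "open I" "convex I" "t \<in> I"
    and deriv: "\<And>t y. t \<in> I \<Longrightarrow> ((\<lambda>t. a t y) has_real_derivative a1 t y) (at t)"
      "\<And>t y. t \<in> I \<Longrightarrow> ((\<lambda>t. b t y) has_real_derivative b1 t y) (at t)"
      "\<And>t y. t \<in> I \<Longrightarrow> ((\<lambda>t. A t y) has_real_derivative A1 t y) (at t)"
    and cont: "continuous_on (I \<times> UNIV) (\<lambda>z. a (fst z) (snd z))" "continuous_on (I \<times> UNIV) (\<lambda>z. b (fst z) (snd z))"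
      "continuous_on (I \<times> UNIV) (\<lambda>z. A (fst z) (snd z))" "continuous_on (I \<times> UNIV) (\<lambda>z. a1 (fst z) (snd z))"
      "continuous_on (I \<times> UNIV) (\<lambda>z. b1 (fst z) (snd z))" "continuous_on (I \<times> UNIV) (\<lambda>z. A1 (fst z) (snd z))"
  shows "((\<lambda>t. strip_integral R (\<lambda>u. A t (fst u) * \<phi> (sw_point p q (a t (fst u)) (b t (fst u)) (snd u))))
    has_real_derivative strip_integral R (\<lambda>u.
      A1 t (fst u) * \<phi> (sw_point p q (a t (fst u)) (b t (fst u)) (snd u)) + A t (fst u) *
        frechet_derivative \<phi> (at (sw_point p q (a t (fst u)) (b t (fst u)) (snd u)))
          (sw_point p q (a1 t (fst u)) (b1 t (fst u)) (snd u)))) (at t)"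
proof -
  note C = C1_compact_D [OF assms(1)]
  have c: "continuous_on (I \<times> B) (\<lambda>z. f (fst z) (fst (snd z)))"
    if "continuous_on (I \<times> UNIV) (\<lambda>z. f (fst z) (snd z))" for f and B :: "(real \<times> real) set"
    by (rule continuous_on_compose2 [OF that, of "I \<times> B" "\<lambda>z. (fst z, fst (snd z))", unfolded fst_conv snd_conv])
      (auto intro!: continuous_intros)
  have csw: "continuous_on (I \<times> B) (\<lambda>z. sw_point p q (a (fst z) (fst (snd z))) (b (fst z) (fst (snd z))) (snd (snd z)))"
    "continuous_on (I \<times> B) (\<lambda>z. sw_point p q (a1 (fst z) (fst (snd z))) (b1 (fst z) (fst (snd z))) (snd (snd z)))"
    for B :: "(real \<times> real) set"
    by (intro continuous_intros c [OF cont(1)] c [OF cont(2)] c [OF cont(4)] c [OF cont(5)])+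
  have c\<phi>: "continuous_on (I \<times> B) (\<lambda>z. \<phi> (sw_point p q (a (fst z) (fst (snd z))) (b (fst z) (fst (snd z))) (snd (snd z))))"
    for B :: "(real \<times> real) set"
    by (rule continuous_on_compose2 [OF C(3) csw(1)]) auto
  have d: "((\<lambda>t. A t (fst u) * \<phi> (sw_point p q (a t (fst u)) (b t (fst u)) (snd u))) has_real_derivative
      A1 t (fst u) * \<phi> (sw_point p q (a t (fst u)) (b t (fst u)) (snd u)) + A t (fst u) *
        frechet_derivative \<phi> (at (sw_point p q (a t (fst u)) (b t (fst u)) (snd u)))
          (sw_point p q (a1 t (fst u)) (b1 t (fst u)) (snd u))) (at t within I)" if t: "t \<in> I" for t u
  proof -
    have "((\<lambda>t. \<phi> (sw_point p q (a t (fst u)) (b t (fst u)) (snd u))) has_vector_derivative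
        frechet_derivative \<phi> (at (sw_point p q (a t (fst u)) (b t (fst u)) (snd u)))
          (sw_point p q (a1 t (fst u)) (b1 t (fst u)) (snd u))) (at t)"
      using vector_derivative_diff_chain_within [of "\<lambda>t. sw_point p q (a t (fst u)) (b t (fst u)) (snd u)"
          "sw_point p q (a1 t (fst u)) (b1 t (fst u)) (snd u)" t UNIV \<phi>]
        sw_point_has_vector_derivative_radius [OF deriv(1,2) [OF t], of p q "fst u" "fst u" "snd u"]
        has_derivative_at_withinI [OF C(1)]
      by (simp add: o_def)
    then have "((\<lambda>t. \<phi> (sw_point p q (a t (fst u)) (b t (fst u)) (snd u))) has_real_derivative
        frechet_derivative \<phi> (at (sw_point p q (a t (fst u)) (b t (fst u)) (snd u)))
          (sw_point p q (a1 t (fst u)) (b1 t (fst u)) (snd u))) (at t)"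
      by (simp add: has_real_derivative_iff_has_vector_derivative)
    from DERIV_mult [OF deriv(3) [OF t, of "fst u"] this] show ?thesis
      by (rule has_field_derivative_at_within [OF DERIV_cong]) (simp only: mult.commute [of "A t (fst u)"])
  qed
  have "((\<lambda>t. strip_integral R (\<lambda>u. A t (fst u) * \<phi> (sw_point p q (a t (fst u)) (b t (fst u)) (snd u))))
    has_real_derivative strip_integral R (\<lambda>u.
      A1 t (fst u) * \<phi> (sw_point p q (a t (fst u)) (b t (fst u)) (snd u)) + A t (fst u) *
        frechet_derivative \<phi> (at (sw_point p q (a t (fst u)) (b t (fst u)) (snd u)))
          (sw_point p q (a1 t (fst u)) (b1 t (fst u)) (snd u)))) (at t within I)"
  proof (rule leibniz_rule_field_derivative [OF d _ _ assms(4,3)])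
    let ?B = "cbox (0, 0) (R, 2 * pi)"
    show "(\<lambda>u. A t (fst u) * \<phi> (sw_point p q (a t (fst u)) (b t (fst u)) (snd u))) integrable_on ?B" if "t \<in> I" for t
    proof (rule integrable_continuous)
      have "continuous_on (I \<times> ?B) (\<lambda>z. A (fst z) (fst (snd z)) *
          \<phi> (sw_point p q (a (fst z) (fst (snd z))) (b (fst z) (fst (snd z))) (snd (snd z))))"
        by (intro continuous_on_mult c [OF cont(3)] c\<phi>)
      note * = this
      show "continuous_on ?B (\<lambda>u. A t (fst u) * \<phi> (sw_point p q (a t (fst u)) (b t (fst u)) (snd u)))"
        by (rule continuous_on_compose2 [OF *, of ?B "\<lambda>u. (t, u)", unfolded fst_conv snd_conv])
          (use that in \<open>auto intro!: continuous_intros\<close>)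
    qed
    show "continuous_on (I \<times> ?B) (\<lambda>(t, u). A1 t (fst u) * \<phi> (sw_point p q (a t (fst u)) (b t (fst u)) (snd u)) + A t (fst u) *
        frechet_derivative \<phi> (at (sw_point p q (a t (fst u)) (b t (fst u)) (snd u)))
          (sw_point p q (a1 t (fst u)) (b1 t (fst u)) (snd u)))"
      unfolding case_prod_unfold
      by (intro continuous_on_add continuous_on_mult c [OF cont(3)] c [OF cont(6)] c\<phi>
          continuous_on_frechet_derivative assms(1) csw)
  qed
  then show ?thesis by (simp only: at_within_open [OF assms(4,2)])
qed


section \<open>The self-similar motion through the cone\<close>

text \<open>At time \<open>t\<close> the radii satisfy \<open>p a\<^sup>2 - q b\<^sup>2 = - 2 (p - q) t\<close>. The coordinate \<open>y\<close> is chosen so that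
  the radius that reaches \<open>0\<close> at the seam is a multiple of \<open>y\<close>; it may then be continued to
  negative \<open>y\<close>.\<close>

definition rad_a :: "nat \<Rightarrow> nat \<Rightarrow> real \<Rightarrow> real \<Rightarrow> real" where
  "rad_a p q t y = (if t < 0 then sqrt (real q / real (p + q) * y\<^sup>2 + 2 * (real p - real q) * (- t) / real p)
     else sqrt (real q / real (p + q)) * y)"

definition rad_b :: "nat \<Rightarrow> nat \<Rightarrow> real \<Rightarrow> real \<Rightarrow> real" where
  "rad_b p q t y = (if t > 0 then sqrt (real p / real (p + q) * y\<^sup>2 + 2 * (real p - real q) * t / real q)
     else sqrt (real p / real (p + q)) * y)"

definition rad_sa :: "nat \<Rightarrow> nat \<Rightarrow> real \<Rightarrow> real \<Rightarrow> real" where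
  "rad_sa p q t y = (if t > 0 then y / (real (p + q) * rad_b p q t y) else sqrt (real p / real (p + q)) / real p)"

definition rad_sb :: "nat \<Rightarrow> nat \<Rightarrow> real \<Rightarrow> real \<Rightarrow> real" where
  "rad_sb p q t y = (if t < 0 then y / (real (p + q) * rad_a p q t y) else sqrt (real q / real (p + q)) / real q)"

text \<open>On the side \<open>y \<ge> 0\<close> one formula covers all times; it shows the continuity in \<open>t\<close> at \<open>t = 0\<close>.\<close>

lemma rad_uniform:
  assumes "0 \<le> y"
  shows "rad_a p q t y = sqrt (real q / real (p + q) * y\<^sup>2 + 2 * (real p - real q) * max 0 (- t) / real p)"
    and "rad_b p q t y = sqrt (real p / real (p + q) * y\<^sup>2 + 2 * (real p - real q) * max 0 t / real q)"
  using assms by (auto simp: rad_a_def rad_b_def max_def real_sqrt_mult simp del: times_divide_eq_left)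

lemma sqrt_has_real_derivative_radius:
  fixes c k y :: real
  assumes "0 < c * y\<^sup>2 + k"
  shows "((\<lambda>y. sqrt (c * y\<^sup>2 + k)) has_real_derivative c * y / sqrt (c * y\<^sup>2 + k)) (at y)"
  using assms by (auto intro!: derivative_eq_intros simp: field_simps)

lemma reciprocal_has_derivative:
  fixes x :: "real \<Rightarrow> real"
  assumes "(x has_real_derivative v) (at t)" "x t \<noteq> 0" "c \<noteq> 0"
  shows "((\<lambda>t. y / (c * x t)) has_real_derivative - (y * v) / (c * (x t)\<^sup>2)) (at t)"
  using assms by (auto intro!: derivative_eq_intros simp: field_simps power2_eq_square)

lemma ratio_has_derivative:
  fixes x :: "real \<Rightarrow> real"
  assumes "(x has_real_derivative k / c * y / x y) (at y)" "x y \<noteq> 0" "c \<noteq> 0"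
  shows "((\<lambda>y. y / x y) has_real_derivative 1 / x y - k * y\<^sup>2 / (c * (x y * (x y)\<^sup>2))) (at y)"
proof -
  have "((\<lambda>y. y / x y) has_real_derivative (1 * x y - y * (k / c * y / x y)) / (x y * x y)) (at y)"
    by (rule DERIV_divide [OF DERIV_ident assms(1,2)])
  then show ?thesis
    by (rule DERIV_cong) (use assms(2,3) in \<open>simp add: field_simps power2_eq_square\<close>)
qed

text \<open>At a fixed \<open>y\<close> one of the two radii is constant in time. The other one, \<open>x\<close>, has velocity \<open>v\<close>;
  the tangential motion of the parametrisation is \<open>w\<close>, with derivative \<open>w'\<close> in \<open>y\<close>. The shrinking and
  the expanding surfaces differ by an exchange of the weights: \<open>(P, Q)\<close> is \<open>(p, q)\<close> for the former and
  \<open>(q, p)\<close> for the latter, which is also why the sign of \<open>t\<close> is tied to that of \<open>P - Q\<close>.\<close>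

locale evolving_radius =
  fixes P Q L :: real and I :: "real set"
  assumes PQ: "0 < P" "0 < Q" and L: "L * L = P / (P + Q)"
    and I: "open I" "convex I" "\<And>t. t \<in> I \<Longrightarrow> 0 < (P - Q) * (- t)"
begin

definition x where "x t y = sqrt (Q / (P + Q) * y\<^sup>2 + 2 * (P - Q) * (- t) / P)"
definition v where "v t y = - (P - Q) / (P * x t y)"
definition w where "w t y = - (P - Q) * Q * L * y / (P * x t y)"
definition w' where "w' t y = - (P - Q) * Q * L / P * (1 / x t y - Q * y\<^sup>2 / ((P + Q) * (x t y * (x t y)\<^sup>2)))"
definition area where "area t y = P\<^sup>2 * (x t y * (L / P)) + Q\<^sup>2 * (L * y * (y / ((P + Q) * x t y)))"
definition area' where
  "area' t y = P\<^sup>2 * (v t y * (L / P)) + Q\<^sup>2 * (L * y * (- (y * v t y) / ((P + Q) * (x t y)\<^sup>2)))"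

lemma nonzero: "P \<noteq> 0" "Q \<noteq> 0" "P + Q \<noteq> 0"
  using PQ by auto

lemma radicand_pos: "t \<in> I \<Longrightarrow> 0 < Q / (P + Q) * y\<^sup>2 + 2 * (P - Q) * (- t) / P"
proof -
  assume "t \<in> I"
  then have "0 < 2 * ((P - Q) * (- t)) / P"
    by (intro divide_pos_pos mult_pos_pos [OF zero_less_numeral] I(3) PQ)
  moreover have "0 \<le> Q / (P + Q) * y\<^sup>2" using PQ by simp
  ultimately show ?thesis unfolding mult.assoc [of 2 "P - Q"] by (intro add_nonneg_pos)
qed

lemma x_pos: "t \<in> I \<Longrightarrow> 0 < x t y"
  using radicand_pos by (simp add: x_def)

lemma x_derivative_time:
  assumes "t \<in> I"
  shows "((\<lambda>t. x t y) has_real_derivative v t y) (at t)"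
proof -
  have "((\<lambda>t. Q / (P + Q) * y\<^sup>2 + 2 * (P - Q) * (- t) / P) has_real_derivative - (2 * (P - Q) / P)) (at t)"
    using PQ by (auto intro!: derivative_eq_intros)
  from DERIV_chain2 [OF DERIV_real_sqrt [OF radicand_pos [OF assms]] this]
  have "((\<lambda>t. x t y) has_real_derivative inverse (x t y) / 2 * - (2 * (P - Q) / P)) (at t)"
    unfolding x_def .
  then show ?thesis
    by (rule DERIV_cong) (use PQ x_pos [OF assms, of y] in \<open>simp add: v_def field_simps\<close>)
qed

lemma area_derivative_time:
  assumes "t \<in> I"
  shows "((\<lambda>t. area t y) has_real_derivative area' t y) (at t)"
  unfolding area_def area'_def
  by (rule DERIV_add DERIV_cmult DERIV_cmult_right x_derivative_time [OF assms] nonzero(3)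
      reciprocal_has_derivative [OF x_derivative_time [OF assms]]
      | simp add: less_imp_neq [OF x_pos [OF assms], symmetric])+

lemma w_derivative:
  assumes "t \<in> I"
  shows "(w t has_real_derivative w' t y) (at y)"
proof -
  have "w t = (\<lambda>y. - (P - Q) * Q * L / P * (y / x t y))" by (simp add: w_def fun_eq_iff)
  moreover have "(x t has_real_derivative Q / (P + Q) * y / x t y) (at y)"
    unfolding x_def [abs_def] by (rule sqrt_has_real_derivative_radius [OF radicand_pos [OF assms]])
  ultimately show ?thesis
    unfolding w'_def using x_pos [OF assms, of y]
    by (simp only:) (intro DERIV_cmult ratio_has_derivative nonzero(3); simp)
qed

lemma continuous_time:
  "continuous_on (I \<times> UNIV) (\<lambda>z. x (fst z) (snd z))" "continuous_on (I \<times> UNIV) (\<lambda>z. v (fst z) (snd z))"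
  "continuous_on (I \<times> UNIV) (\<lambda>z. area (fst z) (snd z))" "continuous_on (I \<times> UNIV) (\<lambda>z. area' (fst z) (snd z))"
proof -
  have nz: "x (fst z) (snd z) \<noteq> 0" if "z \<in> I \<times> UNIV" for z using x_pos that by (auto simp: less_le)
  show c: "continuous_on (I \<times> UNIV) (\<lambda>z. x (fst z) (snd z))"
    unfolding x_def by (intro continuous_intros) (use PQ in auto)
  show "continuous_on (I \<times> UNIV) (\<lambda>z. area (fst z) (snd z))"
    unfolding area_def using nz nonzero by (intro continuous_intros c) auto
  show cv: "continuous_on (I \<times> UNIV) (\<lambda>z. v (fst z) (snd z))"
    unfolding v_def using nz nonzero by (intro continuous_intros c) auto
  show "continuous_on (I \<times> UNIV) (\<lambda>z. area' (fst z) (snd z))"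
    unfolding area'_def using nz nonzero by (intro continuous_intros c cv) auto
qed

lemma continuous_radius:
  assumes "t \<in> I"
  shows "continuous_on UNIV (w t)" "continuous_on UNIV (w' t)" "continuous_on UNIV (\<lambda>y. L / (P * x t y))"
proof -
  have cx: "continuous_on UNIV (\<lambda>y. x t y)"
    unfolding x_def by (intro continuous_intros) (use PQ in auto)
  have nz: "x t y \<noteq> 0" for y using x_pos [OF assms, of y] by simp
  show "continuous_on UNIV (w t)" "continuous_on UNIV (w' t)" "continuous_on UNIV (\<lambda>y. L / (P * x t y))"
    unfolding w_def [abs_def] w'_def [abs_def] using nz nonzero by (intro continuous_intros cx; force)+
qed

text \<open>These are the hypotheses on velocity and dilation under which the motion has the mean curvature
  vector as its normal velocity.\<close>

lemma evolution_identities: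
  assumes "t \<in> I"
  shows "area t y * v t y = - ((P - Q) * (P * (L / P))) + w t y * (Q * (y / ((P + Q) * x t y)))"
    and "0 = (P - Q) * (Q * (y / ((P + Q) * x t y))) + w t y * (P * (L / P))"
    and "area' t y = - ((P - Q)\<^sup>2 * (L / (P * x t y))) + w' t y"
proof -
  have pos: "P + Q \<noteq> 0" "P \<noteq> 0" "Q \<noteq> 0" "x t y \<noteq> 0" using nonzero x_pos [OF assms, of y] by auto
  show "area t y * v t y = - ((P - Q) * (P * (L / P))) + w t y * (Q * (y / ((P + Q) * x t y)))"
    unfolding area_def v_def w_def using pos by (simp add: divide_simps) algebra
  have "w t y * (P * (L / P)) = - (P - Q) * Q * y / (P * x t y) * (L * L)"
    unfolding w_def using pos by (simp add: field_simps)
  also have "\<dots> = - ((P - Q) * (Q * (y / ((P + Q) * x t y))))"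
    unfolding L using pos by (simp add: divide_simps) algebra
  finally show "0 = (P - Q) * (Q * (y / ((P + Q) * x t y))) + w t y * (P * (L / P))" by simp
  show "area' t y = - ((P - Q)\<^sup>2 * (L / (P * x t y))) + w' t y"
    unfolding area'_def v_def w'_def using pos by (simp add: divide_simps) algebra
qed

end

locale sw_motion =
  fixes p q :: nat
  assumes q_gt_1: "1 < q" and q_less_p: "q < p" and coprime_weights: "coprime p q"
begin

abbreviation "ra \<equiv> rad_a p q"
abbreviation "rb \<equiv> rad_b p q"
abbreviation "rsa \<equiv> rad_sa p q"
abbreviation "rsb \<equiv> rad_sb p q"

definition lam where "lam = sqrt (real p / real (p + q))"
definition nu where "nu = sqrt (real q / real (p + q))"

lemma lam_nu: "0 < lam" "0 < nu" "lam * lam = real p / (real p + real q)" "nu * nu = real q / (real p + real q)"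
  using q_gt_1 q_less_p by (simp_all add: lam_def nu_def)

lemma weights_pos: "0 < real p" "0 < real q" "0 < real p - real q" "0 < real p + real q"
  using q_gt_1 q_less_p by auto

lemma radicand_pos: "t < 0 \<Longrightarrow> 0 < real q / real (p + q) * y\<^sup>2 + 2 * (real p - real q) * (- t) / real p"
  "0 < t \<Longrightarrow> 0 < real p / real (p + q) * y\<^sup>2 + 2 * (real p - real q) * t / real q"
proof -
  show "0 < real q / real (p + q) * y\<^sup>2 + 2 * (real p - real q) * (- t) / real p" if "t < 0"
    using weights_pos that by (intro add_nonneg_pos divide_pos_pos mult_pos_pos) auto
  show "0 < real p / real (p + q) * y\<^sup>2 + 2 * (real p - real q) * t / real q" if "0 < t"
    using weights_pos that by (intro add_nonneg_pos divide_pos_pos mult_pos_pos) auto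
qed

lemma rad_a_pos: "t < 0 \<Longrightarrow> 0 < ra t y" and rad_b_pos: "0 < t \<Longrightarrow> 0 < rb t y"
  unfolding rad_a_def rad_b_def using radicand_pos by auto

lemma rad_positive: "0 < y \<Longrightarrow> 0 < ra t y" "0 < y \<Longrightarrow> 0 < rb t y"
  using rad_a_pos [of t y] rad_b_pos [of t y] weights_pos
  by (auto simp: rad_a_def rad_b_def)

lemma rad_s_uniform:
  assumes "0 < y"
  shows "rsa t y = y / (real (p + q) * rb t y)"
    and "rsb t y = y / (real (p + q) * ra t y)"
proof -
  have lam2: "lam * lam * real (p + q) = real p" and nu2: "nu * nu * real (p + q) = real q"
    using lam_nu weights_pos by simp_all
  have "lam * (real (p + q) * (lam * y)) = (lam * lam * real (p + q)) * y" by (simp only: mult_ac)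
  then have "lam * (real (p + q) * (lam * y)) = y * real p" unfolding lam2 by (simp only: mult_ac)
  then have "lam / real p = y / (real (p + q) * (lam * y))"
    using lam_nu weights_pos assms by (simp add: frac_eq_eq)
  then show "rsa t y = y / (real (p + q) * rb t y)"
    by (simp add: rad_sa_def rad_b_def lam_def)
  have "nu * (real (p + q) * (nu * y)) = (nu * nu * real (p + q)) * y" by (simp only: mult_ac)
  then have "nu * (real (p + q) * (nu * y)) = y * real q" unfolding nu2 by (simp only: mult_ac)
  then have "nu / real q = y / (real (p + q) * (nu * y))"
    using lam_nu weights_pos assms by (simp add: frac_eq_eq)
  then show "rsb t y = y / (real (p + q) * ra t y)"
    by (simp add: rad_sb_def rad_a_def nu_def)
qed

lemma rad_continuous:
  "continuous_on UNIV (ra t)" "continuous_on UNIV (rb t)"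
  "continuous_on UNIV (rsa t)" "continuous_on UNIV (rsb t)"
proof -
  have c: "continuous_on UNIV (\<lambda>y. sqrt (c * y\<^sup>2 + k))" "continuous_on UNIV (\<lambda>y. c * y)" for c k :: real
    by (intro continuous_intros)+
  show a: "continuous_on UNIV (ra t)"
    unfolding rad_a_def [abs_def] by (cases "t < 0") (simp_all only: if_True if_False c)
  show b: "continuous_on UNIV (rb t)"
    unfolding rad_b_def [abs_def] by (cases "t > 0") (simp_all only: if_True if_False c)
  show "continuous_on UNIV (rsa t)"
  proof (cases "t > 0")
    case True
    then have eq: "rsa t = (\<lambda>y. y / (real (p + q) * rb t y))"
      by (simp add: rad_sa_def fun_eq_iff)
    have "real (p + q) * rb t y \<noteq> 0" for y
      using rad_b_pos [OF True, of y] weights_pos by simp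
    then show ?thesis unfolding eq
      by (intro continuous_on_divide continuous_on_mult continuous_on_id continuous_on_const b) blast
  qed (simp add: rad_sa_def [abs_def])
  show "continuous_on UNIV (rsb t)"
  proof (cases "t < 0")
    case True
    then have eq: "rsb t = (\<lambda>y. y / (real (p + q) * ra t y))"
      by (simp add: rad_sb_def fun_eq_iff)
    have "real (p + q) * ra t y \<noteq> 0" for y
      using rad_a_pos [OF True, of y] weights_pos by simp
    then show ?thesis unfolding eq
      by (intro continuous_on_divide continuous_on_mult continuous_on_id continuous_on_const a) blast
  qed (simp add: rad_sb_def [abs_def])
qed

lemma rad_a_derivative: "(ra t has_real_derivative q * rsb t y) (at y)"
proof (cases "t < 0")
  case True
  have "(ra t has_real_derivative real q / real (p + q) * y / ra t y) (at y)"
    using sqrt_has_real_derivative_radius [OF radicand_pos(1) [OF True]] True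
    unfolding rad_a_def [abs_def] by simp
  then show ?thesis using True by (simp add: rad_sb_def field_simps)
next
  case False
  then show ?thesis unfolding rad_a_def [abs_def] rad_sb_def using weights_pos
    by (auto intro!: derivative_eq_intros)
qed

lemma rad_b_derivative: "(rb t has_real_derivative p * rsa t y) (at y)"
proof (cases "t > 0")
  case True
  have "(rb t has_real_derivative real p / real (p + q) * y / rb t y) (at y)"
    using sqrt_has_real_derivative_radius [OF radicand_pos(2) [OF True]] True
    unfolding rad_b_def [abs_def] by simp
  then show ?thesis using True by (simp add: rad_sa_def field_simps)
next
  case False
  then show ?thesis unfolding rad_b_def [abs_def] rad_sa_def using weights_pos
    by (auto intro!: derivative_eq_intros)
qed

lemma rad_squares:
  assumes "0 \<le> y"
  shows "(ra t y)\<^sup>2 + (rb t y)\<^sup>2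
      = y\<^sup>2 + 2 * (real p - real q) * max 0 (- t) / real p + 2 * (real p - real q) * max 0 t / real q"
    and "real p * (ra t y)\<^sup>2 - real q * (rb t y)\<^sup>2 = - 2 * (real p - real q) * t"
proof -
  have a: "(ra t y)\<^sup>2 = real q / real (p + q) * y\<^sup>2 + 2 * (real p - real q) * max 0 (- t) / real p"
    unfolding rad_uniform [OF assms] using weights_pos
    by (intro real_sqrt_pow2 add_nonneg_nonneg) auto
  have b: "(rb t y)\<^sup>2 = real p / real (p + q) * y\<^sup>2 + 2 * (real p - real q) * max 0 t / real q"
    unfolding rad_uniform [OF assms] using weights_pos
    by (intro real_sqrt_pow2 add_nonneg_nonneg) auto
  have "real q / real (p + q) + real p / real (p + q) = 1"
    using weights_pos by (simp add: add_divide_distrib [symmetric])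
  then have "real q / real (p + q) * y\<^sup>2 + real p / real (p + q) * y\<^sup>2 = y\<^sup>2"
    by (metis distrib_right mult_1)
  then show "(ra t y)\<^sup>2 + (rb t y)\<^sup>2
      = y\<^sup>2 + 2 * (real p - real q) * max 0 (- t) / real p + 2 * (real p - real q) * max 0 t / real q"
    unfolding a b by simp
  show "real p * (ra t y)\<^sup>2 - real q * (rb t y)\<^sup>2 = - 2 * (real p - real q) * t"
  proof -
    have 1: "real p * (real q / real (p + q) * y\<^sup>2) = real q * (real p / real (p + q) * y\<^sup>2)" by simp
    have 2: "real p * (2 * (real p - real q) * max 0 (- t) / real p) = 2 * (real p - real q) * max 0 (- t)"
      "real q * (2 * (real p - real q) * max 0 t / real q) = 2 * (real p - real q) * max 0 t"
      using weights_pos by simp_all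
    have 3: "max 0 (- t) = max 0 t - t" by simp
    show ?thesis unfolding a b distrib_left 1 2 unfolding 3 by (simp add: algebra_simps)
  qed
qed

sublocale pr: sw_profile p q "ra t" "rb t" "rsa t" "rsb t"
  "\<lambda>y. y / (real (p + q) * ra t y * rb t y)" for t
proof
  show "1 < p" "1 < q" "coprime p q" "p \<noteq> q" using q_gt_1 q_less_p coprime_weights by auto
  show "continuous_on UNIV (ra t)" "continuous_on UNIV (rb t)"
    "continuous_on UNIV (rsa t)" "continuous_on UNIV (rsb t)"
    by (fact rad_continuous)+
  show "ra t 0 = 0 \<or> rb t 0 = 0" by (simp add: rad_a_def rad_b_def)
  fix y :: real
  show "y\<^sup>2 \<le> (ra t y)\<^sup>2 + (rb t y)\<^sup>2" if "0 \<le> y"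
    unfolding rad_squares(1) [OF that] using weights_pos
    by (simp add: add_nonneg_nonneg divide_nonneg_pos)
  assume y: "0 < y"
  note pos = rad_positive [OF y, of t]
  show "0 < ra t y" "0 < rb t y" using pos by auto
  show "0 < y / (real (p + q) * ra t y * rb t y)" using pos y weights_pos by simp
  show "rsa t y = y / (real (p + q) * ra t y * rb t y) * ra t y"
    "rsb t y = y / (real (p + q) * ra t y * rb t y) * rb t y"
    using pos by (simp_all add: rad_s_uniform [OF y])
  show "(ra t has_real_derivative q * rsb t y) (at y)" by (rule rad_a_derivative)
  show "(rb t has_real_derivative p * rsa t y) (at y)" by (rule rad_b_derivative)
qed

lemma mass_has_derivative_shrinking:
  assumes "C1_compact \<phi>" "t < 0"
  shows "((\<lambda>t. mass (pr.V t) \<phi>) has_real_derivative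
      - (\<integral>u. pr.dissipation t \<phi> u \<partial>lborel) + (\<integral>u. pr.transport t \<phi> u \<partial>lborel)) (at t)"
    and "integrable lborel (pr.dissipation t \<phi>)"
proof -
  obtain R where R: "0 \<le> R" "\<And>x. R \<le> norm x \<Longrightarrow> \<phi> x = 0"
    "\<And>x v. R \<le> norm x \<Longrightarrow> frechet_derivative \<phi> (at x) v = 0"
    using C1_compact_radius [OF assms(1)] by blast
  interpret ev: evolving_radius "real p" "real q" lam "{..<0}"
    using weights_pos lam_nu by unfold_locales (auto intro: mult_pos_neg)
  have t: "t \<in> {..<0}" using assms(2) by simp
  have rad: "ra t y = ev.x t y" "rb t y = lam * y"
    "rsa t y = lam / p" "rsb t y = y / ((real p + real q) * ev.x t y)" if "t < 0" for t y
    using that by (simp_all add: rad_a_def rad_b_def rad_sa_def rad_sb_def ev.x_def lam_def)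
  have A: "pr.A t y = ev.area t y" if "t < 0" for t y
    by (simp add: pr.A_def ev.area_def rad [OF that])
  note eqs = A [OF assms(2)] rad [OF assms(2)]
  have v1: "pr.A t y * ev.v t y = - ((real p - real q) * (p * rsa t y)) + ev.w t y * (q * rsb t y)" for y
    unfolding eqs by (rule ev.evolution_identities(1) [OF t])
  have v2: "pr.A t y * 0 = (real p - real q) * (q * rsb t y) + ev.w t y * (p * rsa t y)" for y
    unfolding eqs mult_zero_right by (rule ev.evolution_identities(2) [OF t])
  have w0: "ev.w t 0 = 0" by (simp add: ev.w_def)
  have sc: "lam / (p * ev.x t y) = rsa t y / ra t y" for y
    by (simp add: eqs)
  note M = pr.mass_derivative_integrand [OF assms(1) ev.continuous_radius [OF t] w0 ev.w_derivative [OF t] sc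
      v1 v2 ev.evolution_identities(3) [OF t] R]
  show "integrable lborel (pr.dissipation t \<phi>)" by (rule M(2))
  define \<delta> where "\<delta> = - (\<integral>u. pr.dissipation t \<phi> u \<partial>lborel) + (\<integral>u. pr.transport t \<phi> u \<partial>lborel)"
  have "((\<lambda>t. strip_integral R (\<lambda>u. ev.area t (fst u)
        * \<phi> (sw_point p q (ev.x t (fst u)) (lam * fst u) (snd u)))) has_real_derivative \<delta>) (at t)"
    by (rule DERIV_cong [OF swept_mass_has_derivative [OF assms(1) ev.I(1,2) t ev.x_derivative_time _ ev.area_derivative_time
          ev.continuous_time(1) _ ev.continuous_time(3,2) _ ev.continuous_time(4)]])
      (use M(1) in \<open>auto intro!: continuous_intros simp: \<delta>_def pr.F_def eqs\<close>)
  then show "((\<lambda>t. mass (pr.V t) \<phi>) has_real_derivative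
      - (\<integral>u. pr.dissipation t \<phi> u \<partial>lborel) + (\<integral>u. pr.transport t \<phi> u \<partial>lborel)) (at t)"
    unfolding \<delta>_def [symmetric]
    by (rule has_field_derivative_transform_within_open [of _ _ _ "{..<0}"])
      (use assms(2) in \<open>auto simp: pr.mass_V(2) [OF C1_compact_D(3) [OF assms(1)] R(2)] pr.F_def A rad\<close>)
qed

lemma mass_has_derivative_expanding:
  assumes "C1_compact \<phi>" "0 < t"
  shows "((\<lambda>t. mass (pr.V t) \<phi>) has_real_derivative
      - (\<integral>u. pr.dissipation t \<phi> u \<partial>lborel) + (\<integral>u. pr.transport t \<phi> u \<partial>lborel)) (at t)"
    and "integrable lborel (pr.dissipation t \<phi>)"
proof -
  obtain R where R: "0 \<le> R" "\<And>x. R \<le> norm x \<Longrightarrow> \<phi> x = 0"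
    "\<And>x v. R \<le> norm x \<Longrightarrow> frechet_derivative \<phi> (at x) v = 0"
    using C1_compact_radius [OF assms(1)] by blast
  interpret ev: evolving_radius "real q" "real p" nu "{0<..}"
    using weights_pos lam_nu by unfold_locales (auto intro: mult_neg_neg simp: add.commute mult_less_0_iff)
  have t: "t \<in> {0<..}" using assms(2) by simp
  have x: "rb t y = ev.x t y" if "0 < t" for t y
    using that by (simp add: rad_b_def ev.x_def add.commute algebra_simps)
  have rad: "rb t y = ev.x t y" "ra t y = nu * y"
    "rsa t y = y / ((real q + real p) * ev.x t y)" "rsb t y = nu / q" if "0 < t" for t y
    using that by (simp_all add: x rad_a_def rad_sa_def rad_sb_def nu_def add.commute)
  have A: "pr.A t y = ev.area t y" if "0 < t" for t y
    by (simp add: pr.A_def ev.area_def rad [OF that] add.commute)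
  note eqs = A [OF assms(2)] rad [OF assms(2)]
  have v1: "pr.A t y * 0 = - ((real p - real q) * (p * rsa t y)) + ev.w t y * (q * rsb t y)" for y
    using ev.evolution_identities(2) [OF t, of y]
    unfolding eqs mult_zero_right by (simp only: minus_mult_left minus_diff_eq)
  have v2: "pr.A t y * ev.v t y = (real p - real q) * (q * rsb t y) + ev.w t y * (p * rsa t y)" for y
    using ev.evolution_identities(1) [OF t, of y]
    unfolding eqs by (simp only: minus_mult_left minus_diff_eq)
  have w0: "ev.w t 0 = 0" by (simp add: ev.w_def)
  have sc: "nu / (q * ev.x t y) = rsa t y / ra t y" if "0 < y" for y
  proof -
    have "nu * nu * (real q + real p) = q" using ev.L ev.nonzero by simp
    moreover have "nu * ((real q + real p) * ev.x t y * (nu * y)) = (nu * nu * (real q + real p)) * (y * ev.x t y)"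
      by (simp only: mult_ac)
    ultimately have "nu * ((real q + real p) * ev.x t y * (nu * y)) = y * (q * ev.x t y)" by (simp only: mult_ac)
    moreover have "q * ev.x t y \<noteq> 0" "(real q + real p) * ev.x t y * (nu * y) \<noteq> 0"
      using ev.nonzero ev.x_pos [OF t, of y] that lam_nu by auto
    ultimately have "nu / (q * ev.x t y) = y / ((real q + real p) * ev.x t y * (nu * y))" by (simp add: frac_eq_eq)
    then show ?thesis by (simp add: eqs)
  qed
  have dil: "ev.area' t y = - ((real p - real q)\<^sup>2 * (nu / (q * ev.x t y))) + ev.w' t y" for y
    using ev.evolution_identities(3) [OF t, of y] by (simp only: power2_commute [of "real q" "real p"])
  note M = pr.mass_derivative_integrand [OF assms(1) ev.continuous_radius [OF t] w0 ev.w_derivative [OF t] sc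
      v1 v2 dil R]
  show "integrable lborel (pr.dissipation t \<phi>)" by (rule M(2))
  define \<delta> where "\<delta> = - (\<integral>u. pr.dissipation t \<phi> u \<partial>lborel) + (\<integral>u. pr.transport t \<phi> u \<partial>lborel)"
  have "((\<lambda>t. strip_integral R (\<lambda>u. ev.area t (fst u)
        * \<phi> (sw_point p q (nu * fst u) (ev.x t (fst u)) (snd u)))) has_real_derivative \<delta>) (at t)"
    by (rule DERIV_cong [OF swept_mass_has_derivative [OF assms(1) ev.I(1,2) t _ ev.x_derivative_time ev.area_derivative_time
          _ ev.continuous_time(1,3) _ ev.continuous_time(2,4)]])
      (use M(1) in \<open>auto intro!: continuous_intros simp: \<delta>_def pr.F_def eqs\<close>)
  then show "((\<lambda>t. mass (pr.V t) \<phi>) has_real_derivative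
      - (\<integral>u. pr.dissipation t \<phi> u \<partial>lborel) + (\<integral>u. pr.transport t \<phi> u \<partial>lborel)) (at t)"
    unfolding \<delta>_def [symmetric]
    by (rule has_field_derivative_transform_within_open [of _ _ _ "{0<..}"])
      (use assms(2) in \<open>auto simp: pr.mass_V(2) [OF C1_compact_D(3) [OF assms(1)] R(2)] pr.F_def A rad\<close>)
qed

end


section \<open>The Brakke inequality holds with equality\<close>

context sw_motion
begin

lemma mass_has_derivative:
  assumes "C1_compact \<phi>" "t \<noteq> 0"
  shows "((\<lambda>t. mass (pr.V t) \<phi>) has_real_derivative
      - (\<integral>u. pr.dissipation t \<phi> u \<partial>lborel) + (\<integral>u. pr.transport t \<phi> u \<partial>lborel)) (at t)"
    and "integrable lborel (pr.dissipation t \<phi>)"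
  using mass_has_derivative_shrinking [OF assms(1)] mass_has_derivative_expanding [OF assms(1)] assms(2)
  by (cases "t < 0"; force)+

text \<open>The factor \<open>y\<close> cancels the radius that tends to zero with \<open>y\<close>. These bounds are uniform in \<open>t\<close>,
  although the factor \<open>s\<close> itself is unbounded as \<open>t\<close> tends to \<open>0\<close>.\<close>

lemma rad_s_bounds:
  assumes "0 < y"
  shows "0 \<le> rsa t y" "rsa t y \<le> 1 / (real (p + q) * lam)"
    and "0 \<le> rsb t y" "rsb t y \<le> 1 / (real (p + q) * nu)"
proof -
  note pos = rad_positive [OF assms, of t]
  have "sqrt ((lam * y)\<^sup>2) \<le> rb t y" "sqrt ((nu * y)\<^sup>2) \<le> ra t y"
    unfolding rad_uniform [OF less_imp_le [OF assms]] using weights_pos lam_nu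
    by (auto intro!: real_sqrt_le_mono simp: power_mult_distrib power2_eq_square [of lam] power2_eq_square [of nu])
  then have "lam * y \<le> rb t y" "nu * y \<le> ra t y"
    using lam_nu assms by auto
  then have "y / (real (p + q) * rb t y) \<le> y / (real (p + q) * (lam * y))"
    "y / (real (p + q) * ra t y) \<le> y / (real (p + q) * (nu * y))"
    using assms lam_nu weights_pos pos by (intro divide_left_mono mult_left_mono mult_pos_pos; simp)+
  moreover have "y / (real (p + q) * (lam * y)) = 1 / (real (p + q) * lam)"
    "y / (real (p + q) * (nu * y)) = 1 / (real (p + q) * nu)" using assms by simp_all
  ultimately show "rsa t y \<le> 1 / (real (p + q) * lam)" "rsb t y \<le> 1 / (real (p + q) * nu)"
    unfolding rad_s_uniform [OF assms] by simp_all
  show "0 \<le> rsa t y" "0 \<le> rsb t y"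
    unfolding rad_s_uniform [OF assms] using pos assms by simp_all
qed

lemma rad_bounds:
  assumes "0 \<le> y" "y \<le> R" "\<bar>t\<bar> \<le> 1"
  shows "ra t y \<le> sqrt (R\<^sup>2 + 2 * (p + q))" "rb t y \<le> sqrt (R\<^sup>2 + 2 * (p + q))"
proof -
  have y2: "y\<^sup>2 \<le> R\<^sup>2" using assms by (intro power_mono) auto
  have m: "max 0 (- t) \<le> 1" "max 0 t \<le> 1" using assms by auto
  have "2 * (real p - real q) * max 0 (- t) / real p \<le> 2 * real p * 1 / real p"
    using weights_pos m by (intro divide_right_mono mult_mono) auto
  moreover have "2 * (real p - real q) * max 0 t / real q \<le> 2 * real p * 1 / 1"
    using weights_pos m q_gt_1 by (intro frac_le mult_mono) auto
  ultimately have "(ra t y)\<^sup>2 + (rb t y)\<^sup>2 \<le> R\<^sup>2 + 2 * (p + q)"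
    unfolding rad_squares(1) [OF assms(1)] using y2 weights_pos q_gt_1 by simp
  then have "(ra t y)\<^sup>2 \<le> R\<^sup>2 + 2 * (p + q)" "(rb t y)\<^sup>2 \<le> R\<^sup>2 + 2 * (p + q)"
    by (smt (verit) zero_le_power2)+
  then show "ra t y \<le> sqrt (R\<^sup>2 + 2 * (p + q))" "rb t y \<le> sqrt (R\<^sup>2 + 2 * (p + q))"
    by (simp_all add: real_le_rsqrt)
qed

lemma rad_nonneg: "0 \<le> y \<Longrightarrow> 0 \<le> ra t y" "0 \<le> y \<Longrightarrow> 0 \<le> rb t y"
  using rad_positive [of y t] rad_a_pos [of t 0] rad_b_pos [of t 0]
  by (cases "y = 0"; force simp: rad_a_def rad_b_def)+

lemma rad_tendsto:
  assumes "0 < y" "X \<longlonglongrightarrow> 0"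
  shows "(\<lambda>n. ra (X n) y) \<longlonglongrightarrow> ra 0 y" "(\<lambda>n. rb (X n) y) \<longlonglongrightarrow> rb 0 y"
    and "(\<lambda>n. rsa (X n) y) \<longlonglongrightarrow> rsa 0 y" "(\<lambda>n. rsb (X n) y) \<longlonglongrightarrow> rsb 0 y"
proof -
  note pos = rad_positive [OF assms(1), of 0]
  show a: "(\<lambda>n. ra (X n) y) \<longlonglongrightarrow> ra 0 y" and b: "(\<lambda>n. rb (X n) y) \<longlonglongrightarrow> rb 0 y"
    unfolding rad_uniform [OF less_imp_le [OF assms(1)]]
    by (intro tendsto_intros assms(2); use weights_pos in simp)+
  show "(\<lambda>n. rsa (X n) y) \<longlonglongrightarrow> rsa 0 y" "(\<lambda>n. rsb (X n) y) \<longlonglongrightarrow> rsb 0 y"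
    unfolding rad_s_uniform [OF assms(1)]
    using pos weights_pos by (intro tendsto_intros a b; simp)+
qed

lemma F_tendsto:
  assumes "0 < fst u" "X \<longlonglongrightarrow> 0"
  shows "(\<lambda>n. pr.F (X n) u) \<longlonglongrightarrow> pr.F 0 u" "(\<lambda>n. pr.AH (X n) u) \<longlonglongrightarrow> pr.AH 0 u"
    and "(\<lambda>n. pr.A (X n) (fst u)) \<longlonglongrightarrow> pr.A 0 (fst u)"
  unfolding pr.F_def pr.AH_def pr.A_def sw_point_def
  by (intro tendsto_intros rad_tendsto assms)+

text \<open>The parameter is restricted to \<open>\<bar>t\<bar> \<le> 1\<close> for the bound only; the limit is two-sided.\<close>

lemma half_strip_dominated_convergence:
  fixes g :: "real \<Rightarrow> real \<times> real \<Rightarrow> real"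
  assumes meas: "\<And>t. (\<lambda>u. indicator half_strip u * g t u) \<in> borel_measurable borel"
    and bound: "\<And>t u. u \<in> half_strip \<Longrightarrow> \<bar>t\<bar> \<le> 1 \<Longrightarrow> fst u \<le> R \<Longrightarrow> \<bar>g t u\<bar> \<le> C"
    and supp: "\<And>t u. u \<in> half_strip \<Longrightarrow> R < fst u \<Longrightarrow> g t u = 0"
    and lim: "\<And>u X. u \<in> half_strip \<Longrightarrow> X \<longlonglongrightarrow> 0 \<Longrightarrow> (\<lambda>n. g (X n) u) \<longlonglongrightarrow> g 0 u"
  shows "((\<lambda>t. \<integral>u. indicator half_strip u * g t u \<partial>lborel) \<longlongrightarrow> (\<integral>u. indicator half_strip u * g 0 u \<partial>lborel)) (at 0)"
    and "\<bar>t\<bar> \<le> 1 \<Longrightarrow> integrable lborel (\<lambda>u. indicator half_strip u * g t u)"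
proof -
  let ?w = "\<lambda>u::real \<times> real. indicator (half_strip \<inter> {u. fst u \<le> R}) u *\<^sub>R C"
  have w: "integrable lborel ?w" by (rule half_strip_integrable_bounded) simp
  have wb: "\<bar>indicator half_strip u * g t u\<bar> \<le> ?w u" if "\<bar>t\<bar> \<le> 1" for t u
    using bound [OF _ that, of u] supp [of u t] by (cases "fst u \<le> R") (auto simp: indicator_def)
  show "integrable lborel (\<lambda>u. indicator half_strip u * g t u)" if "\<bar>t\<bar> \<le> 1"
  proof (rule Bochner_Integration.integrable_bound [OF w])
    show "(\<lambda>u. indicator half_strip u * g t u) \<in> borel_measurable lborel" using meas by simp
    show "AE u in lborel. norm (indicator half_strip u * g t u) \<le> norm (?w u)"
      using wb [OF that] by (intro AE_I2) (smt (verit) real_norm_def)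
  qed
  show "((\<lambda>t. \<integral>u. indicator half_strip u * g t u \<partial>lborel) \<longlongrightarrow> (\<integral>u. indicator half_strip u * g 0 u \<partial>lborel)) (at 0)"
    unfolding tendsto_at_iff_sequentially o_def
  proof (intro allI impI)
    fix X :: "nat \<Rightarrow> real" assume X: "X \<longlonglongrightarrow> 0"
    have "eventually (\<lambda>n. dist (X n) 0 < 1) sequentially" by (rule tendstoD [OF X]) simp
    then obtain N where N: "\<And>n. N \<le> n \<Longrightarrow> \<bar>X n\<bar> \<le> 1"
      unfolding eventually_sequentially by (force simp: dist_real_def)
    have "(\<lambda>n. \<integral>u. indicator half_strip u * g (X (n + N)) u \<partial>lborel) \<longlonglongrightarrow> (\<integral>u. indicator half_strip u * g 0 u \<partial>lborel)"
    proof (rule integral_dominated_convergence [OF _ _ w])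
      show "(\<lambda>u. indicator half_strip u * g 0 u) \<in> borel_measurable lborel" using meas by simp
      show "(\<lambda>u. indicator half_strip u * g (X (n + N)) u) \<in> borel_measurable lborel" for n using meas by simp
      show "AE u in lborel. (\<lambda>n. indicator half_strip u * g (X (n + N)) u) \<longlonglongrightarrow> indicator half_strip u * g 0 u"
      proof (rule AE_I2)
        fix u :: "real \<times> real"
        have "(\<lambda>n. X (n + N)) \<longlonglongrightarrow> 0" using X by (rule LIMSEQ_ignore_initial_segment)
        from lim [OF _ this, of u]
        show "(\<lambda>n. indicator half_strip u * g (X (n + N)) u) \<longlonglongrightarrow> indicator half_strip u * g 0 u"
          by (cases "u \<in> half_strip") (auto simp: indicator_def)
      qed
      show "AE u in lborel. norm (indicator half_strip u * g (X (n + N)) u) \<le> ?w u" for n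
        using wb [OF N] by (intro AE_I2) simp
    qed
    then show "(\<lambda>n. \<integral>u. indicator half_strip u * g (X n) u \<partial>lborel) \<longlonglongrightarrow> (\<integral>u. indicator half_strip u * g 0 u \<partial>lborel)"
      by (rule LIMSEQ_offset)
  qed
qed

lemma half_strip_D: "u \<in> half_strip \<Longrightarrow> 0 < fst u"
  by (auto simp: half_strip_def)

lemma mass_tendsto:
  assumes "continuous_on UNIV \<phi>" "compactly_supported \<phi>"
  shows "((\<lambda>t. mass (pr.V t) \<phi>) \<longlongrightarrow> mass (pr.V 0) \<phi>) (at 0)"
proof -
  obtain K C where K: "compact K" "\<And>x. x \<notin> K \<Longrightarrow> \<phi> x = 0" "0 \<le> C" "\<And>x. norm (\<phi> x) \<le> C"
    using compactly_supported_bound [OF assms(2,1)] by blast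
  obtain R0 where R0: "\<And>x. x \<in> K \<Longrightarrow> norm x \<le> R0"
    using K(1) by (meson compact_imp_bounded bounded_iff)
  define R where "R = R0 + 1"
  have R: "\<phi> x = 0" if "R \<le> norm x" for x
    using K(2) [of x] R0 [of x] that by (force simp: R_def)
  define B where "B = sqrt (R\<^sup>2 + 2 * (p + q))"
  define A0 where "A0 = (real p)\<^sup>2 * (B * (1 / (real (p + q) * lam))) + (real q)\<^sup>2 * (B * (1 / (real (p + q) * nu)))"
  have [measurable]: "\<phi> \<in> borel_measurable borel" using assms(1) by (rule borel_measurable_continuous_onI)
  have "((\<lambda>t. \<integral>u. indicator half_strip u * (pr.A t (fst u) * \<phi> (pr.F t u)) \<partial>lborel)
      \<longlongrightarrow> (\<integral>u. indicator half_strip u * (pr.A 0 (fst u) * \<phi> (pr.F 0 u)) \<partial>lborel)) (at 0)"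
  proof (rule half_strip_dominated_convergence(1))
    show "(\<lambda>u. indicator half_strip u * (pr.A t (fst u) * \<phi> (pr.F t u))) \<in> borel_measurable borel" for t
      by measurable
    show "\<bar>pr.A t (fst u) * \<phi> (pr.F t u)\<bar> \<le> A0 * C" if u: "u \<in> half_strip" "\<bar>t\<bar> \<le> 1" "fst u \<le> R" for t u
    proof -
      note y = half_strip_D [OF u(1)]
      have B0: "0 \<le> B" by (simp add: B_def)
      have "pr.A t (fst u) \<le> A0"
        unfolding pr.A_def A0_def B_def
        using rad_bounds [of "fst u" R t] rad_s_bounds [OF y, of t] rad_nonneg [of "fst u" t] y u
        by (intro add_mono mult_left_mono mult_mono) auto
      then have "\<bar>pr.A t (fst u)\<bar> * \<bar>\<phi> (pr.F t u)\<bar> \<le> A0 * C"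
        using pr.A_nonneg [OF y, of t] K(4) [of "pr.F t u"] by (intro mult_mono) auto
      then show ?thesis by (simp add: abs_mult)
    qed
    show "pr.A t (fst u) * \<phi> (pr.F t u) = 0" if "u \<in> half_strip" "R < fst u" for t u
      using R [of "pr.F t u"] pr.norm_F_ge [of u t] half_strip_D [OF that(1)] that by simp
    show "(\<lambda>n. pr.A (X n) (fst u) * \<phi> (pr.F (X n) u)) \<longlonglongrightarrow> pr.A 0 (fst u) * \<phi> (pr.F 0 u)"
      if "u \<in> half_strip" "X \<longlonglongrightarrow> 0" for u X
      using assms(1) F_tendsto [OF half_strip_D [OF that(1)] that(2)]
      by (intro tendsto_mult continuous_on_tendsto_compose [OF assms(1)]) auto
  qed
  then show ?thesis by (simp add: pr.mass_V(1) [OF assms(1) R])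
qed

lemma transport_tendsto:
  assumes "C1_compact \<phi>"
  shows "((\<lambda>t. \<integral>u. pr.transport t \<phi> u \<partial>lborel) \<longlongrightarrow> (\<integral>u. pr.transport 0 \<phi> u \<partial>lborel)) (at 0)"
  unfolding pr.transport_def
proof -
  obtain R where R: "0 \<le> R" "\<And>x v. R \<le> norm x \<Longrightarrow> frechet_derivative \<phi> (at x) v = 0"
    using C1_compact_radius [OF assms] by metis
  obtain L where L: "0 \<le> L" "\<And>x v. norm (frechet_derivative \<phi> (at x) v) \<le> L * norm v"
    using C1_compact_derivative_bound [OF assms] by metis
  define B where "B = real p * (1 / (real (p + q) * lam)) + real q * (1 / (real (p + q) * nu))"
  show "((\<lambda>t. \<integral>u. indicator half_strip u * frechet_derivative \<phi> (at (pr.F t u)) (pr.AH t u) \<partial>lborel)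
      \<longlongrightarrow> (\<integral>u. indicator half_strip u * frechet_derivative \<phi> (at (pr.F 0 u)) (pr.AH 0 u) \<partial>lborel)) (at 0)"
  proof (rule half_strip_dominated_convergence(1))
    show "(\<lambda>u. indicator half_strip u * frechet_derivative \<phi> (at (pr.F t u)) (pr.AH t u)) \<in> borel_measurable borel" for t
      using borel_measurable_integrable [OF pr.transport_integrable [OF assms, of t]]
      unfolding pr.transport_def by simp
    show "\<bar>frechet_derivative \<phi> (at (pr.F t u)) (pr.AH t u)\<bar> \<le> L * ((real p - real q) * B)"
      if u: "u \<in> half_strip" "\<bar>t\<bar> \<le> 1" "fst u \<le> R" for t u
    proof -
      note y = half_strip_D [OF u(1)]
      have "norm (sw_point p q (- (p * rsa t (fst u))) (q * rsb t (fst u)) (snd u))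
          \<le> \<bar>- (p * rsa t (fst u))\<bar> + \<bar>q * rsb t (fst u)\<bar>"
        unfolding norm_sw_point by (rule sqrt_sum_squares_le_sum_abs)
      also have "\<dots> \<le> B"
        unfolding B_def using rad_s_bounds [OF y, of t]
        by (simp add: abs_mult del: times_divide_eq_right) (intro add_mono mult_left_mono; simp)
      finally have "norm (pr.AH t u) \<le> (real p - real q) * B"
        unfolding pr.AH_def using weights_pos by (simp add: mult_left_mono)
      then show ?thesis
        using L(2) [of "pr.F t u" "pr.AH t u"] mult_left_mono [OF _ L(1)] by fastforce
    qed
    show "frechet_derivative \<phi> (at (pr.F t u)) (pr.AH t u) = 0" if "u \<in> half_strip" "R < fst u" for t u
      using R(2) [of "pr.F t u"] pr.norm_F_ge [of u t] half_strip_D [OF that(1)] that by simp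
    show "(\<lambda>n. frechet_derivative \<phi> (at (pr.F (X n) u)) (pr.AH (X n) u)) \<longlonglongrightarrow> frechet_derivative \<phi> (at (pr.F 0 u)) (pr.AH 0 u)"
      if "u \<in> half_strip" "X \<longlonglongrightarrow> 0" for u X
      using isCont_tendsto_compose [OF continuous_C1_derivative [OF assms]
          tendsto_Pair [OF F_tendsto(1,2) [OF half_strip_D [OF that(1)] that(2)]]] by simp
  qed
qed

text \<open>A test function that vanishes at the vertex is bounded by a multiple of \<open>\<bar>F\<bar>\<close>, and
  \<open>s \<bar>F\<bar> \<le> s a + s b\<close> is bounded uniformly in time.\<close>

lemma dissipation_tendsto:
  assumes "C1_compact \<phi>" "\<phi> 0 = 0"
  shows "((\<lambda>t. \<integral>u. pr.dissipation t \<phi> u \<partial>lborel) \<longlongrightarrow> (\<integral>u. pr.dissipation 0 \<phi> u \<partial>lborel)) (at 0)"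
    and "integrable lborel (pr.dissipation 0 \<phi>)"
proof -
  note C = C1_compact_D [OF assms(1)]
  obtain R where R: "0 \<le> R" "\<And>x. R \<le> norm x \<Longrightarrow> \<phi> x = 0"
    using C1_compact_radius [OF assms(1)] by metis
  obtain L where L: "0 \<le> L" "\<And>x v. norm (frechet_derivative \<phi> (at x) v) \<le> L * norm v"
    using C1_compact_derivative_bound [OF assms(1)] by metis
  have lip: "\<bar>\<phi> x\<bar> \<le> L * norm x" for x
  proof -
    have "norm (\<phi> x - \<phi> 0) \<le> L * norm (x - 0)"
      by (rule differentiable_bound [of UNIV, OF convex_UNIV has_derivative_at_withinI [OF C(1)]])
        (auto intro!: onorm_bound L)
    then show ?thesis by (simp add: assms(2))
  qed
  define B where "B = 1 / (real (p + q) * lam) + 1 / (real (p + q) * nu)"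
  define g where "g t u = (real p - real q)\<^sup>2 * (rsa t (fst u) / ra t (fst u)) * \<phi> (pr.F t u)" for t u
  have diss: "pr.dissipation t \<phi> = (\<lambda>u. indicator half_strip u * g t u)" for t
    by (simp add: pr.dissipation_def g_def fun_eq_iff)
  have H: "(\<lambda>u. indicator half_strip u * g t u) \<in> borel_measurable borel" for t
    using pr.dissipation_measurable [OF C(3), of t] by (simp add: diss)
  have bound: "\<bar>g t u\<bar> \<le> (real p - real q)\<^sup>2 * (L * B)" if u: "u \<in> half_strip" "\<bar>t\<bar> \<le> 1" "fst u \<le> R" for t u
  proof -
    note y = half_strip_D [OF u(1)]
    note pos = rad_positive [OF y, of t]
    let ?a = "ra t (fst u)" and ?b = "rb t (fst u)"
    let ?sa = "rsa t (fst u)" and ?sb = "rsb t (fst u)"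
    have sab: "?sa / ?a * ?a = ?sa" "?sa / ?a * ?b = ?sb" "0 \<le> ?sa / ?a"
      using pos y unfolding rad_s_uniform [OF y] by simp_all
    have "norm (pr.F t u) \<le> \<bar>?a\<bar> + \<bar>?b\<bar>"
      unfolding pr.F_def norm_sw_point by (rule sqrt_sum_squares_le_sum_abs)
    then have "norm (pr.F t u) \<le> ?a + ?b" using pos by simp
    then have "?sa / ?a * norm (pr.F t u) \<le> ?sa / ?a * (?a + ?b)"
      using sab(3) by (rule mult_left_mono)
    also have "\<dots> = ?sa + ?sb" unfolding distrib_left sab ..
    also have "\<dots> \<le> B" unfolding B_def using rad_s_bounds [OF y, of t] by (intro add_mono)
    finally have *: "?sa / ?a * norm (pr.F t u) \<le> B" .
    have "?sa / ?a * \<bar>\<phi> (pr.F t u)\<bar> \<le> ?sa / ?a * (L * norm (pr.F t u))"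
      using lip sab(3) by (intro mult_left_mono)
    also have "\<dots> = L * (?sa / ?a * norm (pr.F t u))" by simp
    also have "\<dots> \<le> L * B" using * L(1) by (rule mult_left_mono)
    finally have "(real p - real q)\<^sup>2 * (?sa / ?a * \<bar>\<phi> (pr.F t u)\<bar>) \<le> (real p - real q)\<^sup>2 * (L * B)"
      by (intro mult_left_mono) auto
    moreover have "\<bar>g t u\<bar> = (real p - real q)\<^sup>2 * (?sa / ?a * \<bar>\<phi> (pr.F t u)\<bar>)"
      unfolding g_def abs_mult abs_of_nonneg [OF sab(3)] by simp
    ultimately show ?thesis by simp
  qed
  have supp: "g t u = 0" if "u \<in> half_strip" "R < fst u" for t u
    using R(2) [of "pr.F t u"] pr.norm_F_ge [of u t] half_strip_D [OF that(1)] that by (simp add: g_def)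
  have lim: "(\<lambda>n. g (X n) u) \<longlonglongrightarrow> g 0 u" if "u \<in> half_strip" "X \<longlonglongrightarrow> 0" for u X
    unfolding g_def
    using F_tendsto [OF half_strip_D [OF that(1)] that(2)] rad_tendsto [OF half_strip_D [OF that(1)] that(2)]
      rad_positive(1) [OF half_strip_D [OF that(1)], of 0]
    by (intro tendsto_mult tendsto_divide continuous_on_tendsto_compose [OF C(3)]) auto
  show "((\<lambda>t. \<integral>u. pr.dissipation t \<phi> u \<partial>lborel) \<longlongrightarrow> (\<integral>u. pr.dissipation 0 \<phi> u \<partial>lborel)) (at 0)"
    unfolding diss by (rule half_strip_dominated_convergence(1) [where g = g, OF H bound supp lim])
  show "integrable lborel (pr.dissipation 0 \<phi>)"
    unfolding diss by (rule half_strip_dominated_convergence(2) [where g = g, OF H bound supp lim]) auto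
qed

text \<open>Near the vertex of the cone the factor \<open>s\<close> is a multiple of \<open>1 / y\<close>.\<close>

lemma nn_integral_reciprocal_infinite:
  assumes "0 < \<eta>" "0 < c"
  shows "(\<integral>\<^sup>+u. ennreal (indicator ({0<..\<eta>} \<times> {0..<2 * pi}) u * (c / fst u)) \<partial>(lborel :: (real \<times> real) measure)) = \<infinity>"
proof -
  have ge: "ennreal (c * (ln \<eta> - ln \<epsilon>) * (2 * pi))
      \<le> (\<integral>\<^sup>+u. ennreal (indicator ({0<..\<eta>} \<times> {0..<2 * pi}) u * (c / fst u)) \<partial>(lborel :: (real \<times> real) measure))"
    if e: "0 < \<epsilon>" "\<epsilon> < \<eta>" for \<epsilon>
  proof -
    have [measurable]: "{\<epsilon>..\<eta>} \<times> {0..<2 * pi} \<in> sets (borel :: (real \<times> real) measure)"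
      by (intro borel_Times) auto
    have "(\<integral>\<^sup>+y. ennreal (c / y) * indicator {\<epsilon>..\<eta>} y \<partial>lborel) = ennreal (c * ln \<eta> - c * ln \<epsilon>)"
    proof (rule nn_integral_FTC_Icc)
      show "((\<lambda>y. c * ln y) has_real_derivative c / x) (at x)" if "x \<in> {\<epsilon>..\<eta>}" for x
        using e(1) that by (auto intro!: derivative_eq_intros simp: field_simps)
    qed (use e assms in \<open>auto simp: field_simps\<close>)
    then have 1: "(\<integral>\<^sup>+y. ennreal (c / y) * indicator {\<epsilon>..\<eta>} y \<partial>lborel) = ennreal (c * (ln \<eta> - ln \<epsilon>))"
      by (simp add: right_diff_distrib)
    have 2: "(\<integral>\<^sup>+\<theta>. indicator {0..<2 * pi} \<theta> \<partial>lborel) = ennreal (2 * pi)" by simp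
    have "ennreal (c * (ln \<eta> - ln \<epsilon>) * (2 * pi)) = ennreal (c * (ln \<eta> - ln \<epsilon>)) * ennreal (2 * pi)"
      using e assms by (intro ennreal_mult) auto
    also have "\<dots> = (\<integral>\<^sup>+y. (\<integral>\<^sup>+\<theta>. (ennreal (c / y) * indicator {\<epsilon>..\<eta>} y) * indicator {0..<2 * pi} \<theta> \<partial>lborel) \<partial>lborel)"
      unfolding 1 [symmetric] 2 [symmetric] by (subst nn_integral_cmult) (simp_all add: nn_integral_multc)
    also have "\<dots> = (\<integral>\<^sup>+y. (\<integral>\<^sup>+\<theta>. ennreal (indicator ({\<epsilon>..\<eta>} \<times> {0..<2 * pi}) (y, \<theta>) * (c / fst (y, \<theta>))) \<partial>lborel) \<partial>lborel)"
      by (intro nn_integral_cong) (auto simp: indicator_def)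
    also have "\<dots> = (\<integral>\<^sup>+u. ennreal (indicator ({\<epsilon>..\<eta>} \<times> {0..<2 * pi}) u * (c / fst u)) \<partial>(lborel \<Otimes>\<^sub>M lborel))"
      by (rule lborel.nn_integral_fst) measurable
    also have "\<dots> = (\<integral>\<^sup>+u. ennreal (indicator ({\<epsilon>..\<eta>} \<times> {0..<2 * pi}) u * (c / fst u)) \<partial>lborel)"
      by (simp only: lborel_prod)
    also have "\<dots> \<le> (\<integral>\<^sup>+u. ennreal (indicator ({0<..\<eta>} \<times> {0..<2 * pi}) u * (c / fst u)) \<partial>lborel)"
      using e assms by (intro nn_integral_mono ennreal_leI) (auto simp: indicator_def)
    finally show ?thesis .
  qed
  show ?thesis
  proof (rule ccontr)
    assume "\<not> ?thesis"
    then obtain B where B: "0 \<le> B" "(\<integral>\<^sup>+u. ennreal (indicator ({0<..\<eta>} \<times> {0..<2 * pi}) u * (c / fst u)) \<partial>(lborel :: (real \<times> real) measure)) = ennreal B"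
      by (cases "\<integral>\<^sup>+u. ennreal (indicator ({0<..\<eta>} \<times> {0..<2 * pi}) u * (c / fst u)) \<partial>(lborel :: (real \<times> real) measure)"
          rule: ennreal_cases) auto
    (* the integral over the part beyond \<epsilon> is then B + 1 *)
    define \<epsilon> where "\<epsilon> = \<eta> * exp (- ((B + 1) / (c * (2 * pi))))"
    have "c * (2 * pi) > 0" using assms by simp
    then have e: "0 < \<epsilon>" "\<epsilon> < \<eta>" using assms B by (auto simp: \<epsilon>_def intro!: divide_pos_pos)
    have "ln \<epsilon> = ln \<eta> - (B + 1) / (c * (2 * pi))"
      unfolding \<epsilon>_def using assms by (subst ln_mult) auto
    then have "c * (ln \<eta> - ln \<epsilon>) * (2 * pi) = B + 1" using assms by simp
    then have "ennreal (B + 1) \<le> ennreal B" using ge [OF e] B(2) by simp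
    then show False using B(1) by (simp add: ennreal_le_iff)
  qed
qed

lemma dissipation_infinite:
  assumes "C1_compact \<phi>" "\<And>x. 0 \<le> \<phi> x" "\<phi> 0 \<noteq> 0"
  shows "(\<integral>\<^sup>+u. ennreal (pr.dissipation 0 \<phi> u) \<partial>lborel) = \<infinity>"
proof -
  have pos: "0 < \<phi> 0" using assms(2) [of 0] assms(3) by simp
  have "isCont \<phi> 0" using C1_compact_D(3) [OF assms(1)] continuous_on_eq_continuous_at [OF open_UNIV, of \<phi>] by blast
  then obtain d where d: "0 < d" "\<And>x. dist x 0 < d \<Longrightarrow> dist (\<phi> x) (\<phi> 0) < \<phi> 0 / 2"
    using pos unfolding continuous_at_eps_delta by (metis half_gt_zero)
  define \<eta> where "\<eta> = d / 2"
  define c where "c = (real p - real q)\<^sup>2 * (1 / (real (p + q) * lam * nu)) * (\<phi> 0 / 2)"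
  have c: "0 < c" using weights_pos lam_nu pos by (simp add: c_def)
  have "\<infinity> = (\<integral>\<^sup>+u. ennreal (indicator ({0<..\<eta>} \<times> {0..<2 * pi}) u * (c / fst u)) \<partial>(lborel :: (real \<times> real) measure))"
    by (rule nn_integral_reciprocal_infinite [symmetric]) (use d c in \<open>auto simp: \<eta>_def\<close>)
  also have "\<dots> \<le> (\<integral>\<^sup>+u. ennreal (pr.dissipation 0 \<phi> u) \<partial>lborel)"
  proof (intro nn_integral_mono ennreal_leI)
    fix u :: "real \<times> real"
    show "indicator ({0<..\<eta>} \<times> {0..<2 * pi}) u * (c / fst u) \<le> pr.dissipation 0 \<phi> u"
    proof (cases "u \<in> {0<..\<eta>} \<times> {0..<2 * pi}")
      case True
      then have y: "0 < fst u" and hs: "u \<in> half_strip" and le: "fst u \<le> \<eta>"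
        by (auto simp: half_strip_def)
      have "(norm (pr.F 0 u))\<^sup>2 = (fst u)\<^sup>2"
        unfolding pr.F_def norm_sw_point using rad_squares(1) [of "fst u" 0] y by simp
      then have "norm (pr.F 0 u) = fst u" using y by simp
      then have "dist (\<phi> (pr.F 0 u)) (\<phi> 0) < \<phi> 0 / 2" using le d(1) by (intro d(2)) (simp add: \<eta>_def)
      then have half: "\<phi> 0 / 2 \<le> \<phi> (pr.F 0 u)" by (simp add: dist_real_def abs_if split: if_splits)
      have a0: "ra 0 (fst u) = nu * fst u" "rb 0 (fst u) = lam * fst u"
        by (simp_all add: rad_a_def rad_b_def nu_def lam_def)
      have s: "rsa 0 (fst u) / ra 0 (fst u) = 1 / (real (p + q) * lam * nu) / fst u"
        unfolding rad_s_uniform [OF y] a0 using y by simp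
      have "c / fst u = (real p - real q)\<^sup>2 * (1 / (real (p + q) * lam * nu) / fst u) * (\<phi> 0 / 2)"
        by (simp add: c_def)
      also have "\<dots> \<le> (real p - real q)\<^sup>2 * (1 / (real (p + q) * lam * nu) / fst u) * \<phi> (pr.F 0 u)"
        using half y lam_nu by (intro mult_left_mono) auto
      finally show ?thesis using True hs by (simp add: pr.dissipation_def s)
    next
      case False
      have "0 \<le> pr.dissipation 0 \<phi> u"
        using rad_s_bounds(1) [of "fst u" 0] rad_positive(1) [of "fst u" 0] assms(2) [of "pr.F 0 u"]
        by (auto simp: pr.dissipation_def indicator_def half_strip_def)
      then show ?thesis using False by simp
    qed
  qed
  finally show ?thesis by (simp add: top_unique)
qed

text \<open>Fatou's lemma, applied along a sequence of times at which the dissipation stays below \<open>B\<close>.\<close>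

lemma dissipation_filterlim_at_top:
  assumes "C1_compact \<phi>" "\<And>x. 0 \<le> \<phi> x" "\<phi> 0 \<noteq> 0"
  shows "filterlim (\<lambda>t. \<integral>u. pr.dissipation t \<phi> u \<partial>lborel) at_top (at 0)"
  unfolding filterlim_at_top
proof (rule allI, rule ccontr)
  fix B :: real
  let ?I = "\<lambda>t. \<integral>u. pr.dissipation t \<phi> u \<partial>lborel"
  note C = C1_compact_D [OF assms(1)]
  have [measurable]: "pr.dissipation t \<phi> \<in> borel_measurable borel" for t
    by (rule pr.dissipation_measurable [OF C(3)])
  have nonneg: "0 \<le> pr.dissipation t \<phi> u" for t u
    using rad_s_bounds(1) [of "fst u" t] rad_positive(1) [of "fst u" t] assms(2) [of "pr.F t u"]
    by (auto simp: pr.dissipation_def indicator_def half_strip_def)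
  assume neg: "\<not> (\<forall>\<^sub>F t in at 0. B \<le> ?I t)"
  have "\<exists>t. t \<noteq> 0 \<and> \<bar>t\<bar> < 1 / real (Suc n) \<and> ?I t < B" for n
  proof (rule ccontr)
    assume "\<nexists>t. t \<noteq> 0 \<and> \<bar>t\<bar> < 1 / real (Suc n) \<and> ?I t < B"
    then have "\<forall>\<^sub>F t in at 0. B \<le> ?I t"
      unfolding eventually_at by (intro exI [of _ "1 / real (Suc n)"]) (auto simp: dist_real_def not_less)
    with neg show False by simp
  qed
  then obtain X where X: "\<And>n. X n \<noteq> 0" "\<And>n. \<bar>X n\<bar> < 1 / real (Suc n)" "\<And>n. ?I (X n) < B" by metis
  have X0: "X \<longlonglongrightarrow> 0"
    by (rule Lim_null_comparison [OF _ lim_1_over_n [THEN LIMSEQ_Suc]])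
      (use X(2) in \<open>auto intro!: always_eventually less_imp_le\<close>)
  have lim: "(\<lambda>n. ennreal (pr.dissipation (X n) \<phi> u)) \<longlonglongrightarrow> ennreal (pr.dissipation 0 \<phi> u)" for u
  proof (cases "u \<in> half_strip")
    case True
    note y = half_strip_D [OF True]
    show ?thesis
      unfolding pr.dissipation_def
      using F_tendsto [OF y X0] rad_tendsto [OF y X0] rad_positive(1) [OF y, of 0]
      by (intro tendsto_ennrealI tendsto_mult tendsto_divide tendsto_const
          continuous_on_tendsto_compose [OF C(3)]) auto
  qed (simp add: pr.dissipation_def)
  have "\<infinity> = (\<integral>\<^sup>+u. ennreal (pr.dissipation 0 \<phi> u) \<partial>lborel)"
    by (rule dissipation_infinite [OF assms, symmetric])
  also have "\<dots> = (\<integral>\<^sup>+u. liminf (\<lambda>n. ennreal (pr.dissipation (X n) \<phi> u)) \<partial>lborel)"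
    by (rule nn_integral_cong) (rule lim_imp_Liminf [OF sequentially_bot lim, symmetric])
  also have "\<dots> \<le> liminf (\<lambda>n. \<integral>\<^sup>+u. ennreal (pr.dissipation (X n) \<phi> u) \<partial>lborel)"
    by (rule nn_integral_liminf) simp
  also have "\<dots> \<le> liminf (\<lambda>n. ennreal B)"
  proof (rule Liminf_mono, rule always_eventually, rule allI)
    fix n
    have "(\<integral>\<^sup>+u. ennreal (pr.dissipation (X n) \<phi> u) \<partial>lborel) = ennreal (?I (X n))"
      using mass_has_derivative(2) [OF assms(1) X(1)] nonneg by (intro nn_integral_eq_integral) auto
    then show "(\<integral>\<^sup>+u. ennreal (pr.dissipation (X n) \<phi> u) \<partial>lborel) \<le> ennreal B"
      using X(3) [of n] by (simp add: ennreal_leI)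
  qed
  finally show False by (simp add: Liminf_const top_unique)
qed

text \<open>At \<open>t \<noteq> 0\<close> the mass is differentiable. At \<open>t = 0\<close> it is continuous, and its difference quotients have
  the limit of the derivatives at neighbouring times, be it finite or \<open>- \<infinity>\<close>.\<close>

lemma upper_mass_derivative_V:
  assumes "C1_compact \<phi>" "\<And>x. 0 \<le> \<phi> x" "generalized_mean_curvature (pr.V t) h"
  shows "upper_mass_derivative pr.V t \<phi> = brakke_delta (pr.V t) \<phi> h"
proof -
  note C = C1_compact_D [OF assms(1)]
  note delta = pr.brakke_delta_V [OF assms(1,2,3)]
  define m where "m = (\<lambda>t. mass (pr.V t) \<phi>)"
  define \<delta> where "\<delta> = (\<lambda>t. - (\<integral>u. pr.dissipation t \<phi> u \<partial>lborel) + (\<integral>u. pr.transport t \<phi> u \<partial>lborel))"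
  have dm: "(m has_real_derivative \<delta> s) (at s)" if "s \<noteq> 0" for s
    using mass_has_derivative(1) [OF assms(1) that] by (simp add: m_def \<delta>_def)
  have finite: "(\<integral>\<^sup>+u. ennreal (pr.dissipation t \<phi> u) \<partial>lborel) \<noteq> \<infinity>" if "integrable lborel (pr.dissipation t \<phi>)"
  proof -
    have "0 \<le> pr.dissipation t \<phi> u" for u
      using rad_s_bounds(1) [of "fst u" t] rad_positive(1) [of "fst u" t] assms(2) [of "pr.F t u"]
      by (auto simp: pr.dissipation_def indicator_def half_strip_def)
    then show ?thesis using that by (subst nn_integral_eq_integral) auto
  qed
  have lim: ?thesis if "((\<lambda>s. (m s - m t) / (s - t)) \<longlongrightarrow> \<delta> t) (at t)" "integrable lborel (pr.dissipation t \<phi>)"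
  proof -
    have "((\<lambda>s. ereal ((m s - m t) / (s - t))) \<longlongrightarrow> ereal (\<delta> t)) (at t)"
      using that(1) by (rule tendsto_ereal)
    then have "upper_mass_derivative pr.V t \<phi> = ereal (\<delta> t)"
      unfolding upper_mass_derivative_def m_def by (rule lim_imp_Limsup [OF trivial_limit_at])
    then show ?thesis unfolding delta using finite [OF that(2)] by (simp add: \<delta>_def)
  qed
  show ?thesis
  proof (cases "t = 0")
    case False
    show ?thesis
      using dm [OF False] mass_has_derivative(2) [OF assms(1) False]
      by (intro lim) (auto simp: has_field_derivative_iff)
  next
    case True
    have "(m \<longlongrightarrow> m 0) (at 0)" unfolding m_def by (rule mass_tendsto [OF C(3,4)])
    then have m0: "((\<lambda>s. m s - m 0) \<longlongrightarrow> 0) (at 0)" by (rule Lim_null [THEN iffD1])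
    have quotient: "filterlim (\<lambda>s. (m s - m 0) / s) G (at 0)" if "filterlim \<delta> G (at 0)" for G
    proof (rule lhopital [OF m0, where g' = "\<lambda>s. 1" and f' = \<delta>])
      show "\<forall>\<^sub>F s in at 0. ((\<lambda>s. m s - m 0) has_real_derivative \<delta> s) (at s)"
        unfolding eventually_at_filter
        by (intro always_eventually allI impI) (auto intro!: derivative_eq_intros dm)
    qed (use that in \<open>auto simp: eventually_at_filter\<close>)
    show ?thesis
    proof (cases "\<phi> 0 = 0")
      case 0: True
      note D = dissipation_tendsto [OF assms(1) 0]
      have "(\<delta> \<longlongrightarrow> \<delta> 0) (at 0)"
        unfolding \<delta>_def by (intro tendsto_add tendsto_minus D(1) transport_tendsto assms(1))
      then show ?thesis using quotient [of "nhds (\<delta> 0)"] D(2) True by (intro lim) auto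
    next
      case False
      have "filterlim (\<lambda>s. - (\<integral>u. pr.transport s \<phi> u \<partial>lborel) + (\<integral>u. pr.dissipation s \<phi> u \<partial>lborel)) at_top (at 0)"
        by (rule filterlim_tendsto_add_at_top [OF tendsto_minus [OF transport_tendsto [OF assms(1)]]
            dissipation_filterlim_at_top [OF assms(1,2) False]])
      then have "filterlim \<delta> at_bot (at 0)"
        unfolding filterlim_uminus_at_bot \<delta>_def by (simp add: add.commute)
      from quotient [OF this] have "((\<lambda>s. ereal ((m s - m 0) / (s - 0))) \<longlongrightarrow> - \<infinity>) (at 0)"
        by (simp add: tendsto_MInfty filterlim_at_bot_dense)
      then have "upper_mass_derivative pr.V t \<phi> = - \<infinity>"
        unfolding upper_mass_derivative_def m_def True by (rule lim_imp_Limsup [OF trivial_limit_at])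
      then show ?thesis
        unfolding delta using dissipation_infinite [OF assms(1,2) False] True by simp
    qed
  qed
qed

lemma brakke_motion_V: "brakke_motion 2 pr.V" and without_mass_loss_V: "without_mass_loss pr.V"
proof -
  show "without_mass_loss pr.V"
    unfolding without_mass_loss_def using upper_mass_derivative_V by blast
  show "brakke_motion 2 pr.V"
    unfolding brakke_motion_def
  proof (intro allI conjI)
    fix t
    show "is_varifold 2 (pr.V t)" by (rule pr.is_varifold_V)
    show "\<exists>h. generalized_mean_curvature (pr.V t) h \<and> (\<forall>\<phi>. C1_compact \<phi> \<and> (\<forall>x. 0 \<le> \<phi> x) \<longrightarrow>
        upper_mass_derivative pr.V t \<phi> \<le> brakke_delta (pr.V t) \<phi> h)"
      using upper_mass_derivative_V [OF _ _ pr.generalized_mean_curvature_V]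
      by (intro exI [of _ "sw_mean_curvature p q"] conjI allI impI pr.generalized_mean_curvature_V) force
  qed
qed

end


section \<open>The surfaces as immersions of a half cylinder\<close>

definition cylinder :: "R5 set" where
  "cylinder = {x. norm (fst x) = 1 \<and> fst (snd x) = 0 \<and> 0 \<le> snd (snd x)}"

definition cyl_chart :: "real \<times> real \<Rightarrow> R5" where
  "cyl_chart u = (cis (snd u), 0, fst u)"

text \<open>The parameter \<open>y\<close> runs over the whole line; the part \<open>y \<ge> 0\<close> is cut out by the half plane.\<close>

definition cyl_domain :: "real \<Rightarrow> (real \<times> real) set" where
  "cyl_domain c = UNIV \<times> {c<..<c + 2 * pi}"

definition cyl_atlas :: "R5 chart set" where
  "cyl_atlas = (\<lambda>c. (cyl_domain c, cyl_chart)) ` {- pi, 0}"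

text \<open>Multiplication by \<open>- cis (- c)\<close> moves the slit of the argument to the omitted angle \<open>c\<close>.\<close>

definition cyl_inverse :: "real \<Rightarrow> R5 \<Rightarrow> real \<times> real" where
  "cyl_inverse c x = (snd (snd x), c + pi + Arg (- (fst x * cis (- c))))"

lemma cis_eq_cis_iff: "cis s = cis t \<longleftrightarrow> (\<exists>k::int. s - t = of_int k * (2 * pi))"
proof -
  have "cis s = cis t \<longleftrightarrow> cis (s - t) = 1" by (simp add: cis_divide [symmetric])
  also have "\<dots> \<longleftrightarrow> (\<exists>k::int. s - t = of_int k * (2 * pi))"
    by (auto simp: cis_conv_exp exp_eq_1 mult_ac)
  finally show ?thesis .
qed

lemma cis_Arg_unit: "norm z = 1 \<Longrightarrow> cis (Arg z) = z"
  using cis_Arg [of z] by (cases "z = 0") (auto simp: sgn_div_norm)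

lemma cyl_inverse_chart:
  assumes "u \<in> cyl_domain c"
  shows "cyl_inverse c (cyl_chart u) = u"
proof -
  have "- (cis (snd u) * cis (- c)) = cis (snd u - c - pi)"
    by (simp add: cis_divide [symmetric] cis_mult)
  moreover have "Arg (cis (snd u - c - pi)) = snd u - c - pi"
    by (rule Arg_unique [where r = 1]) (use assms in \<open>auto simp: cyl_domain_def cis_conv_exp\<close>)
  ultimately show ?thesis by (simp add: cyl_inverse_def cyl_chart_def)
qed

lemma cyl_chart_inverse:
  assumes "x \<in> cylinder" "fst x \<noteq> cis c"
  shows "cyl_inverse c x \<in> cyl_domain c \<inter> half_plane" "cyl_chart (cyl_inverse c x) = x"
    "- (fst x * cis (- c)) \<notin> \<real>\<^sub>\<le>\<^sub>0"
proof -
  define z where "z = - (fst x * cis (- c))"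
  have nz: "norm z = 1" using assms by (simp add: z_def norm_mult cylinder_def)
  have zc: "fst x = cis (c + pi) * z"
    by (simp add: z_def cis_mult [symmetric] mult_ac) (simp add: cis_mult mult.left_commute [of "cis c"])
  have zA: "cis (Arg z) = z" using nz by (rule cis_Arg_unit)
  show cut: "- (fst x * cis (- c)) \<notin> \<real>\<^sub>\<le>\<^sub>0"
  proof
    assume "- (fst x * cis (- c)) \<in> \<real>\<^sub>\<le>\<^sub>0"
    then have "Im z = 0" "Re z \<le> 0" by (auto simp: z_def complex_nonpos_Reals_iff)
    then have "z = - 1" using nz by (auto simp: complex_eq_iff cmod_def)
    then have "fst x = cis c" using zc by (simp add: cis_mult [symmetric])
    then show False using assms(2) by simp
  qed
  have "Arg z \<noteq> pi"
  proof
    assume "Arg z = pi"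
    then have "z = - 1" using zA by simp
    then show False using cut by (simp add: z_def [symmetric])
  qed
  then have A: "- pi < Arg z" "Arg z < pi" using Arg_bounded [of z] by auto
  show "cyl_inverse c x \<in> cyl_domain c \<inter> half_plane"
    using A assms(1) by (simp add: cyl_inverse_def z_def [symmetric] cyl_domain_def half_plane_def cylinder_def)
  have "cis (c + pi + Arg z) = fst x" by (simp only: zc zA cis_mult [symmetric, of "c + pi"])
  then show "cyl_chart (cyl_inverse c x) = x"
    using assms(1) by (simp add: cyl_chart_def cyl_inverse_def z_def [symmetric] cylinder_def prod_eq_iff)
qed

lemma cyl_chart_image: "cyl_chart ` (cyl_domain c \<inter> half_plane) = cylinder \<inter> {x. fst x \<noteq> cis c}"
proof (intro equalityI subsetI)
  fix x assume "x \<in> cyl_chart ` (cyl_domain c \<inter> half_plane)"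
  then obtain u where u: "x = cyl_chart u" "u \<in> cyl_domain c" "0 \<le> fst u" by (auto simp: half_plane_def)
  have "cis (snd u) \<noteq> cis c"
  proof
    assume "cis (snd u) = cis c"
    then obtain k :: int where k: "snd u - c = of_int k * (2 * pi)" by (auto simp: cis_eq_cis_iff)
    have "0 < snd u - c" "snd u - c < 1 * (2 * pi)"
      using u(2) by (auto simp: cyl_domain_def)
    then have "0 < real_of_int k" "real_of_int k < 1"
      unfolding k using pi_gt_zero by (auto simp: zero_less_mult_iff mult_less_cancel_right simp del: mult_1)
    then have "0 < k" "k < 1" by simp_all
    then show False by simp
  qed
  then show "x \<in> cylinder \<inter> {x. fst x \<noteq> cis c}" using u by (simp add: cylinder_def cyl_chart_def)
next
  fix x assume "x \<in> cylinder \<inter> {x. fst x \<noteq> cis c}"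
  then show "x \<in> cyl_chart ` (cyl_domain c \<inter> half_plane)"
    using cyl_chart_inverse(1,2) [of x c] by (intro image_eqI [of _ _ "cyl_inverse c x"]) auto
qed

lemma cyl_inverse_continuous: "continuous_on (cylinder \<inter> {x. fst x \<noteq> cis c}) (cyl_inverse c)"
  unfolding cyl_inverse_def
  by (intro continuous_intros continuous_on_compose2 [OF continuous_on_Arg]; use cyl_chart_inverse(3) in auto)

lemma cyl_chart_has_derivative:
  "(cyl_chart has_derivative (\<lambda>v. (snd v *\<^sub>R (\<i> * cis (snd u)), 0, fst v))) (at u)"
  unfolding cyl_chart_def by (auto intro!: derivative_eq_intros)

lemma pd_cyl_chart: "frechet_derivative cyl_chart (at u) = (\<lambda>v. (snd v *\<^sub>R (\<i> * cis (snd u)), 0, fst v))"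
  using frechet_derivative_at [OF cyl_chart_has_derivative] by simp

lemma cylinder_eq: "cylinder = (\<Union>(W, \<psi>)\<in>cyl_atlas. \<psi> ` (W \<inter> half_plane))"
proof -
  have "cis (- pi) \<noteq> cis 0" by (simp add: complex_eq_iff)
  then have "x \<in> cylinder \<longleftrightarrow> x \<in> cylinder \<inter> {x. fst x \<noteq> cis (- pi)} \<or> x \<in> cylinder \<inter> {x. fst x \<noteq> cis 0}" for x
    by auto
  then show ?thesis unfolding cyl_atlas_def by (simp add: cyl_chart_image) blast
qed

lemma oriented_surface_cylinder: "oriented_surface cylinder cyl_atlas"
  unfolding oriented_surface_def
proof (intro conjI)
  show "cylinder = (\<Union>(W, \<psi>)\<in>cyl_atlas. \<psi> ` (W \<inter> half_plane))" by (rule cylinder_eq)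
  have chart: "open (cyl_domain c) \<and> smooth_on (cyl_domain c) cyl_chart \<and>
      (\<forall>u\<in>cyl_domain c \<inter> half_plane. inj (frechet_derivative cyl_chart (at u))) \<and>
      openin (top_of_set cylinder) (cyl_chart ` (cyl_domain c \<inter> half_plane)) \<and>
      (\<exists>\<kappa>. homeomorphism (cyl_domain c \<inter> half_plane) (cyl_chart ` (cyl_domain c \<inter> half_plane)) cyl_chart \<kappa>)" for c
  proof (intro conjI ballI)
    show o: "open (cyl_domain c)" unfolding cyl_domain_def by (intro open_Times) auto
    show "smooth_on (cyl_domain c) cyl_chart"
      unfolding cyl_chart_def
      by (intro smooth_on_Pair smooth_on_cis smooth_on_const smooth_on_linear o bounded_linear_fst bounded_linear_snd)
    show "inj (frechet_derivative cyl_chart (at u))" for u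
      unfolding pd_cyl_chart by (auto intro!: injI simp: prod_eq_iff)
    have "open {x::R5. fst x \<noteq> cis c}" by (intro open_Collect_neq continuous_intros)
    then show "openin (top_of_set cylinder) (cyl_chart ` (cyl_domain c \<inter> half_plane))"
      unfolding cyl_chart_image by (rule openin_open_Int)
    have "homeomorphism (cyl_domain c \<inter> half_plane) (cyl_chart ` (cyl_domain c \<inter> half_plane)) cyl_chart (cyl_inverse c)"
      unfolding homeomorphism_def
    proof (intro conjI ballI)
      show "continuous_on (cyl_domain c \<inter> half_plane) cyl_chart"
        unfolding cyl_chart_def by (intro continuous_intros)
      show "continuous_on (cyl_chart ` (cyl_domain c \<inter> half_plane)) (cyl_inverse c)"
        unfolding cyl_chart_image by (rule cyl_inverse_continuous)
      show "cyl_inverse c ` cyl_chart ` (cyl_domain c \<inter> half_plane) = cyl_domain c \<inter> half_plane"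
        by (force simp: image_image cyl_inverse_chart)
      show "cyl_chart (cyl_inverse c x) = x" if "x \<in> cyl_chart ` (cyl_domain c \<inter> half_plane)" for x
        using that by (auto simp: cyl_inverse_chart)
    qed (auto simp: cyl_inverse_chart)
    then show "\<exists>\<kappa>. homeomorphism (cyl_domain c \<inter> half_plane) (cyl_chart ` (cyl_domain c \<inter> half_plane)) cyl_chart \<kappa>" by blast
  qed
  then show "\<forall>(W, \<psi>)\<in>cyl_atlas. open W \<and> smooth_on W \<psi> \<and>
      (\<forall>u\<in>W \<inter> half_plane. inj (frechet_derivative \<psi> (at u))) \<and>
      openin (top_of_set cylinder) (\<psi> ` (W \<inter> half_plane)) \<and>
      (\<exists>\<kappa>. homeomorphism (W \<inter> half_plane) (\<psi> ` (W \<inter> half_plane)) \<psi> \<kappa>)"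
    unfolding cyl_atlas_def by blast
  have "\<exists>a b c d. pd1 cyl_chart u = a *\<^sub>R pd1 cyl_chart u' + b *\<^sub>R pd2 cyl_chart u' \<and>
      pd2 cyl_chart u = c *\<^sub>R pd1 cyl_chart u' + d *\<^sub>R pd2 cyl_chart u' \<and> a * d - b * c > 0"
    if "cyl_chart u = cyl_chart u'" for u u'
    using that unfolding pd_cyl_chart
    by (intro exI [of _ 1] exI [of _ 0]) (auto simp: cyl_chart_def)
  then show "\<forall>(W, \<psi>)\<in>cyl_atlas. \<forall>(W', \<psi>')\<in>cyl_atlas. \<forall>u\<in>W \<inter> half_plane. \<forall>u'\<in>W' \<inter> half_plane.
        \<psi> u = \<psi>' u' \<longrightarrow>
        (\<exists>a b c d. pd1 \<psi> u = a *\<^sub>R pd1 \<psi>' u' + b *\<^sub>R pd2 \<psi>' u' \<and>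
                   pd2 \<psi> u = c *\<^sub>R pd1 \<psi>' u' + d *\<^sub>R pd2 \<psi>' u' \<and> a * d - b * c > 0)"
    unfolding cyl_atlas_def by (simp only: ball_simps case_prod_conv image_iff bex_simps) blast
qed

text \<open>At times \<open>t \<noteq> 0\<close> the radii extend smoothly across the seam to negative \<open>y\<close>, one of them as an even
  and the other one as an odd function, and \<open>sc\<close> extends \<open>s\<close>. All pointwise identities then hold on a
  neighbourhood of the boundary, as the two-sided derivatives there require.\<close>

locale sw_smooth_profile = sw_profile p q a b sa sb s
  for p q :: nat and a b sa sb s :: "real \<Rightarrow> real" +
  fixes sc :: "real \<Rightarrow> real" and kap :: real
  assumes smooth: "smooth_on UNIV (\<lambda>x::R5. a (snd (snd x)))" "smooth_on UNIV (\<lambda>x::R5. b (snd (snd x)))"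
    and sc: "\<And>y. 0 < sc y" "\<And>y. sa y = sc y * a y" "\<And>y. sb y = sc y * b y" "\<And>y. \<exists>d. (sc has_real_derivative d) (at y)"
    and deriv_all: "\<And>y. (a has_real_derivative q * sb y) (at y)" "\<And>y. (b has_real_derivative p * sa y) (at y)"
    and nondegenerate: "\<And>y. a y \<noteq> 0 \<or> b y \<noteq> 0"
    and level: "\<And>y. real p * (a y)\<^sup>2 - real q * (b y)\<^sup>2 = kap"
begin

text \<open>A smooth map of the ambient space that restricts to the immersion; on the cylinder the powers of the
  unit complex number \<open>\<zeta>\<close> and of its conjugate are the two rotations of the circle action.\<close>

definition G :: "R5 \<Rightarrow> C2" where
  "G x = (of_real (a (snd (snd x))) * fst x ^ p, \<i> * of_real (b (snd (snd x))) * cnj (fst x) ^ q)"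
definition G1 :: "R5 \<Rightarrow> C2" where
  "G1 x = (of_real (q * sb (snd (snd x))) * fst x ^ p, \<i> * of_real (p * sa (snd (snd x))) * cnj (fst x) ^ q)"
definition G2 :: "R5 \<Rightarrow> C2" where
  "G2 x = J (of_real (p * a (snd (snd x))) * fst x ^ p, \<i> * of_real (- (q * b (snd (snd x)))) * cnj (fst x) ^ q)"

lemma cis_powers: "cis \<theta> ^ p = cis (real p * \<theta>)" "cnj (cis \<theta>) ^ q = cis (- (real q * \<theta>))"
  by (simp_all add: Complex.DeMoivre cis_cnj)

lemma G_chart: "G (cyl_chart u) = F u" "G1 (cyl_chart u) = F1 u" "G2 (cyl_chart u) = F2 u"
  by (simp_all add: G_def G1_def G2_def F_def F1_def F2_def sw_point_def cyl_chart_def cis_powers)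

lemma G_comp_chart: "G \<circ> cyl_chart = F"
  by (simp add: fun_eq_iff G_chart)

lemma D_pos_all: "0 < D y"
  using nondegenerate [of y] weights unfolding D_def by (auto simp: add_pos_nonneg add_nonneg_pos)

lemma A_all: "A y = sc y * D y"
  by (simp add: A_def D_def sc power_mult_distrib power2_eq_square algebra_simps)

lemma A_pos_all: "0 < A y"
  by (simp add: A_all sc(1) D_pos_all)

lemma F1_all: "F1 u = sc (fst u) *\<^sub>R conormal u"
  unfolding F1_def conormal_def sw_point_linear(2) [symmetric] by (simp add: sc mult_ac)

lemma F1_norm_all: "F1 u \<bullet> F1 u = (sc (fst u))\<^sup>2 * D (fst u)"
  by (simp add: F1_all inner_frame(1) power2_eq_square)

lemma frame_nonzero: "F1 u \<noteq> 0" "F2 u \<noteq> 0"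
  using F1_norm_all [of u] inner_frame(2) [of u] D_pos_all [of "fst u"] sc(1) [of "fst u"] by auto

lemma F_has_derivative_all: "(F has_derivative (\<lambda>v. fst v *\<^sub>R F1 u + snd v *\<^sub>R F2 u)) (at u)"
  using sw_point_has_derivative [OF deriv_all(1) [of "fst u"] deriv_all(2) [of "fst u"], of p q "snd u"]
  unfolding F_def F1_def F2_def by simp

lemma pd_F_all: "frechet_derivative F (at u) = (\<lambda>v. fst v *\<^sub>R F1 u + snd v *\<^sub>R F2 u)"
  using frechet_derivative_at [OF F_has_derivative_all] by simp

lemma area_density_all: "area_density F u = A (fst u)"
proof -
  have "area_density F u = sqrt ((A (fst u))\<^sup>2)"
    unfolding area_density_def pd_F_all
    by (simp add: inner_frame F1_norm_all A_all power2_eq_square mult_ac del: real_sqrt_abs real_sqrt_abs2)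
  then show ?thesis using A_pos_all [of "fst u"] by simp
qed

lemma tangent_plane_all: "plane_proj (tangent_plane F u) = frame_proj (F1 u) (F2 u)"
  unfolding tangent_plane_def pd_F_all
  by (simp add: plane_proj_span_orthogonal frame_nonzero inner_frame(3))

lemma symplectic_form_J: "symplectic_form v w = J v \<bullet> w"
  by (simp add: symplectic_form_def J_def inner_prod_def inner_complex_def)

lemma smooth_G: "smooth_on UNIV G"
proof -
  have 1: "smooth_on UNIV (\<lambda>x::R5. fst x)" by (rule smooth_on_linear [OF open_UNIV bounded_linear_fst])
  have 2: "smooth_on UNIV (\<lambda>x::R5. cnj (fst x))"
    by (rule smooth_on_linear_comp [OF open_UNIV bounded_linear_cnj 1])
  have 3: "smooth_on UNIV (\<lambda>x::R5. complex_of_real (a (snd (snd x))))" "smooth_on UNIV (\<lambda>x::R5. complex_of_real (b (snd (snd x))))"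
    by (rule smooth_on_linear_comp [OF open_UNIV bounded_linear_of_real] smooth)+
  show ?thesis unfolding G_def
    by (intro smooth_on_Pair smooth_on_mult smooth_on_power smooth_on_const open_UNIV 1 2 3)
qed

lemma continuous_G: "continuous_on S G"
proof -
  have "continuous_on UNIV G" using smooth_G unfolding smooth_on_def by (metis higher_differentiable_on.simps(1))
  then show ?thesis by (rule continuous_on_subset) simp
qed

lemma lagrangian_immersion_G: "lagrangian_immersion cylinder cyl_atlas G"
  unfolding lagrangian_immersion_def proper_immersion_def
proof (intro conjI allI impI)
  show "\<exists>N. open N \<and> cylinder \<subseteq> N \<and> smooth_on N G" using smooth_G by blast
  have "inj (frechet_derivative F (at u))" for u
    unfolding pd_F_all
  proof (rule injI)
    fix v w :: "real \<times> real" assume eq: "fst v *\<^sub>R F1 u + snd v *\<^sub>R F2 u = fst w *\<^sub>R F1 u + snd w *\<^sub>R F2 u"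
    have "F2 u \<bullet> F1 u = 0" using inner_frame(3) [of u] by (simp add: inner_commute)
    with arg_cong [OF eq, of "\<lambda>z. z \<bullet> F1 u"] arg_cong [OF eq, of "\<lambda>z. z \<bullet> F2 u"]
    show "v = w" using frame_nonzero [of u] inner_frame(3) [of u] by (auto simp: inner_add_left prod_eq_iff)
  qed
  then show "\<forall>(W, \<psi>)\<in>cyl_atlas. \<forall>u\<in>W \<inter> half_plane. inj (frechet_derivative (G \<circ> \<psi>) (at u))"
    unfolding cyl_atlas_def by (auto simp: G_comp_chart)
  show "\<forall>(W, \<psi>)\<in>cyl_atlas. \<forall>u\<in>W \<inter> half_plane. symplectic_form (pd1 (G \<circ> \<psi>) u) (pd2 (G \<circ> \<psi>) u) = 0"
    unfolding cyl_atlas_def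
    by (auto simp: G_comp_chart pd_F_all symplectic_form_J F1_def F2_def inner_J_J inner_sw_point sc)
  fix K :: "C2 set" assume K: "compact K"
  then obtain R where R: "\<And>x. x \<in> K \<Longrightarrow> norm x \<le> R" by (meson compact_imp_bounded bounded_iff)
  have clc: "closed cylinder"
    unfolding cylinder_def
    by (intro closed_Collect_conj closed_Collect_eq closed_Collect_le continuous_intros)
  have "closed (G -` K)" using continuous_closed_vimage [OF compact_imp_closed [OF K]] continuous_G
    by (metis continuous_on_eq_continuous_at open_UNIV UNIV_I)
  then have cl: "closed (cylinder \<inter> G -` K)" using clc by (rule closed_Int [rotated])
  have "norm x \<le> 1 + \<bar>R\<bar>" if "x \<in> cylinder \<inter> G -` K" for x
  proof -
    have x: "norm (fst x) = 1" "fst (snd x) = 0" "0 \<le> snd (snd x)" using that by (auto simp: cylinder_def)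
    have "norm (G x) = norm (F (snd (snd x), Arg (fst x)))"
    proof -
      have "cis (Arg (fst x)) = fst x" using x(1) by (rule cis_Arg_unit)
      then have "x = cyl_chart (snd (snd x), Arg (fst x))" using x(2) by (simp add: cyl_chart_def prod_eq_iff)
      then show ?thesis by (metis G_chart(1))
    qed
    moreover have "norm (G x) \<le> R" using that R by auto
    ultimately have "snd (snd x) \<le> R" using norm_F_ge [of "(snd (snd x), Arg (fst x))"] x(3) by simp
    moreover have "norm (snd x) = \<bar>snd (snd x)\<bar>" using x(2) by (cases x) (simp add: norm_Pair)
    ultimately show ?thesis using norm_Pair_le [of "fst x" "snd x"] x by simp
  qed
  then have "bounded (cylinder \<inter> G -` K)" unfolding bounded_iff by blast
  then show "compact (cylinder \<inter> G -` K)" using cl by (simp add: compact_eq_bounded_closed)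
qed

definition angle :: "real \<times> real \<Rightarrow> real" where "angle u = (real p - real q) * snd u"

lemma angle_has_derivative: "(angle has_derivative (\<lambda>v. (real p - real q) * snd v)) (at u)"
  unfolding angle_def by (auto intro!: derivative_eq_intros)

lemma pd_angle: "frechet_derivative angle (at u) = (\<lambda>v. (real p - real q) * snd v)"
  using frechet_derivative_at [OF angle_has_derivative] by simp

lemma lagrangian_angle: "lagrangian_angle_near F u angle"
  unfolding lagrangian_angle_near_def
proof (intro exI conjI ballI)
  show "smooth_on UNIV angle"
    unfolding angle_def by (intro smooth_on_linear open_UNIV bounded_linear_const_mult bounded_linear_snd)
  fix v :: "real \<times> real"
  have e: "cis (real p * snd v) * cis (- (real q * snd v)) = cis (angle v)"
    by (simp add: cis_mult angle_def left_diff_distrib)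
  have "dz12 (F1 v) (F2 v) = of_real (A (fst v)) * (cis (real p * snd v) * cis (- (real q * snd v)))"
    unfolding dz12_def F1_def F2_def sw_point_def J_def A_def
    by (simp add: power2_eq_square) (simp add: algebra_simps)
  then show "dz12 (pd1 F v) (pd2 F v) / of_real (area_density F v) = cis (angle v)"
    using A_pos_all [of "fst v"] by (simp add: pd_F_all area_density_all e)
qed auto

lemma gradient_angle: "grad1 F angle u = 0" "grad2 F angle u = (real p - real q) / D (fst u)"
proof -
  show "grad1 F angle u = 0" by (simp add: grad1_def pd_F_all pd_angle inner_frame)
  show "grad2 F angle u = (real p - real q) / D (fst u)"
    using A_pos_all [of "fst u"] D_pos_all [of "fst u"] sc(1) [of "fst u"]
    by (simp add: grad2_def pd_F_all pd_angle inner_frame area_density_all F1_norm_all A_all power2_eq_square)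
qed

text \<open>The gradient flux \<open>area * grad2 = (p - q) sc\<close> depends on \<open>y\<close> only and points in the direction of \<open>\<theta>\<close>.\<close>

lemma laplacian_angle: "surface_laplacian F angle u = 0"
proof -
  have 2: "area_density F v * grad2 F angle v = (real p - real q) * sc (fst v)" for v
    using D_pos_all [of "fst v"] by (simp add: gradient_angle area_density_all A_all)
  obtain d where d: "(sc has_real_derivative d) (at (fst u))" using sc(4) by blast
  have "((\<lambda>v::real \<times> real. sc (fst v)) has_derivative (\<lambda>v. fst v * d)) (at u)"
    by (rule DERIV_compose_FDERIV [OF d has_derivative_fst [OF has_derivative_ident]])
  then have "((\<lambda>v. (real p - real q) * sc (fst v)) has_derivative (\<lambda>v. (real p - real q) * (fst v * d))) (at u)"
    by (rule has_derivative_mult_right)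
  from frechet_derivative_at [OF this, symmetric]
  have "pd2 (\<lambda>v. (real p - real q) * sc (fst v)) u = 0" by simp
  moreover have "pd1 (\<lambda>v::real \<times> real. 0 :: real) u = 0"
    by (simp add: frechet_derivative_const)
  ultimately show ?thesis unfolding surface_laplacian_def 2 by (simp add: gradient_angle(1))
qed

lemma hamiltonian_stationary_G: "hamiltonian_stationary cyl_atlas G"
  unfolding hamiltonian_stationary_def cyl_atlas_def
  using lagrangian_angle laplacian_angle by (simp add: G_comp_chart) blast

text \<open>The position vector is orthogonal to \<open>F2\<close>, so only its component along \<open>F1\<close> has to be removed; the rest
  is computed from \<open>p a\<^sup>2 - q b\<^sup>2 = kap\<close>.\<close>

lemma normal_part_F:
  "F u - frame_proj (F1 u) (F2 u) (F u) = (- kap / D (fst u)) *\<^sub>R J (F2 u)"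
proof -
  let ?a = "a (fst u)" and ?b = "b (fst u)" and ?D = "D (fst u)" and ?s = "sc (fst u)"
  have D: "?D \<noteq> 0" "?s \<noteq> 0" using D_pos_all [of "fst u"] sc(1) [of "fst u"] by auto
  have "F2 u \<bullet> F u = 0" by (simp add: F_def F2_def inner_J_sw_point)
  moreover have "F1 u \<bullet> F u = ?s * ((real p + real q) * ?a * ?b)"
    by (simp add: F_def F1_def inner_sw_point sc algebra_simps)
  ultimately have "frame_proj (F1 u) (F2 u) (F u) = ((real p + real q) * ?a * ?b / ?D) *\<^sub>R conormal u"
    unfolding frame_proj_apply F1_norm_all using D by (simp add: F1_all power2_eq_square field_simps)
  moreover have "J (F2 u) = sw_point p q (- (p * ?a)) (q * ?b) (snd u)"
    unfolding F2_def J_J sw_point_linear(3) [symmetric] by simp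
  moreover have "?a = (real p + real q) * ?a * ?b / ?D * (q * ?b) + (- kap / ?D) * - (p * ?a)"
  proof -
    have "?a * ?D = (real p + real q) * ?a * ?b * (q * ?b) + kap * (p * ?a)"
      unfolding D_def level [of "fst u", symmetric] by algebra
    then have "?a = ((real p + real q) * ?a * ?b * (q * ?b) + kap * (p * ?a)) / ?D"
      by (rule nonzero_eq_divide_eq [OF D(1), THEN iffD2])
    then show ?thesis by (simp only: add_divide_distrib diff_divide_distrib) simp
  qed
  moreover have "?b = (real p + real q) * ?a * ?b / ?D * (p * ?a) + (- kap / ?D) * (q * ?b)"
  proof -
    have "?b * ?D = (real p + real q) * ?a * ?b * (p * ?a) - kap * (q * ?b)"
      unfolding D_def level [of "fst u", symmetric] by algebra
    then have "?b = ((real p + real q) * ?a * ?b * (p * ?a) - kap * (q * ?b)) / ?D"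
      by (rule nonzero_eq_divide_eq [OF D(1), THEN iffD2])
    then show ?thesis by (simp only: add_divide_distrib diff_divide_distrib) simp
  qed
  ultimately have "F u = frame_proj (F1 u) (F2 u) (F u) + (- kap / ?D) *\<^sub>R J (F2 u)"
    unfolding F_def conormal_def
    by (simp only: sw_point_linear(1,2) [symmetric])
  then show ?thesis by (simp add: algebra_simps)
qed

lemma self_similar_G: "self_similar cyl_atlas G (- kap / (2 * (real p - real q)))"
proof -
  have "real p - real q \<noteq> 0" using weights(4) by simp
  then have "2 * (- kap / (2 * (real p - real q))) * ((real p - real q) / D (fst u)) = - kap / D (fst u)" for u :: "real \<times> real"
    by (metis (no_types, opaque_lifting) mult.commute mult_minus_left nonzero_mult_divide_mult_cancel_right2
        times_divide_eq_left times_divide_times_eq mult_divide_mult_cancel_left_if zero_neq_numeral minus_divide_left)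
  then have "G (cyl_chart u) - plane_proj (tangent_plane F u) (G (cyl_chart u))
      = (2 * (- kap / (2 * (real p - real q)))) *\<^sub>R J (surface_gradient F angle u)" for u
    unfolding G_chart tangent_plane_all normal_part_F surface_gradient_def gradient_angle pd_F_all
    by (simp add: J_linear)
  then have "\<exists>\<beta>. lagrangian_angle_near (G \<circ> cyl_chart) u \<beta> \<and>
      G (cyl_chart u) - plane_proj (tangent_plane (G \<circ> cyl_chart) u) (G (cyl_chart u))
        = (2 * (- kap / (2 * (real p - real q)))) *\<^sub>R J (surface_gradient (G \<circ> cyl_chart) \<beta> u)" for u
    unfolding G_comp_chart using lagrangian_angle by blast
  then show ?thesis unfolding self_similar_def cyl_atlas_def by blast
qed

end


lemma cylinder_borel: "cylinder \<in> sets borel"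
  unfolding cylinder_def
  by (intro borel_closed closed_Collect_conj closed_Collect_eq closed_Collect_le continuous_intros)

lemma cyl_chart_image_borel:
  assumes "B \<in> sets borel" "B \<subseteq> cyl_domain c \<inter> half_plane"
  shows "cyl_chart ` B \<in> sets borel"
proof -
  let ?S = "cylinder \<inter> {x. fst x \<noteq> cis c}"
  have S: "?S \<in> sets borel"
    by (intro sets.Int cylinder_borel borel_open open_Collect_neq continuous_intros)
  have "cyl_inverse c \<in> borel_measurable (restrict_space borel ?S)"
    by (rule borel_measurable_continuous_on_restrict [OF cyl_inverse_continuous])
  from measurable_sets [OF this assms(1)]
  have "cyl_inverse c -` B \<inter> ?S \<in> sets borel"
    using S by (simp add: sets_restrict_space_iff space_restrict_space)
  moreover have "cyl_chart ` B = cyl_inverse c -` B \<inter> ?S"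
  proof (intro equalityI subsetI)
    fix x assume "x \<in> cyl_chart ` B"
    then obtain u where u: "x = cyl_chart u" "u \<in> B" by blast
    then have "x \<in> cyl_chart ` (cyl_domain c \<inter> half_plane)" using assms(2) by blast
    then show "x \<in> cyl_inverse c -` B \<inter> ?S"
      using u assms(2) unfolding cyl_chart_image by (auto simp: cyl_inverse_chart)
  next
    fix x assume "x \<in> cyl_inverse c -` B \<inter> ?S"
    then show "x \<in> cyl_chart ` B"
      using cyl_chart_inverse(2) [of x c] by (intro image_eqI [of _ _ "cyl_inverse c x"]) auto
  qed
  ultimately show ?thesis by simp
qed

lemma nn_integral_lborel_translate:
  fixes f :: "'a::euclidean_space \<Rightarrow> ennreal"
  assumes "f \<in> borel_measurable borel"
  shows "(\<integral>\<^sup>+u. f u \<partial>lborel) = (\<integral>\<^sup>+u. f (v + u) \<partial>lborel)"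
proof -
  have "(\<integral>\<^sup>+u. f u \<partial>lborel) = (\<integral>\<^sup>+u. f u \<partial>distr lborel borel ((+) v))" by (simp only: lborel_distr_plus)
  also have "\<dots> = (\<integral>\<^sup>+u. f (v + u) \<partial>lborel)" using assms by (intro nn_integral_distr) auto
  finally show ?thesis .
qed

text \<open>The half strip is a fundamental domain for the angle. A chart domain meets it and its translate by
  one period, and no point of the surface has preimages in both.\<close>

lemma cyl_chart_in_image_iff:
  assumes "B \<subseteq> cyl_domain c \<inter> half_plane" "c = - pi \<or> c = 0" "u \<in> half_strip"
  shows "cyl_chart u \<in> cyl_chart ` B \<longleftrightarrow> u \<in> B \<or> - (0, 2 * pi) + u \<in> B"
    and "\<not> (u \<in> B \<and> - (0, 2 * pi) + u \<in> B)"
proof -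
  have cyc: "cyl_chart (- (0, 2 * pi) + u) = cyl_chart u"
    by (simp add: cyl_chart_def cis_divide [symmetric])
  have "u \<in> B \<or> - (0, 2 * pi) + u \<in> B" if im: "cyl_chart u \<in> cyl_chart ` B"
  proof -
    obtain v where "v \<in> B" "cyl_chart u = cyl_chart v" using im by blast
    then have v: "v \<in> B" "fst v = fst u" "cis (snd u) = cis (snd v)" by (simp_all add: cyl_chart_def)
    then obtain k :: int where k: "snd u - snd v = of_int k * (2 * pi)" by (auto simp: cis_eq_cis_iff)
    have "- 1 * (2 * pi) < snd u - snd v" "snd u - snd v < 2 * (2 * pi)"
      using v(1) assms pi_gt_zero by (auto simp: cyl_domain_def half_strip_def)
    then have "- 1 < real_of_int k" "real_of_int k < 2"
      unfolding k using pi_gt_zero by (simp_all only: mult_less_cancel_right)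
    then have "k = 0 \<or> k = 1" by auto
    then show ?thesis
    proof
      assume "k = 0"
      then have "u = v" using k v by (simp add: prod_eq_iff)
      then show ?thesis using v by simp
    next
      assume "k = 1"
      then have "- (0, 2 * pi) + u = v" using k v by (simp add: prod_eq_iff)
      then show ?thesis using v by simp
    qed
  qed
  then show "cyl_chart u \<in> cyl_chart ` B \<longleftrightarrow> u \<in> B \<or> - (0, 2 * pi) + u \<in> B"
    using cyc by (metis image_eqI)
  show "\<not> (u \<in> B \<and> - (0, 2 * pi) + u \<in> B)"
  proof
    have dom: "c < snd v \<and> snd v < c + 2 * pi" if "v \<in> B" for v
      using assms(1) that by (auto simp: cyl_domain_def)
    assume "u \<in> B \<and> - (0, 2 * pi) + u \<in> B"
    with dom [of u] dom [of "- (0, 2 * pi) + u"] show False by simp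
  qed
qed

context sw_smooth_profile
begin

text \<open>The cut-off at \<open>0\<close> keeps the values in the cylinder for all arguments; it acts outside the half strip
  only, where there is no area.\<close>

definition cyl_lift :: "real \<times> real \<Rightarrow> R5" where
  "cyl_lift u = cyl_chart (max 0 (fst u), snd u)"

definition cyl_measure :: "R5 measure" where
  "cyl_measure = distr area_measure (restrict_space borel cylinder) cyl_lift"

lemma cyl_lift_measurable: "cyl_lift \<in> area_measure \<rightarrow>\<^sub>M restrict_space borel cylinder"
proof (rule measurable_restrict_space2)
  show "cyl_lift \<in> space area_measure \<rightarrow> cylinder"
    by (auto simp: cyl_lift_def cyl_chart_def cylinder_def)
  have "continuous_on UNIV cyl_lift"
    unfolding cyl_lift_def cyl_chart_def by (intro continuous_intros)
  then have "cyl_lift \<in> borel \<rightarrow>\<^sub>M borel" by (rule borel_measurable_continuous_onI)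
  then show "cyl_lift \<in> area_measure \<rightarrow>\<^sub>M borel" by (simp add: area_measure_def)
qed

lemma cyl_lift_half_strip: "u \<in> half_strip \<Longrightarrow> cyl_lift u = cyl_chart u"
  by (auto simp: cyl_lift_def half_strip_def max_def)

lemma emeasure_cyl_measure:
  assumes "B \<in> sets borel" "B \<subseteq> cyl_domain c \<inter> half_plane" "c = - pi \<or> c = 0"
  shows "emeasure cyl_measure (cyl_chart ` B) = (\<integral>\<^sup>+u\<in>B. ennreal (A (fst u)) \<partial>lborel)"
proof -
  have [measurable]: "B \<in> sets borel" by (rule assms)
  let ?v = "- (0, 2 * pi) :: real \<times> real"
  have "cyl_chart ` B \<in> sets borel" by (rule cyl_chart_image_borel [OF assms(1,2)])
  moreover have "cyl_chart ` B \<subseteq> cylinder"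
    using image_mono [OF assms(2), of cyl_chart] unfolding cyl_chart_image by blast
  ultimately have im: "cyl_chart ` B \<in> sets (restrict_space borel cylinder)"
    using cylinder_borel by (simp add: sets_restrict_space_iff)
  have pre: "cyl_lift -` (cyl_chart ` B) \<in> sets borel"
    using measurable_sets [OF cyl_lift_measurable im] by (simp add: area_measure_def)
  have [measurable]: "(\<lambda>u::real \<times> real. ?v + u) \<in> borel \<rightarrow>\<^sub>M borel"
    by (intro borel_measurable_continuous_onI continuous_intros)
  have B': "{u. ?v + u \<in> B} \<in> sets borel"
    using measurable_sets [of "\<lambda>u. ?v + u" borel borel B] by (simp add: vimage_def)
  (* the parts of the chart image over the half strip and over its translate by one period *)
  define g1 where "g1 u = ennreal (A (fst u)) * indicator (half_strip \<inter> B) u" for u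
  define g2 where "g2 u = ennreal (A (fst u)) * indicator (half_strip \<inter> {u. ?v + u \<in> B}) u" for u
  have [measurable]: "g1 \<in> borel_measurable borel" "g2 \<in> borel_measurable borel"
    using B' unfolding g1_def g2_def by measurable
  have "emeasure cyl_measure (cyl_chart ` B) = emeasure area_measure (cyl_lift -` (cyl_chart ` B))"
    unfolding cyl_measure_def by (subst emeasure_distr [OF cyl_lift_measurable im]) (simp add: area_measure_def)
  also have "\<dots> = (\<integral>\<^sup>+u. ennreal (indicator half_strip u * A (fst u)) * indicator (cyl_lift -` (cyl_chart ` B)) u \<partial>lborel)"
    unfolding area_measure_def using pre by (subst emeasure_density) auto
  also have "\<dots> = (\<integral>\<^sup>+u. g1 u + g2 u \<partial>lborel)"
  proof (rule nn_integral_cong)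
    fix u :: "real \<times> real"
    show "ennreal (indicator half_strip u * A (fst u)) * indicator (cyl_lift -` (cyl_chart ` B)) u = g1 u + g2 u"
    proof (cases "u \<in> half_strip")
      case True
      then show ?thesis
        using cyl_chart_in_image_iff [OF assms(2,3) True] cyl_lift_half_strip [OF True]
        by (cases "u \<in> B"; cases "?v + u \<in> B") (auto simp: g1_def g2_def)
    qed (simp add: g1_def g2_def)
  qed
  also have "\<dots> = (\<integral>\<^sup>+u. g1 u \<partial>lborel) + (\<integral>\<^sup>+u. g2 u \<partial>lborel)" by (rule nn_integral_add) auto
  also have "(\<integral>\<^sup>+u. g2 u \<partial>lborel) = (\<integral>\<^sup>+u. g2 (- ?v + u) \<partial>lborel)"
    by (rule nn_integral_lborel_translate) simp
  also have "(\<integral>\<^sup>+u. g1 u \<partial>lborel) + (\<integral>\<^sup>+u. g2 (- ?v + u) \<partial>lborel) = (\<integral>\<^sup>+u. g1 u + g2 (- ?v + u) \<partial>lborel)"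
  proof (rule nn_integral_add [symmetric])
    have "(\<lambda>u::real \<times> real. - ?v + u) \<in> borel \<rightarrow>\<^sub>M borel"
      by (intro borel_measurable_continuous_onI continuous_intros)
    from measurable_compose [OF this, of g2 borel] show "(\<lambda>u. g2 (- ?v + u)) \<in> borel_measurable lborel" by simp
  qed auto
  also have "\<dots> = (\<integral>\<^sup>+u\<in>B. ennreal (A (fst u)) \<partial>lborel)"
  proof (rule nn_integral_cong_AE)
    show "AE u in lborel. g1 u + g2 (- ?v + u) = ennreal (A (fst u)) * indicator B u"
      using AE_lborel_coordinate_neq(1) [of 0]
    proof eventually_elim
      case (elim u)
      have "?v + (- ?v + u) = u" by (rule add_minus_cancel)
      then have g2: "g2 (- ?v + u) = ennreal (A (fst u)) * (if 0 < fst u \<and> - 2 * pi \<le> snd u \<and> snd u < 0 \<and> u \<in> B then 1 else 0)"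
        unfolding g2_def indicator_def Int_iff mem_Collect_eq
        by (simp only:) (auto simp: half_strip_def mem_Times_iff)
      show ?case
      proof (cases "u \<in> B")
        case True
        then have "0 < fst u" "- pi < snd u" "snd u < 2 * pi"
          using elim assms(2,3) pi_gt_zero by (auto simp: half_plane_def cyl_domain_def)
        then show ?thesis
          using True pi_gt_zero unfolding g2
          by (cases "0 \<le> snd u") (auto simp: g1_def half_strip_def indicator_def mem_Times_iff)
      qed (unfold g2, simp add: g1_def)
    qed
  qed
  finally show ?thesis .
qed

lemma surface_varifold_G: "surface_varifold cylinder cyl_atlas G V"
proof -
  define P where "P x = frame_proj (G1 x) (G2 x)" for x
  have chart: "(\<forall>B\<in>sets borel. B \<subseteq> cyl_domain c \<inter> half_plane \<longrightarrow>
        emeasure cyl_measure (cyl_chart ` B) = (\<integral>\<^sup>+u\<in>B. ennreal (area_density (G \<circ> cyl_chart) u) \<partial>lborel)) \<and>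
      (\<forall>u\<in>cyl_domain c \<inter> half_plane. P (cyl_chart u) = plane_proj (tangent_plane (G \<circ> cyl_chart) u))"
    if "c = - pi \<or> c = 0" for c
    unfolding G_comp_chart area_density_all tangent_plane_all P_def G_chart
    using emeasure_cyl_measure that by blast
  have surj: "\<exists>u. x = cyl_chart u" if "x \<in> cylinder" for x
    using that unfolding cylinder_eq cyl_atlas_def by blast
  have nz: "G1 x \<noteq> 0 \<and> G2 x \<noteq> 0" if "x \<in> cylinder" for x
    using surj [OF that] frame_nonzero by (auto simp: G_chart)
  have ct: "continuous_on S (\<lambda>x::R5. a (snd (snd x)))" "continuous_on S (\<lambda>x::R5. b (snd (snd x)))"
    "continuous_on S (\<lambda>x::R5. sa (snd (snd x)))" "continuous_on S (\<lambda>x::R5. sb (snd (snd x)))" for S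
    by (rule continuous_on_compose2 [OF cont(1)] continuous_on_compose2 [OF cont(2)]
      continuous_on_compose2 [OF cont(3)] continuous_on_compose2 [OF cont(4)];
      auto intro!: continuous_intros)+
  have "continuous_on cylinder G1" "continuous_on cylinder G2"
    unfolding G1_def G2_def by (intro continuous_intros ct)+
  then have "continuous_on cylinder (\<lambda>x. (G x, P x))"
    unfolding P_def using nz by (intro continuous_on_Pair continuous_G continuous_on_frame_proj) auto
  then have m: "(\<lambda>x. (G x, P x)) \<in> restrict_space borel cylinder \<rightarrow>\<^sub>M borel"
    by (rule borel_measurable_continuous_on_restrict)
  have lift: "lift \<in> area_measure \<rightarrow>\<^sub>M borel" using measurable_lift by (simp add: area_measure_def)
  have "AE u in area_measure. u \<in> half_strip"
    unfolding area_measure_def by (subst AE_density) (auto simp: indicator_def)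
  then have "AE u in area_measure. ((\<lambda>x. (G x, P x)) \<circ> cyl_lift) u = lift u"
    by eventually_elim (simp add: cyl_lift_half_strip lift_half_strip P_def G_chart)
  then have "distr area_measure borel ((\<lambda>x. (G x, P x)) \<circ> cyl_lift) = V"
    unfolding V_eq using m lift cyl_lift_measurable by (intro distr_cong_AE) (auto intro: measurable_comp)
  then have "V = distr cyl_measure borel (\<lambda>x. (G x, P x))"
    unfolding cyl_measure_def by (subst distr_distr [OF m cyl_lift_measurable]) simp
  moreover have "sets cyl_measure = sets (restrict_space borel cylinder)" by (simp add: cyl_measure_def)
  ultimately show ?thesis
    unfolding surface_varifold_def cyl_atlas_def using chart
    by (intro exI [of _ cyl_measure] exI [of _ P]) auto
qed

lemma smooth_hs_self_similar_V: "smooth_hs_self_similar V (- kap / (2 * (real p - real q)))"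
  unfolding smooth_hs_self_similar_def
  using oriented_surface_cylinder lagrangian_immersion_G hamiltonian_stationary_G self_similar_G
    surface_varifold_G by blast

end


section \<open>The eternal motion\<close>

context sw_motion
begin

lemma rad_smooth:
  "smooth_on UNIV (\<lambda>x::R5. ra t (snd (snd x)))" "smooth_on UNIV (\<lambda>x::R5. rb t (snd (snd x)))"
proof -
  have y: "smooth_on UNIV (\<lambda>x::R5. snd (snd x))"
    using bounded_linear_compose [OF bounded_linear_snd bounded_linear_snd]
    by (intro smooth_on_linear open_UNIV) (simp add: o_def)
  have lin: "smooth_on UNIV (\<lambda>x::R5. c * snd (snd x))" for c :: real
    by (intro smooth_on_mult smooth_on_const open_UNIV y)
  have root: "smooth_on UNIV (\<lambda>x::R5. sqrt (c * (snd (snd x))\<^sup>2 + k))" if "\<And>y. 0 < c * y\<^sup>2 + k" for c k :: real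
    by (intro smooth_on_sqrt smooth_on_add smooth_on_mult smooth_on_power smooth_on_const open_UNIV y that)
  show "smooth_on UNIV (\<lambda>x::R5. ra t (snd (snd x)))"
    unfolding rad_a_def
    by (cases "t < 0") (simp_all only: if_True if_False lin root [OF radicand_pos(1)])
  show "smooth_on UNIV (\<lambda>x::R5. rb t (snd (snd x)))"
    unfolding rad_b_def
    by (cases "t > 0") (simp_all only: if_True if_False lin root [OF radicand_pos(2)])
qed

text \<open>Both squares are even in \<open>y\<close>.\<close>

lemma rad_level: "real p * (ra t y)\<^sup>2 - real q * (rb t y)\<^sup>2 = - 2 * (real p - real q) * t"
proof -
  have "(ra t y)\<^sup>2 = (ra t \<bar>y\<bar>)\<^sup>2" "(rb t y)\<^sup>2 = (rb t \<bar>y\<bar>)\<^sup>2"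
    by (simp_all add: rad_a_def rad_b_def power_mult_distrib)
  then show ?thesis using rad_squares(2) [of "\<bar>y\<bar>" t] by simp
qed

lemma rad_s_continued:
  "t < 0 \<Longrightarrow> rsb t y = lam / (real p * ra t y) * rb t y"
  "0 < t \<Longrightarrow> rsa t y = nu / (real q * rb t y) * ra t y"
proof -
  have l: "lam * lam / real p = 1 / real (p + q)" "nu * nu / real q = 1 / real (p + q)"
    using lam_nu weights_pos by simp_all
  show "rsb t y = lam / (real p * ra t y) * rb t y" if "t < 0"
  proof -
    have "lam / (real p * ra t y) * (lam * y) = (lam * lam / real p) * (y / ra t y)" by simp
    then show ?thesis using that unfolding l by (simp add: rad_sb_def rad_b_def lam_def)
  qed
  show "rsa t y = nu / (real q * rb t y) * ra t y" if "0 < t"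
  proof -
    have "nu / (real q * rb t y) * (nu * y) = (nu * nu / real q) * (y / rb t y)" by simp
    then show ?thesis using that unfolding l by (simp add: rad_sa_def rad_a_def nu_def)
  qed
qed

text \<open>The factor \<open>s\<close>, continued to negative \<open>y\<close>.\<close>

definition rate :: "real \<Rightarrow> real \<Rightarrow> real" where
  "rate t y = (if t < 0 then lam / (real p * ra t y) else nu / (real q * rb t y))"

lemma smooth_profile:
  assumes "t \<noteq> 0"
  shows "sw_smooth_profile p q (ra t) (rb t) (rsa t) (rsb t)
    (\<lambda>y. y / (real (p + q) * ra t y * rb t y)) (rate t) (- 2 * (real p - real q) * t)"
proof (unfold_locales)
  fix y
  show "(ra t has_real_derivative q * rsb t y) (at y)" by (rule rad_a_derivative)
  show "(rb t has_real_derivative p * rsa t y) (at y)" by (rule rad_b_derivative)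
  show "real p * (ra t y)\<^sup>2 - real q * (rb t y)\<^sup>2 = - 2 * (real p - real q) * t" by (rule rad_level)
  consider "t < 0" | "0 < t" using assms by linarith
  then have "0 < rate t y \<and> rsa t y = rate t y * ra t y \<and> rsb t y = rate t y * rb t y \<and>
      (\<exists>d. (rate t has_real_derivative d) (at y)) \<and> (ra t y \<noteq> 0 \<or> rb t y \<noteq> 0)"
  proof cases
    case 1
    note a = rad_a_pos [OF 1, of y]
    have r: "rate t = (\<lambda>y. lam / (real p * ra t y))" using 1 by (simp add: rate_def fun_eq_iff)
    have "real p * ra t y \<noteq> 0" using a weights_pos by simp
    from DERIV_divide [OF DERIV_const [of lam] DERIV_cmult [OF rad_a_derivative] this]
    have "\<exists>d. (rate t has_real_derivative d) (at y)" unfolding r by (rule exI)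
    moreover have "rsa t y = lam / real p" using 1 by (simp add: rad_sa_def lam_def)
    ultimately show ?thesis using a lam_nu weights_pos rad_s_continued(1) [OF 1, of y] unfolding r by simp
  next
    case 2
    note b = rad_b_pos [OF 2, of y]
    have r: "rate t = (\<lambda>y. nu / (real q * rb t y))" using 2 by (simp add: rate_def fun_eq_iff)
    have "real q * rb t y \<noteq> 0" using b weights_pos by simp
    from DERIV_divide [OF DERIV_const [of nu] DERIV_cmult [OF rad_b_derivative] this]
    have "\<exists>d. (rate t has_real_derivative d) (at y)" unfolding r by (rule exI)
    moreover have "rsb t y = nu / real q" using 2 by (simp add: rad_sb_def nu_def)
    ultimately show ?thesis using b lam_nu weights_pos rad_s_continued(2) [OF 2, of y] unfolding r by simp
  qed
  then show "0 < rate t y" "rsa t y = rate t y * ra t y" "rsb t y = rate t y * rb t y"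
    "\<exists>d. (rate t has_real_derivative d) (at y)" "ra t y \<noteq> 0 \<or> rb t y \<noteq> 0" by blast+
qed (rule rad_smooth)+

lemma self_similar_V:
  assumes "t \<noteq> 0"
  shows "smooth_hs_self_similar (pr.V t) t"
proof -
  have "- (- 2 * d * t) / (2 * d) = t" if "d \<noteq> 0" for d :: real using that by simp
  from this [of "real p - real q"]
  have "- (- 2 * (real p - real q) * t) / (2 * (real p - real q)) = t" using weights_pos by linarith
  then show ?thesis
    using sw_smooth_profile.smooth_hs_self_similar_V [OF smooth_profile [OF assms]] by simp
qed

lemma V_0: "pr.V 0 = sw_cone_varifold p q"
proof -
  have "pr.F 0 = sw_param p q"
    by (auto simp: fun_eq_iff pr.F_def sw_point_def sw_param_def sw_curve_def rad_a_def rad_b_def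
        scaleR_conv_of_real mult_ac)
  then show ?thesis by (simp add: pr.V_def sw_cone_varifold_def half_strip_def)
qed

lemma eternal_motion: "hs_self_similar_eternal_brakke_motion pr.V"
  unfolding hs_self_similar_eternal_brakke_motion_def hs_self_shrinker_def hs_self_expander_def
  using brakke_motion_V without_mass_loss_V self_similar_V by (metis less_irrefl)

lemma approaches_cone:
  "approaches pr.V (sw_cone_varifold p q) (at_left 0)" "approaches pr.V (sw_cone_varifold p q) (at_right 0)"
  unfolding approaches_def V_0 [symmetric]
  using mass_tendsto by (auto simp: filterlim_at_split)

end

theorem theorem1p2:
  fixes p q :: nat
  assumes "0 < q" and "q < p" and "coprime p q" and "1 < q"
  shows "\<exists>V :: real \<Rightarrow> C2 varifold.
    hs_self_similar_eternal_brakke_motion V \<and>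
    approaches V (sw_cone_varifold p q) (at_left 0) \<and>
    approaches V (sw_cone_varifold p q) (at_right 0)"
proof -
  interpret sw_motion p q using assms by unfold_locales
  show ?thesis using eternal_motion approaches_cone by blast
qed

end
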